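(* Let $T>0$, $\mu\in\{1,-1\}$, $u_0\in H^1(\mathbb{T})$, and assume that the solution $u$ to the nonlinear Schrödinger equation $$\mathrm{i}\partial_t u+\partial_x^2 u=\mu|u|^2u \quad\text{on } [0,T]\times\mathbb{T},\qquad u(0)=u_0,$$ satisfies $u(t)\in H^1(\mathbb{T})$ for all $t\in[0,T]$. For a step size $\tau>0$ let $(u_n)_{n\ge 0}$ be defined recursively, starting from $u_0$, by $$u_{n+1}=e^{\mathrm{i}\tau\partial_x^2}\Big(u_n-\mathrm{i}\tau\mu\,(u_n)^2\,\varphi_1(-2\mathrm{i}\tau\partial_x^2)\bar u_n\Big).$$ Then there are a constant $C>0$ and a maximum step size $\tau_0>0$, depending only on $T$ and $\|u\|_{L^\infty([0,T],H^1(\mathbb{T}))}$, such that $$\|u(n\tau)-u_n\|_{L^2(\mathbb{T})}\le C\tau$$ for all $\tau\in(0,\tau_0]$ and all integers $n\ge 0$ with $n\tau\le T$.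
   Context: $\mathbb{T}=\mathbb{R}/\mathbb{Z}$ is the one-dimensional torus; functions are complex-valued and $\bar u$ is the complex conjugate. $H^r(\mathbb{T})$ is the usual $L^2$-based Sobolev space. $e^{\mathrm{i}t\partial_x^2}$, $t\in\mathbb{R}$, is the Schrödinger group (a Fourier multiplier). The operator $\varphi_1(-2\mathrm{i}\tau\partial_x^2)$ is defined for $f\in L^2(\mathbb{T})$ by $$\varphi_1(-2\mathrm{i}\tau\partial_x^2)f=\frac1\tau\int_0^\tau e^{-2\mathrm{i}s\partial_x^2}f\,\mathrm{d}s.$$ A solution $u$ is understood as $u\in C([0,T],H^1(\mathbb{T}))\cap C^1([0,T],H^{-1}(\mathbb{T}))$ satisfying the equation in $H^{-1}(\mathbb{T})$ for all $t\in[0,T]$ and the initial condition. *)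

theory Defs
  imports "HOL-Analysis.Analysis" "HOL-Probability.Essential_Supremum"
begin

text \<open>
  Functions on the torus \<open>\<real>/\<int>\<close> are \<open>1\<close>-periodic functions on the real line. Elements of
  \<open>L\<^sup>2\<close> are handled through representatives: nothing below depends on which
  (\<open>1\<close>-periodic) representative of an almost-everywhere class is used.
\<close>

definition L2_torus :: "(real \<Rightarrow> complex) set" where
  "L2_torus = {f. (\<forall>x. f (x + 1) = f x) \<and>
      f \<in> borel_measurable (lebesgue_on {0..1}) \<and>
      integrable (lebesgue_on {0..1}) (\<lambda>x. (cmod (f x))\<^sup>2)}"

definition L2_inner :: "(real \<Rightarrow> complex) \<Rightarrow> (real \<Rightarrow> complex) \<Rightarrow> complex" where
  "L2_inner f g = (LINT x|lebesgue_on {0..1}. f x * cnj (g x))"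

definition L2_norm :: "(real \<Rightarrow> complex) \<Rightarrow> real" where
  "L2_norm f = sqrt (LINT x|lebesgue_on {0..1}. (cmod (f x))\<^sup>2)"

definition fourier_coeff :: "(real \<Rightarrow> complex) \<Rightarrow> int \<Rightarrow> complex" where
  "fourier_coeff f k = (LINT x|lebesgue_on {0..1}. f x * cis (- (2 * pi * of_int k * x)))"

text \<open>
  The space \<open>H\<^sup>r\<close> for arbitrary real \<open>r\<close>. For negative \<open>r\<close> its elements are periodic
  distributions; a periodic distribution is identified with the family of its Fourier
  coefficients, and a function \<open>f\<close> is viewed as the distribution \<open>fourier_coeff f\<close>.
  \<open>sobolev_norm\<close> is meaningful only on elements of \<open>sobolev_space r\<close>.
\<close>

definition sobolev_space :: "real \<Rightarrow> (int \<Rightarrow> complex) set" where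
  "sobolev_space r =
     {c. (\<lambda>k. (1 + (2 * pi * of_int k)\<^sup>2) powr r * (cmod (c k))\<^sup>2) summable_on UNIV}"

definition sobolev_norm :: "real \<Rightarrow> (int \<Rightarrow> complex) \<Rightarrow> real" where
  "sobolev_norm r c =
     sqrt (\<Sum>\<^sub>\<infinity>k. (1 + (2 * pi * of_int k)\<^sup>2) powr r * (cmod (c k))\<^sup>2)"

definition H1_torus :: "(real \<Rightarrow> complex) set" where
  "H1_torus = {f \<in> L2_torus. fourier_coeff f \<in> sobolev_space 1}"

definition H1_norm :: "(real \<Rightarrow> complex) \<Rightarrow> real" where
  "H1_norm f = sobolev_norm 1 (fourier_coeff f)"

definition dist_deriv :: "(int \<Rightarrow> complex) \<Rightarrow> int \<Rightarrow> complex" where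
  "dist_deriv c k = 2 * pi * \<i> * of_int k * c k"

definition sobolev_continuous :: "real \<Rightarrow> real \<Rightarrow> (real \<Rightarrow> int \<Rightarrow> complex) \<Rightarrow> bool" where
  "sobolev_continuous r T c \<longleftrightarrow>
     (\<forall>t\<in>{0..T}. c t \<in> sobolev_space r) \<and>
     (\<forall>t\<in>{0..T}. ((\<lambda>s. sobolev_norm r (\<lambda>k. c s k - c t k)) \<longlongrightarrow> 0) (at t within {0..T}))"

text \<open>\<open>v\<close> is the derivative on \<open>[0,T]\<close> (one-sided at the end points) of the \<open>H\<^sup>r\<close>-valued curve \<open>c\<close>.\<close>

definition sobolev_has_derivative ::
    "real \<Rightarrow> real \<Rightarrow> (real \<Rightarrow> int \<Rightarrow> complex) \<Rightarrow> (real \<Rightarrow> int \<Rightarrow> complex) \<Rightarrow> bool" where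
  "sobolev_has_derivative r T c v \<longleftrightarrow>
     (\<forall>t\<in>{0..T}. c t \<in> sobolev_space r \<and> v t \<in> sobolev_space r) \<and>
     (\<forall>t\<in>{0..T}. ((\<lambda>s. sobolev_norm r (\<lambda>k. (c s k - c t k) / of_real (s - t) - v t k)) \<longlongrightarrow> 0)
        (at t within {0..T}))"

definition NLS_solution ::
    "real \<Rightarrow> real \<Rightarrow> (real \<Rightarrow> complex) \<Rightarrow> (real \<Rightarrow> real \<Rightarrow> complex) \<Rightarrow> bool" where
  "NLS_solution T \<mu> u0 u \<longleftrightarrow>
     (\<forall>t\<in>{0..T}. u t \<in> H1_torus) \<and>
     sobolev_continuous 1 T (\<lambda>t. fourier_coeff (u t)) \<and>
     (\<exists>v. sobolev_has_derivative (-1) T (\<lambda>t. fourier_coeff (u t)) v \<and>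
          sobolev_continuous (-1) T v \<and>
          (\<forall>t\<in>{0..T}. \<forall>k. \<i> * v t k + dist_deriv (dist_deriv (fourier_coeff (u t))) k =
             of_real \<mu> * fourier_coeff (\<lambda>x. (of_real (cmod (u t x)))\<^sup>2 * u t x) k)) \<and>
     (AE x in lebesgue_on {0..1}. u 0 x = u0 x)"

definition Linf_H1_norm :: "real \<Rightarrow> (real \<Rightarrow> real \<Rightarrow> complex) \<Rightarrow> ereal" where
  "Linf_H1_norm T u = esssup (lebesgue_on {0..T}) (\<lambda>t. ereal (H1_norm (u t)))"

text \<open>
  The operators below yield elements of \<open>L\<^sup>2\<close>, that is, functions that are determined
  only up to null sets; the choice operator picks a representative.
\<close>

definition fourier_multiplier :: "(int \<Rightarrow> complex) \<Rightarrow> (real \<Rightarrow> complex) \<Rightarrow> real \<Rightarrow> complex" where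
  "fourier_multiplier m f =
     (SOME g. g \<in> L2_torus \<and> (\<forall>k. fourier_coeff g k = m k * fourier_coeff f k))"

text \<open>The group \<open>exp(\<i> t \<partial>\<^sub>x\<^sup>2)\<close>; the symbol of \<open>\<partial>\<^sub>x\<^sup>2\<close> is \<open>-(2 \<pi> k)\<^sup>2\<close>.\<close>

definition schroedinger :: "real \<Rightarrow> (real \<Rightarrow> complex) \<Rightarrow> real \<Rightarrow> complex" where
  "schroedinger t = fourier_multiplier (\<lambda>k. exp (\<i> * of_real t * of_real (- ((2 * pi * of_int k)\<^sup>2))))"

text \<open>
  The integral of an \<open>L\<^sup>2\<close>-valued function over \<open>[a,b]\<close>, in the weak (Gelfand-Pettis) sense;
  for continuous integrands it is the usual Riemann or Bochner integral.
\<close>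

definition L2_integral :: "real \<Rightarrow> real \<Rightarrow> (real \<Rightarrow> real \<Rightarrow> complex) \<Rightarrow> real \<Rightarrow> complex" where
  "L2_integral a b F =
     (SOME g. g \<in> L2_torus \<and>
        (\<forall>h\<in>L2_torus. L2_inner g h = integral {a..b} (\<lambda>s. L2_inner (F s) h)))"

text \<open>The operator \<open>\<phi>\<^sub>1(-2 \<i> \<tau> \<partial>\<^sub>x\<^sup>2)\<close>.\<close>

definition phi1 :: "real \<Rightarrow> (real \<Rightarrow> complex) \<Rightarrow> real \<Rightarrow> complex" where
  "phi1 \<tau> f = (\<lambda>x. of_real (1 / \<tau>) * L2_integral 0 \<tau> (\<lambda>s. schroedinger (- 2 * s) f) x)"

primrec scheme :: "real \<Rightarrow> real \<Rightarrow> (real \<Rightarrow> complex) \<Rightarrow> nat \<Rightarrow> real \<Rightarrow> complex" where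
  "scheme \<tau> \<mu> u0 0 = u0"
| "scheme \<tau> \<mu> u0 (Suc n) =
     schroedinger \<tau> (\<lambda>x. scheme \<tau> \<mu> u0 n x
        - \<i> * of_real \<tau> * of_real \<mu> * (scheme \<tau> \<mu> u0 n x)\<^sup>2
          * phi1 \<tau> (\<lambda>y. cnj (scheme \<tau> \<mu> u0 n y)) x)"

end

theory Submission
  imports Defs
begin

text \<open>
  Let \<open>U(t)\<close> denote the Schroedinger group and write \<open>v = u(t\<^sub>n)\<close>. Replacing \<open>u(t\<^sub>n + s)\<close> by
  \<open>U(s) v\<close> in Duhamel's formula changes the solution by \<open>O(\<tau>\<^sup>2)\<close> in \<open>L\<^sup>2\<close> per step; the scheme makes
  the further replacement of \<open>U(-s) (|U(s) v|\<^sup>2 U(s) v)\<close> by \<open>v\<^sup>2 U(-2s) cnj v\<close>. On a frequency triple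
  the two differ by a factor \<open>exp (\<i> s \<theta>)\<close> in which \<open>\<theta>\<close> is a combination of products of two
  frequencies, so the difference costs one derivative on each of two factors. For data in \<open>H\<^sup>1\<close> a
  product of two derivatives is merely in \<open>L\<^sup>1\<close>, and estimating each local error by itself does not
  give \<open>O(\<tau>\<^sup>2)\<close> in \<open>L\<^sup>2\<close>.

  The sum of the local errors is nevertheless \<open>O(\<tau>)\<close>. Writing \<open>exp (\<i> s \<theta>) - 1\<close> as an integral over
  an intermediate time turns the difference into products of linear flows of the derivative of \<open>v\<close>.
  The local error is thus bounded by \<open>O(\<tau>\<^sup>2)\<close> plus \<open>\<tau>\<close> times a space-time integral of the fourth power
  of such a flow over a window of length \<open>2 \<tau>\<close> (\<open>resonance_error\<close>, \<open>local_error\<close>). The periodic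
  \<open>L\<^sup>4\<close> Strichartz estimate (\<open>strichartz_periodic\<close>) controls the integral over \<open>[0, T]\<close> for one fixed
  datum. The datum changes from step to step, but slowly: the profile \<open>U(-t) u(t)\<close> is Lipschitz in
  \<open>H\<^sup>1\<close>, so it is a telescoping sum of increments of total size \<open>O(1)\<close>, and convexity of the fourth
  power reduces the sum over all windows to the Strichartz estimate for each increment
  (\<open>strichartz_along_profile\<close>).

  Stability of the scheme in \<open>L\<^sup>2\<close> requires only a bound on the \<open>l\<^sup>1\<close> norm of the Fourier
  coefficients of the iterates. Applied to differences of translates, the same estimate shows that
  the \<open>H\<^sup>1\<close> norm of the iterates grows by a factor \<open>1 + O(\<tau>)\<close> per step. The \<open>l\<^sup>1\<close> bound is then
  obtained by a bootstrap argument (\<open>coefficient_convergence\<close>): the error is small in \<open>L\<^sup>2\<close>, hence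
  on any finite set of frequencies, and the \<open>H\<^sup>1\<close> bound takes care of the remaining ones.

  Since all functions involved have summable Fourier coefficients, the argument takes place on
  coefficient sequences, with products formed in physical space and estimated through Bessel's
  inequality; \<open>fourier_uniqueness\<close> connects the two sides.
\<close>

section \<open>Integration over one period\<close>

abbreviation torus :: "real measure" where
  "torus \<equiv> lebesgue_on {0..1}"

definition mode :: "int \<Rightarrow> real \<Rightarrow> complex" where
  "mode k x = cis (2 * pi * of_int k * x)"

lemma norm_mode [simp]: "norm (mode k x) = 1"
  by (simp add: mode_def)

lemma mode_0 [simp]: "mode 0 x = 1"
  by (simp add: mode_def)

lemma mode_add_left: "mode (j + k) x = mode j x * mode k x"
  by (simp add: mode_def cis_mult algebra_simps)

lemma mode_add_right: "mode k (x + y) = mode k x * mode k y"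
  by (simp add: mode_def cis_mult algebra_simps)

lemma cnj_mode: "cnj (mode k x) = mode (- k) x"
  by (simp add: mode_def cis_cnj)

lemma mode_periodic [simp]: "mode k (x + 1) = mode k x"
proof -
  have "mode k 1 = 1"
    unfolding mode_def using cis_multiple_2pi[of "of_int k"] by (simp add: mult.assoc)
  then show ?thesis by (simp add: mode_add_right)
qed

lemma continuous_on_mode [continuous_intros]:
  "continuous_on A f \<Longrightarrow> continuous_on A (\<lambda>x. mode k (f x))"
  unfolding mode_def by (intro continuous_intros)

lemma fourier_coeff_mode: "fourier_coeff f k = (LINT x|torus. f x * mode (- k) x)"
  by (simp add: fourier_coeff_def mode_def)

lemma finite_measure_period [simp]: "finite_measure torus"
  by (rule finite_measure_lebesgue_on) simp

lemma measure_period [simp]: "measure torus {0..1} = 1"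
  by (simp add: measure_restrict_space)

lemma integral_period_const [simp]:
  "(LINT x|torus. c) = (c :: 'a :: {banach,second_countable_topology})"
  by (simp only: Bochner_Integration.lebesgue_integral_const space_lebesgue_on measure_period scaleR_one)

lemma measurable_period_continuous:
  fixes f :: "real \<Rightarrow> 'a :: {second_countable_topology, euclidean_space}"
  assumes "continuous_on UNIV f"
  shows "f \<in> borel_measurable torus"
  using assms by (intro continuous_imp_measurable_on_sets_lebesgue) (auto intro: continuous_on_subset)

lemma integrable_period_bounded:
  fixes f :: "real \<Rightarrow> 'a :: {second_countable_topology, banach}"
  assumes "f \<in> borel_measurable torus" and "\<And>x. x \<in> {0..1} \<Longrightarrow> norm (f x) \<le> B"
  shows "integrable torus f"
  using assms by (intro finite_measure.integrable_const_bound[where B = B] finite_measure_period)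
    (auto intro: AE_I2)

lemma integrable_period_continuous:
  fixes f :: "real \<Rightarrow> 'a :: {second_countable_topology, euclidean_space}"
  assumes "continuous_on UNIV f"
  shows "integrable torus f"
proof -
  have "compact (f ` {0..1})"
    using assms by (intro compact_continuous_image) (auto intro: continuous_on_subset)
  then obtain B where "\<And>x. x \<in> {0..1} \<Longrightarrow> norm (f x) \<le> B"
    by (meson bounded_iff compact_imp_bounded image_eqI)
  then show ?thesis
    using assms by (intro integrable_period_bounded measurable_period_continuous)
qed

lemma integrable_times_continuous:
  fixes f g :: "real \<Rightarrow> complex"
  assumes g: "integrable torus g" and f: "continuous_on UNIV f"
  shows "integrable torus (\<lambda>x. f x * g x)"
proof -
  have "compact (f ` {0..1})"
    using f by (intro compact_continuous_image) (auto intro: continuous_on_subset)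
  then obtain B where B: "\<And>x. x \<in> {0..1} \<Longrightarrow> norm (f x) \<le> B"
    by (meson bounded_iff compact_imp_bounded image_eqI)
  have B0: "0 \<le> B" using order_trans[OF norm_ge_zero B[of 0]] by simp
  show ?thesis
  proof (rule Bochner_Integration.integrable_bound)
    show "integrable torus (\<lambda>x. B * norm (g x))"
      using g by (intro integrable_mult_right integrable_norm)
    show "(\<lambda>x. f x * g x) \<in> borel_measurable torus"
      using borel_measurable_integrable[OF g] measurable_period_continuous[OF f]
      by (rule borel_measurable_times[rotated])
    show "AE x in torus. norm (f x * g x) \<le> norm (B * norm (g x))"
      using B B0 by (intro AE_I2) (simp add: norm_mult mult_right_mono)
  qed
qed

lemma integral_period_eq_integral:
  fixes f :: "real \<Rightarrow> 'a :: {second_countable_topology, euclidean_space}"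
  assumes "continuous_on UNIV f"
  shows "(LINT x|torus. f x) = integral {0..1} f"
  using assms by (intro lebesgue_integral_eq_integral integrable_period_continuous) auto

lemma integral_mode: "(LINT x|torus. mode k x) = (if k = 0 then 1 else 0)"
proof (cases "k = 0")
  case False
  define F where "F = (\<lambda>x. mode k x / (2 * pi * of_int k * \<i>))"
  have "(mode k has_integral (F 1 - F 0)) {0..1}"
  proof (rule fundamental_theorem_of_calculus)
    fix x :: real
    have "((\<lambda>x. cis (2 * pi * of_int k * x)) has_vector_derivative
        (2 * pi * of_int k) *\<^sub>R (\<i> * cis (2 * pi * of_int k * x))) (at x within {0..1})"
      unfolding has_vector_derivative_def
      by (auto intro!: derivative_eq_intros simp: algebra_simps)
    then have "(F has_vector_derivative
        (2 * pi * of_int k) *\<^sub>R (\<i> * mode k x) / (2 * pi * of_int k * \<i>)) (at x within {0..1})"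
      unfolding F_def mode_def by (rule has_vector_derivative_divide)
    then show "(F has_vector_derivative mode k x) (at x within {0..1})"
      using False by (simp add: scaleR_conv_of_real field_simps)
  qed simp
  moreover have "F 1 = F 0"
    using mode_periodic[of k 0] by (simp add: F_def)
  ultimately show ?thesis
    using False by (simp add: integral_period_eq_integral continuous_intros integral_unique
       )
qed simp

section \<open>Norms of coefficient sequences\<close>

text \<open>Norm bounds are expressed through finite sums, so that they imply summability instead of presupposing it.\<close>

definition l1_le :: "(int \<Rightarrow> complex) \<Rightarrow> real \<Rightarrow> bool" where
  "l1_le c R \<longleftrightarrow> (\<forall>K. finite K \<longrightarrow> (\<Sum>k\<in>K. cmod (c k)) \<le> R)"

definition l2_le :: "(int \<Rightarrow> complex) \<Rightarrow> real \<Rightarrow> bool" where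
  "l2_le c B \<longleftrightarrow> (\<forall>K. finite K \<longrightarrow> L2_set (\<lambda>k. cmod (c k)) K \<le> B)"

lemma l1_leD: "l1_le c R \<Longrightarrow> finite K \<Longrightarrow> (\<Sum>k\<in>K. cmod (c k)) \<le> R"
  by (simp add: l1_le_def)

lemma l2_leD: "l2_le c B \<Longrightarrow> finite K \<Longrightarrow> L2_set (\<lambda>k. cmod (c k)) K \<le> B"
  by (simp add: l2_le_def)

lemma l1_le_nonneg: "l1_le c R \<Longrightarrow> 0 \<le> R"
  using l1_leD[of c R "{}"] by simp

lemma l2_le_nonneg: "l2_le c B \<Longrightarrow> 0 \<le> B"
  using l2_leD[of c B "{}"] by simp

lemma l1_le_summable: "l1_le c R \<Longrightarrow> (\<lambda>k. cmod (c k)) summable_on UNIV"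
  by (rule nonneg_bdd_above_summable_on) (auto simp: l1_le_def intro!: bdd_aboveI[where M = R])

lemma summable_imp_l1_le:
  "(\<lambda>k. cmod (c k)) summable_on UNIV \<Longrightarrow> l1_le c (\<Sum>\<^sub>\<infinity>k. cmod (c k))"
  by (auto simp: l1_le_def intro!: finite_sum_le_infsum)

lemma l1_le_infsum: "l1_le c R \<Longrightarrow> (\<Sum>\<^sub>\<infinity>k. cmod (c k)) \<le> R"
  by (rule infsum_le_finite_sums[OF l1_le_summable]) (auto simp: l1_le_def)

lemma l2_le_iff: "l2_le c B \<longleftrightarrow> 0 \<le> B \<and> (\<forall>K. finite K \<longrightarrow> (\<Sum>k\<in>K. (cmod (c k))\<^sup>2) \<le> B\<^sup>2)"
proof -
  have "L2_set (\<lambda>k. cmod (c k)) K \<le> B \<longleftrightarrow> (\<Sum>k\<in>K. (cmod (c k))\<^sup>2) \<le> B\<^sup>2" if "0 \<le> B" for K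
    unfolding L2_set_def using that real_sqrt_le_iff[of _ "B\<^sup>2"] by simp
  then show ?thesis
    using l2_le_nonneg[of c B] unfolding l2_le_def by blast
qed

lemma l1_le_cmod_mono: "l1_le c R \<Longrightarrow> (\<And>k. cmod (d k) \<le> cmod (c k)) \<Longrightarrow> l1_le d R"
  unfolding l1_le_def by (meson order_trans sum_mono)

lemma l2_le_cmod_mono: "l2_le c B \<Longrightarrow> (\<And>k. cmod (d k) \<le> cmod (c k)) \<Longrightarrow> l2_le d B"
  unfolding l2_le_def by (meson order_trans L2_set_mono norm_ge_zero)

lemma l1_le_mono: "l1_le c R \<Longrightarrow> R \<le> S \<Longrightarrow> l1_le c S"
  unfolding l1_le_def by (meson order_trans)

lemma l2_le_mono: "l2_le c B \<Longrightarrow> B \<le> S \<Longrightarrow> l2_le c S"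
  unfolding l2_le_def by (meson order_trans)

lemma l1_le_add: "l1_le c R \<Longrightarrow> l1_le d S \<Longrightarrow> l1_le (\<lambda>k. c k + d k) (R + S)"
  unfolding l1_le_def
proof (intro allI impI)
  fix K :: "int set"
  assume "\<forall>K. finite K \<longrightarrow> (\<Sum>k\<in>K. cmod (c k)) \<le> R" "\<forall>K. finite K \<longrightarrow> (\<Sum>k\<in>K. cmod (d k)) \<le> S"
    "finite K"
  moreover have "(\<Sum>k\<in>K. cmod (c k + d k)) \<le> (\<Sum>k\<in>K. cmod (c k)) + (\<Sum>k\<in>K. cmod (d k))"
    unfolding sum.distrib[symmetric] by (intro sum_mono norm_triangle_ineq)
  ultimately show "(\<Sum>k\<in>K. cmod (c k + d k)) \<le> R + S" by force
qed

lemma l2_le_add: "l2_le c B \<Longrightarrow> l2_le d S \<Longrightarrow> l2_le (\<lambda>k. c k + d k) (B + S)"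
  unfolding l2_le_def
proof (intro allI impI)
  fix K :: "int set"
  assume *: "\<forall>K. finite K \<longrightarrow> L2_set (\<lambda>k. cmod (c k)) K \<le> B"
    "\<forall>K. finite K \<longrightarrow> L2_set (\<lambda>k. cmod (d k)) K \<le> S" "finite K"
  have "L2_set (\<lambda>k. cmod (c k + d k)) K \<le> L2_set (\<lambda>k. cmod (c k) + cmod (d k)) K"
    by (intro L2_set_mono norm_triangle_ineq) simp
  also have "\<dots> \<le> L2_set (\<lambda>k. cmod (c k)) K + L2_set (\<lambda>k. cmod (d k)) K"
    by (rule L2_set_triangle_ineq)
  finally show "L2_set (\<lambda>k. cmod (c k + d k)) K \<le> B + S" using * by force
qed

lemma l1_le_mult: "l1_le c R \<Longrightarrow> (\<And>k. cmod (m k) \<le> L) \<Longrightarrow> l1_le (\<lambda>k. m k * c k) (L * R)"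
  unfolding l1_le_def
proof (intro allI impI)
  fix K :: "int set"
  assume *: "\<forall>K. finite K \<longrightarrow> (\<Sum>k\<in>K. cmod (c k)) \<le> R" "\<And>k. cmod (m k) \<le> L" "finite K"
  have "0 \<le> L" using *(2)[of 0] norm_ge_zero order_trans by blast
  have "(\<Sum>k\<in>K. cmod (m k * c k)) \<le> (\<Sum>k\<in>K. L * cmod (c k))"
    by (intro sum_mono) (simp add: norm_mult *(2) mult_right_mono)
  also have "\<dots> = L * (\<Sum>k\<in>K. cmod (c k))" by (simp add: sum_distrib_left)
  also have "\<dots> \<le> L * R" using * \<open>0 \<le> L\<close> by (intro mult_left_mono) auto
  finally show "(\<Sum>k\<in>K. cmod (m k * c k)) \<le> L * R" .
qed

lemma l2_le_mult: "l2_le c B \<Longrightarrow> (\<And>k. cmod (m k) \<le> L) \<Longrightarrow> l2_le (\<lambda>k. m k * c k) (L * B)"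
  unfolding l2_le_def
proof (intro allI impI)
  fix K :: "int set"
  assume *: "\<forall>K. finite K \<longrightarrow> L2_set (\<lambda>k. cmod (c k)) K \<le> B" "\<And>k. cmod (m k) \<le> L" "finite K"
  have "0 \<le> L" using *(2)[of 0] norm_ge_zero order_trans by blast
  have "L2_set (\<lambda>k. cmod (m k * c k)) K \<le> L2_set (\<lambda>k. L * cmod (c k)) K"
    by (intro L2_set_mono) (simp_all add: norm_mult *(2) mult_right_mono)
  also have "\<dots> = L * L2_set (\<lambda>k. cmod (c k)) K" using \<open>0 \<le> L\<close> by (simp add: L2_set_right_distrib)
  also have "\<dots> \<le> L * B" using * \<open>0 \<le> L\<close> by (intro mult_left_mono) auto
  finally show "L2_set (\<lambda>k. cmod (m k * c k)) K \<le> L * B" .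
qed

lemma l1_le_uminus: "l1_le (\<lambda>k. - c k) R \<longleftrightarrow> l1_le c R"
  by (simp add: l1_le_def)

lemma l2_le_uminus: "l2_le (\<lambda>k. - c k) R \<longleftrightarrow> l2_le c R"
  by (simp add: l2_le_def)

lemma l1_le_diff: "l1_le c R \<Longrightarrow> l1_le d S \<Longrightarrow> l1_le (\<lambda>k. c k - d k) (R + S)"
  using l1_le_add[of c R "\<lambda>k. - d k" S] by (simp add: l1_le_uminus)

lemma l2_le_diff: "l2_le c R \<Longrightarrow> l2_le d S \<Longrightarrow> l2_le (\<lambda>k. c k - d k) (R + S)"
  using l2_le_add[of c R "\<lambda>k. - d k" S] by (simp add: l2_le_uminus)

lemma l2_le_duality:
  assumes "0 \<le> B"
    and "\<And>K h. finite K \<Longrightarrow> L2_set (\<lambda>k. cmod (h k)) K \<le> 1 \<Longrightarrow> cmod (\<Sum>k\<in>K. c k * cnj (h k)) \<le> B"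
  shows "l2_le c B"
  unfolding l2_le_def
proof (intro allI impI)
  fix K :: "int set"
  assume K: "finite K"
  define N where "N = L2_set (\<lambda>k. cmod (c k)) K"
  show "L2_set (\<lambda>k. cmod (c k)) K \<le> B"
  proof (cases "N = 0")
    case False
    then have N: "N > 0" by (simp add: N_def order_less_le)
    \<comment> \<open>The extremal test sequence: \<open>c\<close> itself, normalised on \<open>K\<close>.\<close>
    define h where "h = (\<lambda>k. c k / N)"
    have "L2_set (\<lambda>k. cmod (h k)) K = L2_set (\<lambda>k. inverse N * cmod (c k)) K"
      using N by (intro L2_set_cong) (auto simp: h_def norm_divide field_simps)
    also have "\<dots> = 1"
      using N by (subst L2_set_right_distrib[symmetric]) (simp_all add: N_def)
    finally have "cmod (\<Sum>k\<in>K. c k * cnj (h k)) \<le> B"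
      using assms K by simp
    moreover have "(\<Sum>k\<in>K. c k * cnj (h k)) = of_real ((\<Sum>k\<in>K. (cmod (c k))\<^sup>2) / N)"
      unfolding h_def of_real_divide of_real_sum sum_divide_distrib
      by (intro sum.cong refl) (simp only: complex_norm_square of_real_divide complex_cnj_divide
          complex_cnj_complex_of_real times_divide_eq_right)
    moreover have "(\<Sum>k\<in>K. (cmod (c k))\<^sup>2) = N\<^sup>2"
      by (simp add: N_def L2_set_def sum_nonneg)
    ultimately have "\<bar>N\<^sup>2 / N\<bar> \<le> B"
      by (simp only: norm_of_real)
    then have "N \<le> B"
      using N by (simp add: power2_eq_square)
    then show ?thesis by (simp add: N_def)
  qed (use assms in \<open>simp add: N_def\<close>)
qed

lemma l2_le_pairing:
  assumes "l2_le c B" "finite K" "L2_set (\<lambda>k. cmod (h k)) K \<le> 1"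
  shows "cmod (\<Sum>k\<in>K. c k * cnj (h k)) \<le> B"
proof -
  have "cmod (\<Sum>k\<in>K. c k * cnj (h k)) \<le> (\<Sum>k\<in>K. \<bar>cmod (c k)\<bar> * \<bar>cmod (h k)\<bar>)"
    by (rule norm_sum[THEN order_trans]) (simp add: norm_mult)
  also have "\<dots> \<le> L2_set (\<lambda>k. cmod (c k)) K * L2_set (\<lambda>k. cmod (h k)) K"
    by (rule L2_set_mult_ineq)
  also have "\<dots> \<le> B * 1"
    using assms l2_le_nonneg[OF assms(1)] l2_leD[OF assms(1,2)] by (intro mult_mono) auto
  finally show ?thesis by simp
qed

text \<open>The mean value inequality for curves in \<open>l\<^sup>2\<close> that are differentiable only coefficientwise: by
  duality it suffices to test against finitely supported sequences.\<close>

lemma l2_le_mean_value: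
  assumes "a \<le> b" and B: "\<And>t. t \<in> {a..b} \<Longrightarrow> l2_le (g t) B"
    and "\<And>k t. t \<in> {a..b} \<Longrightarrow> ((\<lambda>t. y t k) has_vector_derivative g t k) (at t within {a..b})"
  shows "l2_le (\<lambda>k. y b k - y a k) ((b - a) * B)"
proof (rule l2_le_duality)
  show "0 \<le> (b - a) * B" using l2_le_nonneg[OF B[of a]] \<open>a \<le> b\<close> by simp
next
  fix K :: "int set" and h :: "int \<Rightarrow> complex"
  assume K: "finite K" and h: "L2_set (\<lambda>k. cmod (h k)) K \<le> 1"
  define \<phi> where "\<phi> = (\<lambda>t. \<Sum>k\<in>K. y t k * cnj (h k))"
  \<comment> \<open>Testing against \<open>h\<close> turns the curve into a scalar function, to which the mean value inequality applies.\<close>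
  have "norm (\<phi> b - \<phi> a) \<le> B * norm (b - a)"
  proof (rule differentiable_bound)
    fix t assume t: "t \<in> {a..b}"
    have "(\<phi> has_vector_derivative (\<Sum>k\<in>K. g t k * cnj (h k))) (at t within {a..b})"
      unfolding \<phi>_def using assms(3)[OF t]
      by (intro has_vector_derivative_sum has_vector_derivative_mult_left)
    then show "(\<phi> has_derivative (\<lambda>s. s *\<^sub>R (\<Sum>k\<in>K. g t k * cnj (h k)))) (at t within {a..b})"
      by (simp add: has_vector_derivative_def)
    have "cmod (\<Sum>k\<in>K. g t k * cnj (h k)) \<le> B"
      using l2_le_pairing[OF B[OF t] K h] .
    then show "onorm (\<lambda>s. s *\<^sub>R (\<Sum>k\<in>K. g t k * cnj (h k))) \<le> B"
      by (simp add: onorm_scaleR_left bounded_linear_ident onorm_id)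
  qed (use \<open>a \<le> b\<close> in auto)
  moreover have "\<phi> b - \<phi> a = (\<Sum>k\<in>K. (y b k - y a k) * cnj (h k))"
    by (simp add: \<phi>_def sum_subtractf left_diff_distrib)
  ultimately show "cmod (\<Sum>k\<in>K. (y b k - y a k) * cnj (h k)) \<le> (b - a) * B"
    using \<open>a \<le> b\<close> by (simp add: mult.commute)
qed

section \<open>Absolutely convergent Fourier series\<close>

definition fser :: "(int \<Rightarrow> complex) \<Rightarrow> real \<Rightarrow> complex" where
  "fser c x = (\<Sum>\<^sub>\<infinity>k. c k * mode k x)"

definition summable_coeffs :: "(int \<Rightarrow> complex) \<Rightarrow> bool" where
  "summable_coeffs c \<longleftrightarrow> (\<lambda>k. cmod (c k)) summable_on UNIV"

lemma l1_le_summable_coeffs: "l1_le c R \<Longrightarrow> summable_coeffs c"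
  by (simp add: summable_coeffs_def l1_le_summable)

lemma summable_coeffs_l1_le: "summable_coeffs c \<Longrightarrow> l1_le c (\<Sum>\<^sub>\<infinity>k. cmod (c k))"
  by (simp add: summable_coeffs_def summable_imp_l1_le)

lemma summable_coeffs_iff: "summable_coeffs c \<longleftrightarrow> (\<exists>R. l1_le c R)"
  using l1_le_summable_coeffs summable_coeffs_l1_le by blast

lemma summable_coeffs_finite: "finite {k. c k \<noteq> 0} \<Longrightarrow> summable_coeffs c"
  unfolding summable_coeffs_def
  by (rule finite_nonzero_values_imp_summable_on) simp

lemma has_sum_finite_support:
  assumes "finite K" "\<And>k. k \<notin> K \<Longrightarrow> f k = 0"
  shows "(f has_sum sum f K) UNIV"
  by (rule has_sum_finite_neutralI[OF assms(1)]) (use assms(2) in auto)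

lemma fser_has_sum:
  assumes "summable_coeffs c"
  shows "((\<lambda>k. c k * mode k x) has_sum fser c x) UNIV"
proof -
  have "(\<lambda>k. norm (c k * mode k x)) summable_on UNIV"
    using assms by (simp add: norm_mult summable_coeffs_def)
  then show ?thesis
    unfolding fser_def by (rule has_sum_infsum[OF abs_summable_summable])
qed

lemma fser_finite:
  assumes "finite K" and "\<And>k. k \<notin> K \<Longrightarrow> c k = 0"
  shows "fser c x = (\<Sum>k\<in>K. c k * mode k x)"
proof -
  have "fser c x = (\<Sum>\<^sub>\<infinity>k\<in>K. c k * mode k x)"
    unfolding fser_def by (rule infsum_cong_neutral) (use assms in auto)
  then show ?thesis using assms by simp
qed

lemma norm_fser_le: "l1_le c R \<Longrightarrow> cmod (fser c x) \<le> R"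
  unfolding fser_def
  by (rule order_trans[OF norm_infsum_bound]) (simp_all add: norm_mult l1_le_infsum l1_le_summable)

lemma fser_uniform_limit:
  assumes "summable_coeffs c"
  shows "uniform_limit UNIV (\<lambda>K x. \<Sum>k\<in>K. c k * mode k x) (fser c) (finite_subsets_at_top UNIV)"
  unfolding fser_def
  by (rule Weierstrass_m_test_general[where M = "\<lambda>k. cmod (c k)"])
    (use assms in \<open>auto simp: norm_mult summable_coeffs_def\<close>)

lemma continuous_on_fser:
  assumes "summable_coeffs c"
  shows "continuous_on A (fser c)"
proof -
  have "continuous_on UNIV (fser c)"
    by (rule uniform_limit_theorem[OF _ fser_uniform_limit[OF assms]])
      (auto intro!: always_eventually continuous_intros)
  then show ?thesis by (rule continuous_on_subset) simp
qed

lemma continuous_on_fser_compose [continuous_intros]: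
  "summable_coeffs c \<Longrightarrow> continuous_on A f \<Longrightarrow> continuous_on A (\<lambda>x. fser c (f x))"
  using continuous_on_compose2[OF continuous_on_fser[of c UNIV]] by blast

lemma fser_periodic [simp]: "fser c (x + 1) = fser c x"
  by (simp add: fser_def)

lemma fser_add: "summable_coeffs c \<Longrightarrow> summable_coeffs d \<Longrightarrow> fser (\<lambda>k. c k + d k) x = fser c x + fser d x"
  using has_sum_add[OF fser_has_sum fser_has_sum, of c d x x]
  by (simp add: fser_def distrib_right infsumI)

lemma fser_cmult: "fser (\<lambda>k. a * c k) x = a * fser c x"
  by (simp add: fser_def mult.assoc infsum_cmult_right')

lemma fser_minus: "fser (\<lambda>k. - c k) x = - fser c x"
  using fser_cmult[of "-1" c x] by simp

lemma summable_coeffs_minus: "summable_coeffs (\<lambda>k. - c k) = summable_coeffs c"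
  by (simp add: summable_coeffs_def)

lemma summable_coeffs_add: "summable_coeffs c \<Longrightarrow> summable_coeffs d \<Longrightarrow> summable_coeffs (\<lambda>k. c k + d k)"
  unfolding summable_coeffs_iff using l1_le_add by blast

lemma summable_coeffs_diff: "summable_coeffs c \<Longrightarrow> summable_coeffs d \<Longrightarrow> summable_coeffs (\<lambda>k. c k - d k)"
  unfolding summable_coeffs_iff using l1_le_diff by blast

lemma summable_coeffs_mult:
  "summable_coeffs c \<Longrightarrow> (\<And>k. cmod (m k) \<le> L) \<Longrightarrow> summable_coeffs (\<lambda>k. m k * c k)"
  unfolding summable_coeffs_iff using l1_le_mult by blast

lemma fser_diff: "summable_coeffs c \<Longrightarrow> summable_coeffs d \<Longrightarrow> fser (\<lambda>k. c k - d k) x = fser c x - fser d x"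
  using fser_add[of c "\<lambda>k. - d k" x] by (simp add: summable_coeffs_minus fser_minus)

text \<open>The coefficients of the complex conjugate function.\<close>

definition conj_coeffs :: "(int \<Rightarrow> complex) \<Rightarrow> int \<Rightarrow> complex" where
  "conj_coeffs c k = cnj (c (- k))"

lemma sum_conj_coeffs: "finite K \<Longrightarrow> (\<Sum>k\<in>K. f (cmod (conj_coeffs c k))) = (\<Sum>k\<in>uminus ` K. f (cmod (c k)))"
  by (subst sum.reindex) (auto simp: conj_coeffs_def)

lemma l1_le_conj_coeffs: "l1_le c R \<Longrightarrow> l1_le (conj_coeffs c) R"
  unfolding l1_le_def using sum_conj_coeffs[where f = "\<lambda>x. x"] by (metis finite_imageI)

lemma l2_le_conj_coeffs: "l2_le c R \<Longrightarrow> l2_le (conj_coeffs c) R"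
  unfolding l2_le_def L2_set_def using sum_conj_coeffs[where f = "\<lambda>x. x\<^sup>2"] by (metis finite_imageI)

lemma summable_coeffs_conj_coeffs: "summable_coeffs c \<Longrightarrow> summable_coeffs (conj_coeffs c)"
  unfolding summable_coeffs_iff using l1_le_conj_coeffs by blast

lemma fser_conj_coeffs: "fser (conj_coeffs c) x = cnj (fser c x)"
proof -
  have "cnj (fser c x) = (\<Sum>\<^sub>\<infinity>k. cnj (c k) * mode (- k) x)"
    by (simp add: fser_def flip: infsum_cnj cnj_mode)
  also have "\<dots> = (\<Sum>\<^sub>\<infinity>k. cnj (c (- k)) * mode k x)"
    by (rule infsum_reindex_bij_witness[of _ uminus uminus]) auto
  finally show ?thesis by (simp add: fser_def conj_coeffs_def)
qed

text \<open>Uniform convergence of the series allows termwise integration against any integrable function. The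
  two identities that follow are the cases of a mode and of the conjugate series.\<close>

lemma fser_pairing:
  assumes "summable_coeffs c" and g: "integrable torus g"
  shows "((\<lambda>k. c k * (LINT x|torus. mode k x * g x)) has_sum
      (LINT x|torus. fser c x * g x)) UNIV"
proof -
  let ?F = "finite_subsets_at_top (UNIV :: int set)"
  have mg [simp]: "integrable torus (\<lambda>x. f x * g x)"
    if "continuous_on UNIV f" for f :: "real \<Rightarrow> complex"
    by (rule integrable_times_continuous[OF g that])
  have eq: "(\<Sum>k\<in>K. c k * (LINT x|torus. mode k x * g x))
      = (LINT x|torus. (\<Sum>k\<in>K. c k * mode k x) * g x)" for K
  proof -
    have "(LINT x|torus. (\<Sum>k\<in>K. c k * mode k x) * g x)
        = (LINT x|torus. (\<Sum>k\<in>K. c k * (mode k x * g x)))"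
      by (simp add: sum_distrib_right mult.assoc)
    also have "\<dots> = (\<Sum>k\<in>K. LINT x|torus. c k * (mode k x * g x))"
      by (rule Bochner_Integration.integral_sum) (auto intro!: integrable_mult_right mg continuous_intros)
    finally show ?thesis by simp
  qed
  define G where "G = (LINT x|torus. norm (g x))"
  have G: "0 \<le> G" unfolding G_def by simp
  have "((\<lambda>K. \<Sum>k\<in>K. c k * (LINT x|torus. mode k x * g x)) \<longlongrightarrow>
      (LINT x|torus. fser c x * g x)) ?F"
  proof (rule tendstoI)
    fix e :: real assume e: "e > 0"
    \<comment> \<open>The summand \<open>1\<close> covers the case \<open>g = 0\<close>.\<close>
    define d where "d = e / (G + 1)"
    have d: "d > 0" using e G by (simp add: d_def)
    have "\<forall>\<^sub>F K in ?F. \<forall>x\<in>UNIV. dist (\<Sum>k\<in>K. c k * mode k x) (fser c x) < d"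
      using fser_uniform_limit[OF assms(1)] d by (rule uniform_limitD)
    then show "\<forall>\<^sub>F K in ?F. dist (\<Sum>k\<in>K. c k * (LINT x|torus. mode k x * g x))
        (LINT x|torus. fser c x * g x) < e"
    proof eventually_elim
      case (elim K)
      have "dist (\<Sum>k\<in>K. c k * (LINT x|torus. mode k x * g x)) (LINT x|torus. fser c x * g x)
         = norm (LINT x|torus. (\<Sum>k\<in>K. c k * mode k x) * g x - fser c x * g x)"
        unfolding eq dist_norm
        by (subst Bochner_Integration.integral_diff)
          (auto intro!: mg continuous_intros assms)
      also have "\<dots> \<le> (LINT x|torus. d * norm (g x))"
      proof (rule Bochner_Integration.integral_norm_bound_integral)
        show "integrable torus (\<lambda>x. (\<Sum>k\<in>K. c k * mode k x) * g x - fser c x * g x)"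
          by (intro Bochner_Integration.integrable_diff mg continuous_intros assms)
        show "integrable torus (\<lambda>x. d * norm (g x))"
          using g by (intro integrable_mult_right integrable_norm)
        fix x
        show "norm ((\<Sum>k\<in>K. c k * mode k x) * g x - fser c x * g x) \<le> d * norm (g x)"
          unfolding left_diff_distrib[symmetric] norm_mult
          using elim by (intro mult_right_mono) (auto simp: dist_norm less_imp_le)
      qed
      also have "\<dots> = d * G" by (simp add: G_def)
      also have "\<dots> < e" using e G by (simp add: d_def field_simps)
      finally show ?case .
    qed
  qed
  then show ?thesis by (simp add: has_sum_def)
qed

lemma fourier_coeff_fser:
  assumes "summable_coeffs c"
  shows "fourier_coeff (fser c) k = c k"
proof -
  have "((\<lambda>j. c j * (LINT x|torus. mode j x * mode (- k) x)) has_sum fourier_coeff (fser c) k) UNIV"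
    unfolding fourier_coeff_mode
    by (rule fser_pairing[OF assms]) (auto intro!: integrable_period_continuous continuous_intros)
  moreover have "c j * (LINT x|torus. mode j x * mode (- k) x) = (if j = k then c k else 0)" for j
    using integral_mode[of "j + - k"] by (simp add: mode_add_left[symmetric] del: add_uminus_conv_diff)
  ultimately have "((\<lambda>j. if j = k then c k else 0) has_sum fourier_coeff (fser c) k) UNIV"
    by simp
  moreover have "((\<lambda>j. if j = k then c k else 0) has_sum c k) UNIV"
    using has_sum_finite_support[of "{k}" "\<lambda>j. if j = k then c k else 0"] by simp
  ultimately show ?thesis by (rule has_sum_unique)
qed

lemma parseval_fser:
  assumes "summable_coeffs c"
  shows "((\<lambda>k. (cmod (c k))\<^sup>2) has_sum (LINT x|torus. (cmod (fser c x))\<^sup>2)) UNIV"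
proof -
  have "((\<lambda>k. c k * (LINT x|torus. mode k x * cnj (fser c x))) has_sum
      (LINT x|torus. fser c x * cnj (fser c x))) UNIV"
    by (rule fser_pairing[OF assms])
      (auto intro!: integrable_period_continuous continuous_intros assms)
  moreover have "(LINT x|torus. mode k x * cnj (fser c x)) = cnj (c k)" for k
  proof -
    have "cnj (LINT x|torus. fser c x * mode (- k) x) =
        (LINT x|torus. cnj (fser c x * mode (- k) x))"
      by (rule Bochner_Integration.integral_cnj[symmetric])
    then show ?thesis
      using fourier_coeff_fser[OF assms, of k]
      by (simp add: fourier_coeff_mode cnj_mode mult.commute)
  qed
  ultimately have "((\<lambda>k. of_real ((cmod (c k))\<^sup>2)) has_sum
      (LINT x|torus. complex_of_real ((cmod (fser c x))\<^sup>2))) UNIV"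
    by (simp only: complex_norm_square)
  then show ?thesis
    unfolding integral_complex_of_real has_sum_of_real_iff .
qed

lemma parseval_le:
  assumes "summable_coeffs c" "l2_le c B"
  shows "(LINT x|torus. (cmod (fser c x))\<^sup>2) \<le> B\<^sup>2"
  by (rule has_sum_le_finite_sums[OF parseval_fser[OF assms(1)]])
    (use assms(2) in \<open>simp add: l2_le_iff\<close>)

lemma bessel:
  fixes f :: "real \<Rightarrow> complex"
  assumes f: "continuous_on UNIV f" and B: "(LINT x|torus. (cmod (f x))\<^sup>2) \<le> B\<^sup>2" "0 \<le> B"
  shows "l2_le (fourier_coeff f) B"
  unfolding l2_le_iff
proof (intro conjI allI impI)
  fix K :: "int set" assume K: "finite K"
  define s where "s = (\<lambda>k. if k \<in> K then fourier_coeff f k else 0)"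
  have s: "summable_coeffs s"
    using K by (intro summable_coeffs_finite) (auto simp: s_def intro: rev_finite_subset)
  define S where "S = (\<Sum>k\<in>K. (cmod (fourier_coeff f k))\<^sup>2)"
  have "((\<lambda>k. (cmod (s k))\<^sup>2) has_sum S) UNIV"
    using has_sum_finite_support[OF K, of "\<lambda>k. (cmod (s k))\<^sup>2"] by (simp add: s_def S_def)
  then have SS: "(LINT x|torus. (cmod (fser s x))\<^sup>2) = S"
    using has_sum_unique parseval_fser[OF s] by blast
  have "((\<lambda>k. s k * (LINT x|torus. mode k x * cnj (f x))) has_sum
      (LINT x|torus. fser s x * cnj (f x))) UNIV"
    by (rule fser_pairing[OF s]) (intro integrable_period_continuous continuous_intros f)
  moreover have "(LINT x|torus. mode k x * cnj (f x)) = cnj (fourier_coeff f k)" for k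
    unfolding fourier_coeff_mode Bochner_Integration.integral_cnj[symmetric] by (simp add: cnj_mode mult.commute del: Bochner_Integration.integral_cnj)
  ultimately have "((\<lambda>k. s k * cnj (fourier_coeff f k)) has_sum
      (LINT x|torus. fser s x * cnj (f x))) UNIV" by simp
  moreover have "((\<lambda>k. s k * cnj (fourier_coeff f k)) has_sum of_real S) UNIV"
    using has_sum_finite_support[OF K, of "\<lambda>k. s k * cnj (fourier_coeff f k)"]
    by (simp add: s_def S_def complex_norm_square flip: of_real_power cong: sum.cong)
  ultimately have X: "(LINT x|torus. fser s x * cnj (f x)) = of_real S"
    using has_sum_unique by blast
  \<comment> \<open>The square of the distance of \<open>f\<close> from its partial Fourier sum over \<open>K\<close> is
    \<open>\<integral>|f|\<^sup>2 - S\<close>.\<close>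
  have "0 \<le> (LINT x|torus. (cmod (f x - fser s x))\<^sup>2)" by simp
  also have "\<dots> = (LINT x|torus. (cmod (f x))\<^sup>2 - 2 * Re (fser s x * cnj (f x)) + (cmod (fser s x))\<^sup>2)"
  proof -
    have "(cmod (a - b))\<^sup>2 = (cmod a)\<^sup>2 - 2 * Re (b * cnj a) + (cmod b)\<^sup>2" for a b
      unfolding cmod_power2 by (simp add: power2_eq_square algebra_simps)
    then show ?thesis by simp
  qed
  also have "\<dots> = (LINT x|torus. (cmod (f x))\<^sup>2)
       - 2 * Re (LINT x|torus. fser s x * cnj (f x)) + (LINT x|torus. (cmod (fser s x))\<^sup>2)"
  proof -
    have i: "integrable torus (\<lambda>x. (cmod (f x))\<^sup>2)"
      "integrable torus (\<lambda>x. fser s x * cnj (f x))"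
      "integrable torus (\<lambda>x. (cmod (fser s x))\<^sup>2)"
      by (intro integrable_period_continuous continuous_intros f s)+
    show ?thesis
      using i integrable_Re[OF i(2)] integral_Re[OF i(2)]
      by (simp del: complex_mod_cnj times_complex.sel)
  qed
  also have "\<dots> = (LINT x|torus. (cmod (f x))\<^sup>2) - S"
    by (simp add: X SS)
  finally show "(\<Sum>k\<in>K. (cmod (fourier_coeff f k))\<^sup>2) \<le> B\<^sup>2"
    using B by (simp add: S_def)
qed (use B in auto)

section \<open>Uniqueness of Fourier coefficients\<close>

inductive trig_poly :: "(real \<Rightarrow> complex) \<Rightarrow> bool" where
  mono: "trig_poly (\<lambda>x. c * mode k x)"
| add: "trig_poly p \<Longrightarrow> trig_poly q \<Longrightarrow> trig_poly (\<lambda>x. p x + q x)"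

lemma trig_poly_mult:
  assumes "trig_poly p" "trig_poly q"
  shows "trig_poly (\<lambda>x. p x * q x)"
  using assms(1)
proof induction
  case (mono c k)
  show ?case using assms(2)
  proof induction
    case (mono d j)
    show ?case using trig_poly.mono[of "c * d" "k + j"] by (simp add: mode_add_left ac_simps)
  qed (auto simp: distrib_left intro: trig_poly.add)
qed (auto simp: distrib_right intro: trig_poly.add)

text \<open>Since \<open>Re z\<close> and \<open>Im z\<close> are combinations of \<open>z\<close> and \<open>cnj z\<close>, real polynomials on the unit circle
  are trigonometric polynomials.\<close>

lemma trig_poly_of_polynomial:
  assumes "real_polynomial_function p"
  shows "trig_poly (\<lambda>x. of_real (p (mode 1 x)))"
  using assms
proof induction
  case (linear f)
  interpret bounded_linear f by fact
  have fz: "f z = Re z * f 1 + Im z * f \<i>" for z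
  proof -
    have "z = Re z *\<^sub>R 1 + Im z *\<^sub>R \<i>" by (simp add: complex_eq_iff)
    then have "f z = f (Re z *\<^sub>R 1 + Im z *\<^sub>R \<i>)" by (rule arg_cong)
    then show ?thesis by (simp only: add scale real_scaleR_def)
  qed
  have reim: "complex_of_real (Re z) = (z + cnj z) / 2" "complex_of_real (Im z) = (z - cnj z) / (2 * \<i>)" for z
    by (simp_all add: complex_eq_iff Im_divide Re_divide)
  have "complex_of_real (f (mode 1 x)) =
      (f 1 / 2 + f \<i> / (2 * \<i>)) * mode 1 x + (f 1 / 2 - f \<i> / (2 * \<i>)) * mode (- 1) x" for x
    unfolding fz[of "mode 1 x"] of_real_add of_real_mult reim cnj_mode by (simp add: field_simps)
  then show ?case
    using trig_poly.add[OF trig_poly.mono[of "f 1 / 2 + f \<i> / (2 * \<i>)" 1] trig_poly.mono[of "f 1 / 2 - f \<i> / (2 * \<i>)" "- 1"]]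
    by simp
next
  case (const c)
  show ?case using trig_poly.mono[of c 0] by simp
qed (auto intro: trig_poly.add trig_poly_mult)

lemma trig_poly_orthogonal:
  assumes "trig_poly p" and f: "integrable torus f" "\<And>k. fourier_coeff f k = 0"
  shows "continuous_on UNIV p \<and> (LINT x|torus. p x * f x) = 0"
  using assms(1)
proof induction
  case (mono c k)
  show ?case using f(2)[of "- k"]
    by (auto simp: fourier_coeff_mode mult.commute[of "mode k _"] mult.assoc
        intro!: continuous_intros)
next
  case (add p q)
  then show ?case
    using integrable_times_continuous[OF f(1)]
    by (auto simp: distrib_right intro!: continuous_intros)
qed

lemma continuous_orthogonal:
  fixes h :: "complex \<Rightarrow> real"
  assumes h: "continuous_on UNIV h" and f: "integrable torus f" "\<And>k. fourier_coeff f k = 0"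
  shows "(LINT x|torus. of_real (h (mode 1 x)) * f x) = 0"
proof -
  define F where "F = (LINT x|torus. norm (f x))"
  have F: "F \<ge> 0" by (simp add: F_def)
  have ch: "continuous_on UNIV (\<lambda>x. complex_of_real (h (mode 1 x)))"
    by (intro continuous_on_of_real continuous_on_compose2[OF h] continuous_intros) auto
  \<comment> \<open>\<open>h\<close> is uniformly close on the unit circle to a polynomial in the real and imaginary part,
    that is, to a trigonometric polynomial.\<close>
  have "norm (LINT x|torus. of_real (h (mode 1 x)) * f x) \<le> e * F" if e: "e > 0" for e
  proof -
    obtain p where p: "real_polynomial_function p" "\<And>z. z \<in> sphere 0 1 \<Longrightarrow> \<bar>h z - p z\<bar> < e"
      using Stone_Weierstrass_real_polynomial_function[of "sphere 0 1" h e] h e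
      by (auto intro: continuous_on_subset)
    note T = trig_poly_orthogonal[OF trig_poly_of_polynomial[OF p(1)] f]
    have i: "integrable torus (\<lambda>x. of_real (h (mode 1 x)) * f x)"
      "integrable torus (\<lambda>x. of_real (p (mode 1 x)) * f x)"
      using T ch integrable_times_continuous[OF f(1)] by auto
    have "(LINT x|torus. of_real (h (mode 1 x)) * f x) =
        (LINT x|torus. of_real (h (mode 1 x)) * f x - of_real (p (mode 1 x)) * f x)"
      using T i by simp
    also have "norm \<dots> \<le> (LINT x|torus. e * norm (f x))"
    proof (rule Bochner_Integration.integral_norm_bound_integral)
      fix x
      have "norm (of_real (h (mode 1 x)) - of_real (p (mode 1 x)) :: complex) \<le> e"
        using p(2)[of "mode 1 x"] by (simp flip: of_real_diff)
      then show "norm (of_real (h (mode 1 x)) * f x - of_real (p (mode 1 x)) * f x) \<le> e * norm (f x)"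
        unfolding left_diff_distrib[symmetric] norm_mult by (rule mult_right_mono) simp
    qed (use i f in auto)
    finally show ?thesis by (simp add: F_def)
  qed
  then have "norm (LINT x|torus. of_real (h (mode 1 x)) * f x) \<le> 0 + e" if "e > 0" for e
  proof -
    have "norm (LINT x|torus. of_real (h (mode 1 x)) * f x) \<le> e / (F + 1) * F"
      using that F \<open>\<And>e. e > 0 \<Longrightarrow> _ \<le> e * F\<close>[of "e / (F + 1)"] by simp
    also have "\<dots> \<le> e" using that F by (simp add: field_simps)
    finally show ?thesis by simp
  qed
  then have "norm (LINT x|torus. of_real (h (mode 1 x)) * f x) \<le> 0"
    by (rule field_le_epsilon)
  then show ?thesis by simp
qed

lemma mode_1_inj:
  assumes "mode 1 x = mode 1 y" "\<bar>x - y\<bar> < 1"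
  shows "x = y"
proof -
  have "cis (2 * pi * (x - y)) = 1"
    using assms(1) by (simp add: mode_def right_diff_distrib flip: cis_divide)
  then have "cos (2 * pi * (x - y)) = 1" by (metis cis.sel(1) one_complex.sel(1))
  then obtain n where "2 * pi * (x - y) = of_int n * 2 * pi"
    using cos_one_2pi_int by auto
  then have n: "x - y = of_int n" by simp
  then have "n = 0" using assms(2) by simp
  then show ?thesis using n by simp
qed

text \<open>The indicator of a compact set is a pointwise limit of continuous functions of the point on the
  circle.\<close>

lemma compact_orthogonal:
  assumes K: "compact K" "K \<subseteq> {0..1}" and f: "integrable torus f" "\<And>k. fourier_coeff f k = 0"
  shows "set_lebesgue_integral torus K f = 0"
proof (cases "K = {}")
  case False
  define C where "C = mode 1 ` K"
  have "compact C" unfolding C_def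
    by (intro compact_continuous_image K continuous_intros)
  then have C: "closed C" "C \<noteq> {}" using False by (auto simp: C_def compact_imp_closed)
  define h where "h = (\<lambda>(n::nat) z. max 0 (1 - real n * infdist z C))"
  have h: "continuous_on UNIV (h n)" for n
    unfolding h_def by (intro continuous_intros continuous_on_infdist)
  have h01: "0 \<le> h n z" "h n z \<le> 1" for n z
    by (auto simp: h_def infdist_nonneg)
  have lim: "(\<lambda>n. h n z) \<longlonglongrightarrow> indicator C z" for z
  proof (cases "z \<in> C")
    case True
    then show ?thesis by (simp add: h_def)
  next
    case False
    then have d: "infdist z C > 0"
      using C in_closed_iff_infdist_zero infdist_nonneg by (metis order_le_less)
    obtain N :: nat where N: "1 < real N * infdist z C" using reals_Archimedean3[OF d] by blast
    have "\<forall>\<^sub>F n in sequentially. h n z = indicator C z"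
      using eventually_ge_at_top[of N]
    proof eventually_elim
      case (elim n)
      have "real N * infdist z C \<le> real n * infdist z C" using elim d by simp
      then show ?case using N False by (simp add: h_def)
    qed
    then show ?thesis by (rule tendsto_eventually)
  qed
  have ae: "AE x in torus. x \<noteq> 0 \<and> x \<noteq> 1"
  proof -
    have "AE x in lebesgue. x \<notin> {0, 1 :: real}" 
      by (intro AE_not_in) (simp flip: negligible_iff_null_sets)
    then show ?thesis by (subst AE_restrict_space_iff) auto
  qed
  have "(\<lambda>n. LINT x|torus. of_real (h n (mode 1 x)) * f x) \<longlonglongrightarrow>
      (LINT x|torus. indicator K x *\<^sub>R f x)"
  proof (rule integral_dominated_convergence)
    show "(\<lambda>x. indicator K x *\<^sub>R f x) \<in> borel_measurable torus"
      using K f(1) by (intro borel_measurable_scaleR borel_measurable_indicator)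
         (auto simp: sets_restrict_space borel_compact intro: image_eqI[of _ _ K])
    show "(\<lambda>x. of_real (h n (mode 1 x)) * f x) \<in> borel_measurable torus" for n
      by (rule borel_measurable_integrable[OF integrable_times_continuous[OF f(1)]])
       (intro continuous_on_of_real continuous_on_compose2[OF h] continuous_intros continuous_on_id; auto)
    show "integrable torus (\<lambda>x. norm (f x))" using f by simp
    show "AE x in torus. norm (of_real (h n (mode 1 x)) * f x) \<le> norm (f x)" for n
      using h01 by (intro AE_I2) (simp add: norm_mult mult_left_le_one_le)
    show "AE x in torus. (\<lambda>n. of_real (h n (mode 1 x)) * f x) \<longlonglongrightarrow> indicator K x *\<^sub>R f x"
      using ae AE_space
    proof eventually_elim
      case (elim x)
      then have x: "0 < x" "x < 1" by auto
      \<comment> \<open>The circle identifies the end points \<open>0\<close> and \<open>1\<close> only, and these were excluded.\<close>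
      have "mode 1 x \<in> C \<longleftrightarrow> x \<in> K"
      proof
        assume "mode 1 x \<in> C"
        then obtain y where y: "y \<in> K" "mode 1 x = mode 1 y" by (auto simp: C_def)
        then have "0 \<le> y" "y \<le> 1" using K by auto
        then have "\<bar>x - y\<bar> < 1" using x by linarith
        then show "x \<in> K" using mode_1_inj y by blast
      qed (simp add: C_def)
      then have eq: "indicator C (mode 1 x) = indicat_real K x"
        by (simp add: indicator_def)
      show ?case
        unfolding scaleR_conv_of_real
        using lim[of "mode 1 x"] unfolding eq by (intro tendsto_intros)
    qed
  qed
  then show ?thesis
    using continuous_orthogonal[OF h f] by (simp add: set_lebesgue_integral_def LIMSEQ_const_iff)
qed (simp add: set_lebesgue_integral_def)

text \<open>Measurable sets are, up to null sets, increasing unions of compact sets, so the integral over every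
  measurable set vanishes.\<close>

theorem fourier_uniqueness:
  assumes f: "integrable torus f" "\<And>k. fourier_coeff f k = 0"
  shows "AE x in torus. f x = 0"
proof -
  interpret finite_measure torus by simp
  show ?thesis
  proof (rule density_zero[OF f(1)])
  fix A assume "A \<in> sets torus"
  then have A: "A \<in> sets lebesgue" "A \<subseteq> {0..1}" by (auto simp: sets_restrict_space_iff)
  then obtain C T where C: "fsigma C" "T \<in> null_sets lebesgue" "C \<union> T = A" "disjnt C T"
    using lebesgue_set_almost_fsigma by blast
  obtain F :: "nat \<Rightarrow> real set" where F: "range F \<subseteq> Collect compact" "C = \<Union> (range F)"
    using C(1) fsigma_Union_compact by blast
  define G where "G = (\<lambda>n. \<Union>i\<le>n. F i)"
  have G: "compact (G n)" "G n \<subseteq> {0..1}" for n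
    using F A C by (auto simp: G_def intro!: compact_UN)
  have Gs: "G n \<in> sets torus" for n
    using G[of n] by (auto simp: sets_restrict_space_iff borel_compact)
  have UG: "(\<Union>n. G n) = C" using F(2) by (auto simp: G_def)
  have "incseq G" by (force simp: G_def incseq_def)
  have CM: "C \<in> sets torus" using UG Gs by (metis sets.countable_UN image_subset_iff UNIV_I)
  have "(\<lambda>n. set_lebesgue_integral torus (G n) f) \<longlonglongrightarrow>
      set_lebesgue_integral torus (\<Union>n. G n) f"
    using Gs \<open>incseq G\<close> CM f(1) unfolding set_integrable_def
    by (intro set_integral_cont_up) (auto simp: UG set_integrable_def intro!: integrable_mult_indicator)
  then have "set_lebesgue_integral torus C f = 0"
    using compact_orthogonal[OF G f] by (simp add: UG LIMSEQ_const_iff)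
  moreover have "set_lebesgue_integral torus A f = set_lebesgue_integral torus C f"
  proof -
    have "AE x in lebesgue. x \<notin> T" using C(2) by (rule AE_not_in)
    then have "AE x in torus. x \<notin> T"
      by (subst AE_restrict_space_iff) (auto elim: eventually_mono)
    then have "AE x in torus. indicat_real A x *\<^sub>R f x = indicator C x *\<^sub>R f x"
      by eventually_elim (use C(3) in \<open>auto simp: indicator_def\<close>)
    moreover have "(\<lambda>x. indicat_real A x *\<^sub>R f x) \<in> borel_measurable torus"
      "(\<lambda>x. indicat_real C x *\<^sub>R f x) \<in> borel_measurable torus"
      using CM \<open>A \<in> sets torus\<close> f(1) by (auto intro!: borel_measurable_scaleR borel_measurable_indicator)
    ultimately show ?thesis
      unfolding set_lebesgue_integral_def by (intro integral_cong_AE)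
  qed
  ultimately show "set_lebesgue_integral torus A f = 0" by simp
  qed
qed

section \<open>The scheme in terms of Fourier coefficients\<close>

lemma L2_torus_measurable: "f \<in> L2_torus \<Longrightarrow> f \<in> borel_measurable torus"
  by (simp add: L2_torus_def)

lemma L2_torus_integrable:
  assumes "f \<in> L2_torus"
  shows "integrable torus f"
proof (rule Bochner_Integration.integrable_bound)
  show "integrable torus (\<lambda>x. 1 + (cmod (f x))\<^sup>2)"
    using assms by (intro Bochner_Integration.integrable_add finite_measure.integrable_const finite_measure_period)
      (simp add: L2_torus_def)
  have "cmod (f x) \<le> 1 + (cmod (f x))\<^sup>2" for x
    using sum_squares_ge_zero[of "cmod (f x) - 1 / 2" 0] by (simp add: power2_eq_square field_simps)
  then show "AE x in torus. norm (f x) \<le> norm (1 + (cmod (f x))\<^sup>2)"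
    by (intro AE_I2) (simp add: abs_of_nonneg add_nonneg_nonneg)
qed (use assms L2_torus_measurable in auto)

lemma L2_torus_fser: "summable_coeffs c \<Longrightarrow> fser c \<in> L2_torus"
  unfolding L2_torus_def
  by (auto intro!: measurable_period_continuous integrable_period_continuous continuous_intros)

lemma fourier_coeff_cong_AE:
  assumes "AE x in torus. f x = g x"
    and [measurable]: "f \<in> borel_measurable torus" "g \<in> borel_measurable torus"
  shows "fourier_coeff f = fourier_coeff g"
proof
  fix k
  have [measurable]: "mode (- k) \<in> borel_measurable torus"
    by (intro measurable_period_continuous continuous_intros)
  show "fourier_coeff f k = fourier_coeff g k"
    unfolding fourier_coeff_mode
    by (intro integral_cong_AE) (use assms(1) in \<open>auto elim: eventually_mono\<close>)
qed

lemma AE_eq_fser: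
  assumes "f \<in> L2_torus" "summable_coeffs (fourier_coeff f)"
  shows "AE x in torus. f x = fser (fourier_coeff f) x"
proof -
  have i: "integrable torus f" "integrable torus (fser (fourier_coeff f))"
    using assms L2_torus_integrable L2_torus_fser by auto
  have "AE x in torus. f x - fser (fourier_coeff f) x = 0"
  proof (rule fourier_uniqueness)
    show "integrable torus (\<lambda>x. f x - fser (fourier_coeff f) x)" using i by simp
    fix k
    have "integrable torus (\<lambda>x. g x * mode (- k) x)" if "integrable torus g" for g
      using integrable_times_continuous[OF that, of "mode (- k)"]
      by (simp add: mult.commute continuous_intros)
    then have "fourier_coeff (\<lambda>x. f x - fser (fourier_coeff f) x) k =
        fourier_coeff f k - fourier_coeff (fser (fourier_coeff f)) k"
      using i by (simp add: fourier_coeff_mode left_diff_distrib)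
    then show "fourier_coeff (\<lambda>x. f x - fser (fourier_coeff f) x) k = 0"
      by (simp add: fourier_coeff_fser[OF assms(2)])
  qed
  then show ?thesis by simp
qed

lemma fourier_coeff_cnj: "fourier_coeff (\<lambda>x. cnj (f x)) = conj_coeffs (fourier_coeff f)"
proof
  fix k
  have "(LINT x|torus. cnj (f x) * mode (- k) x) = (LINT x|torus. cnj (f x * mode k x))"
    by (simp add: cnj_mode)
  also have "\<dots> = cnj (LINT x|torus. f x * mode k x)"
    by (rule Bochner_Integration.integral_cnj)
  finally show "fourier_coeff (\<lambda>x. cnj (f x)) k = conj_coeffs (fourier_coeff f) k"
    by (simp add: fourier_coeff_mode conj_coeffs_def)
qed

lemma L2_torus_cnj: "f \<in> L2_torus \<Longrightarrow> (\<lambda>x. cnj (f x)) \<in> L2_torus"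
proof -
  assume f: "f \<in> L2_torus"
  have "(\<lambda>x. cnj (f x)) \<in> borel_measurable torus"
    by (rule measurable_compose[OF L2_torus_measurable[OF f] borel_measurable_continuous_onI])
      (intro continuous_intros)
  then show ?thesis using f by (simp add: L2_torus_def)
qed

definition freq :: "int \<Rightarrow> real" where
  "freq k = (2 * pi * of_int k)\<^sup>2"

definition flow :: "real \<Rightarrow> (int \<Rightarrow> complex) \<Rightarrow> int \<Rightarrow> complex" where
  "flow t c k = cis (- (freq k * t)) * c k"

lemma norm_flow [simp]: "cmod (flow t c k) = cmod (c k)"
  by (simp add: flow_def norm_mult)

lemma summable_coeffs_flow [simp]: "summable_coeffs (flow t c) = summable_coeffs c"
  by (simp add: summable_coeffs_def)

lemma flow_flow: "flow s (flow t c) = flow (s + t) c"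
  by (rule ext) (simp add: flow_def cis_mult algebra_simps flip: mult.assoc)

lemma flow_0 [simp]: "flow 0 c = c"
  by (rule ext) (simp add: flow_def)

lemma fourier_multiplier_summable:
  assumes "summable_coeffs (\<lambda>k. m k * fourier_coeff f k)"
  shows "fourier_multiplier m f \<in> L2_torus"
    and "fourier_coeff (fourier_multiplier m f) = (\<lambda>k. m k * fourier_coeff f k)"
proof -
  have "\<exists>g. g \<in> L2_torus \<and> (\<forall>k. fourier_coeff g k = m k * fourier_coeff f k)"
    using L2_torus_fser[OF assms] fourier_coeff_fser[OF assms] by blast
  then have *: "fourier_multiplier m f \<in> L2_torus \<and>
      (\<forall>k. fourier_coeff (fourier_multiplier m f) k = m k * fourier_coeff f k)"
    unfolding fourier_multiplier_def by (rule someI_ex)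
  then show "fourier_multiplier m f \<in> L2_torus" by blast
  show "fourier_coeff (fourier_multiplier m f) = (\<lambda>k. m k * fourier_coeff f k)"
    using * by blast
qed

lemma schroedinger_summable:
  assumes "summable_coeffs (fourier_coeff f)"
  shows "schroedinger t f \<in> L2_torus"
    and "fourier_coeff (schroedinger t f) = flow t (fourier_coeff f)"
proof -
  have m: "exp (\<i> * of_real t * of_real (- ((2 * pi * of_int k)\<^sup>2))) = cis (- (freq k * t))" for k
    by (simp add: freq_def cis_conv_exp ac_simps)
  have "summable_coeffs (\<lambda>k. exp (\<i> * of_real t * of_real (- ((2 * pi * of_int k)\<^sup>2))) * fourier_coeff f k)"
    using assms unfolding m by (simp flip: flow_def)
  from fourier_multiplier_summable[OF this]
  show "schroedinger t f \<in> L2_torus"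
    and "fourier_coeff (schroedinger t f) = flow t (fourier_coeff f)"
    unfolding schroedinger_def m by (auto simp: flow_def)
qed

text \<open>\<open>\<tau>\<close> times the symbol of \<open>\<phi>\<^sub>1(-2 \<i> \<tau> \<partial>\<^sub>x\<^sup>2)\<close>.\<close>

definition phi_symbol :: "real \<Rightarrow> int \<Rightarrow> complex" where
  "phi_symbol \<tau> k = integral {0..\<tau>} (\<lambda>s. cis (2 * freq k * s))"

lemma phi_symbol_has_integral:
  "((\<lambda>s. cis (2 * freq k * s)) has_integral phi_symbol \<tau> k) {0..\<tau>}"
  unfolding phi_symbol_def
  by (intro integrable_integral integrable_continuous_interval continuous_intros)

lemma norm_phi_symbol_le: "0 \<le> \<tau> \<Longrightarrow> cmod (phi_symbol \<tau> k) \<le> \<tau>"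
  using has_integral_bound[of 1 "\<lambda>s. cis (2 * freq k * s)" "phi_symbol \<tau> k" 0 \<tau>] phi_symbol_has_integral[where k = k and \<tau> = \<tau>]
  by simp

lemma phi_symbol_deriv:
  assumes "s \<in> {0..\<tau>}"
  shows "((\<lambda>s. phi_symbol s k) has_vector_derivative cis (2 * freq k * s)) (at s within {0..\<tau>})"
  unfolding phi_symbol_def using assms
  by (intro integral_has_vector_derivative continuous_intros) auto

lemma phi_symbol_0 [simp]: "phi_symbol 0 k = 0"
  by (simp add: phi_symbol_def)

lemma L2_inner_cong_AE:
  assumes "AE x in torus. f x = g x" "f \<in> L2_torus" "g \<in> L2_torus" "h \<in> L2_torus"
  shows "L2_inner f h = L2_inner g h"
proof -
  have [measurable]: "f \<in> borel_measurable torus" "g \<in> borel_measurable torus"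
     "(\<lambda>x. cnj (h x)) \<in> borel_measurable torus"
    using assms L2_torus_cnj L2_torus_measurable by blast+
  show ?thesis
    unfolding L2_inner_def
    by (intro integral_cong_AE) (use assms(1) in \<open>auto elim: eventually_mono\<close>)
qed

lemma L2_inner_has_sum:
  assumes "summable_coeffs c" "h \<in> L2_torus" "f \<in> L2_torus" "fourier_coeff f = c"
  shows "((\<lambda>k. c k * cnj (fourier_coeff h k)) has_sum L2_inner f h) UNIV"
proof -
  have "L2_inner f h = (LINT x|torus. fser c x * cnj (h x))"
    using L2_inner_cong_AE[OF _ _ L2_torus_fser[OF assms(1)], of f h] AE_eq_fser[of f] assms
    by (simp add: L2_inner_def)
  moreover have "(LINT x|torus. mode k x * cnj (h x)) = cnj (fourier_coeff h k)" for k
    using fun_cong[OF fourier_coeff_cnj[of h], of "- k"]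
    by (simp add: fourier_coeff_mode conj_coeffs_def mult.commute)
  ultimately show ?thesis
    using fser_pairing[OF assms(1) L2_torus_integrable[OF L2_torus_cnj[OF assms(2)]]] by simp
qed

lemma L2_integral_schroedinger:
  assumes f: "f \<in> L2_torus" "summable_coeffs (fourier_coeff f)" and \<tau>: "0 \<le> \<tau>"
  defines "g \<equiv> L2_integral 0 \<tau> (\<lambda>s. schroedinger (- 2 * s) f)"
  shows "g \<in> L2_torus" and "fourier_coeff g = (\<lambda>k. phi_symbol \<tau> k * fourier_coeff f k)"
proof -
  define c where "c = fourier_coeff f"
  define d where "d = (\<lambda>k. phi_symbol \<tau> k * c k)"
  have c: "summable_coeffs c" using f by (simp add: c_def)
  have d: "summable_coeffs d" unfolding d_def
    by (rule summable_coeffs_mult[OF c norm_phi_symbol_le[OF \<tau>]])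
  \<comment> \<open>Both sides are limits of the same finite sums, since the series for the integrand converges
    uniformly in \<open>s\<close>.\<close>
  have eq: "L2_inner (fser d) h = integral {0..\<tau>} (\<lambda>s. L2_inner (schroedinger (- 2 * s) f) h)"
    if h: "h \<in> L2_torus" for h
  proof -
    define q where "q = (\<lambda>k. c k * cnj (fourier_coeff h k))"
    have q: "(\<lambda>k. cmod (q k)) summable_on UNIV"
    proof -
      define B where "B = (LINT x|torus. cmod (h x))"
      have "cmod (cnj (fourier_coeff h k)) \<le> B" for k
        unfolding fourier_coeff_mode complex_mod_cnj B_def
        by (rule order_trans[OF integral_norm_bound]) (simp add: norm_mult)
      from summable_coeffs_mult[OF c this] show ?thesis
        by (simp add: q_def summable_coeffs_def mult.commute)
    qed
    have inner: "((\<lambda>k. q k * cis (2 * freq k * s)) has_sum L2_inner (schroedinger (- 2 * s) f) h) UNIV" for s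
      using L2_inner_has_sum[OF _ h schroedinger_summable[OF f(2), of "- 2 * s"]] c
      by (simp add: c_def[symmetric] flow_def q_def ac_simps)
    have ul: "uniform_limit {0..\<tau>} (\<lambda>K s. \<Sum>k\<in>K. q k * cis (2 * freq k * s))
        (\<lambda>s. L2_inner (schroedinger (- 2 * s) f) h) (finite_subsets_at_top UNIV)"
      by (rule Weierstrass_m_test_general'[OF _ inner q]) (simp add: norm_mult)
    obtain I J where IJ:
      "\<And>K. ((\<lambda>s. \<Sum>k\<in>K. q k * cis (2 * freq k * s)) has_integral I K) {0..\<tau>}"
      "((\<lambda>s. L2_inner (schroedinger (- 2 * s) f) h) has_integral J) {0..\<tau>}"
      "(I \<longlongrightarrow> J) (finite_subsets_at_top UNIV)"
      by (rule uniform_limit_integral[OF ul]) (auto intro!: continuous_intros)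
    have "I K = (\<Sum>k\<in>K. d k * cnj (fourier_coeff h k))" if "finite K" for K
    proof (rule has_integral_unique[OF IJ(1)])
      have "((\<lambda>s. \<Sum>k\<in>K. q k * cis (2 * freq k * s)) has_integral (\<Sum>k\<in>K. q k * phi_symbol \<tau> k)) {0..\<tau>}"
        by (intro has_integral_sum that has_integral_mult_right phi_symbol_has_integral)
      then show "((\<lambda>s. \<Sum>k\<in>K. q k * cis (2 * freq k * s)) has_integral (\<Sum>k\<in>K. d k * cnj (fourier_coeff h k))) {0..\<tau>}"
        by (simp add: q_def d_def ac_simps)
    qed
    then have "((\<lambda>K. \<Sum>k\<in>K. d k * cnj (fourier_coeff h k)) \<longlongrightarrow> J) (finite_subsets_at_top UNIV)"
      using IJ(3) by (rule_tac Lim_transform_eventually) (auto intro: eventually_finite_subsets_at_top_weakI)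
    then have "((\<lambda>k. d k * cnj (fourier_coeff h k)) has_sum J) UNIV"
      by (simp add: has_sum_def)
    moreover have "((\<lambda>k. d k * cnj (fourier_coeff h k)) has_sum L2_inner (fser d) h) UNIV"
      by (rule L2_inner_has_sum[OF d h L2_torus_fser[OF d]]) (rule ext, rule fourier_coeff_fser[OF d])
    ultimately show ?thesis
      using IJ(2) has_sum_unique integral_unique by metis
  qed
  have "\<exists>g. g \<in> L2_torus \<and>
        (\<forall>h\<in>L2_torus. L2_inner g h = integral {0..\<tau>} (\<lambda>s. L2_inner (schroedinger (- 2 * s) f) h))"
    using eq L2_torus_fser[OF d] by blast
  then have g: "g \<in> L2_torus \<and>
        (\<forall>h\<in>L2_torus. L2_inner g h = integral {0..\<tau>} (\<lambda>s. L2_inner (schroedinger (- 2 * s) f) h))"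
    unfolding g_def L2_integral_def by (rule someI_ex)
  then show "g \<in> L2_torus" by blast
  show "fourier_coeff g = (\<lambda>k. phi_symbol \<tau> k * fourier_coeff f k)"
  proof
    fix k
    \<comment> \<open>Testing with the Fourier modes identifies the coefficients.\<close>
    have "mode k \<in> L2_torus"
      unfolding L2_torus_def
      by (auto intro!: measurable_period_continuous integrable_period_continuous continuous_intros)
    then have "L2_inner g (mode k) = L2_inner (fser d) (mode k)" using g eq by simp
    then have "fourier_coeff g k = fourier_coeff (fser d) k"
      by (simp add: L2_inner_def fourier_coeff_mode cnj_mode)
    then show "fourier_coeff g k = phi_symbol \<tau> k * fourier_coeff f k"
      unfolding fourier_coeff_fser[OF d] by (simp add: d_def c_def)
  qed
qed

text \<open>\<open>\<tau>\<close> times the nonlinear term of the scheme, for the function with coefficients \<open>a\<close>.\<close>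

definition scheme_cubic :: "real \<Rightarrow> (int \<Rightarrow> complex) \<Rightarrow> int \<Rightarrow> complex" where
  "scheme_cubic \<tau> a = fourier_coeff (\<lambda>x. (fser a x)\<^sup>2 * fser (\<lambda>k. phi_symbol \<tau> k * conj_coeffs a k) x)"

definition scheme_step :: "real \<Rightarrow> real \<Rightarrow> (int \<Rightarrow> complex) \<Rightarrow> int \<Rightarrow> complex" where
  "scheme_step \<tau> \<mu> a = flow \<tau> (\<lambda>k. a k - \<i> * of_real \<mu> * scheme_cubic \<tau> a k)"

lemma scheme_Suc_coeffs:
  assumes \<tau>: "0 < \<tau>" and v: "scheme \<tau> \<mu> u0 n \<in> L2_torus" "fourier_coeff (scheme \<tau> \<mu> u0 n) = a"
    and a: "summable_coeffs a" "summable_coeffs (scheme_cubic \<tau> a)"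
  shows "scheme \<tau> \<mu> u0 (Suc n) \<in> L2_torus"
    and "fourier_coeff (scheme \<tau> \<mu> u0 (Suc n)) = scheme_step \<tau> \<mu> a"
proof -
  let ?v = "scheme \<tau> \<mu> u0 n"
  define g where "g = (\<lambda>x. ?v x - \<i> * of_real \<tau> * of_real \<mu> * (?v x)\<^sup>2 * phi1 \<tau> (\<lambda>y. cnj (?v y)) x)"
  define b where "b = (\<lambda>k. phi_symbol \<tau> k * conj_coeffs a k)"
  define w where "w = L2_integral 0 \<tau> (\<lambda>s. schroedinger (- 2 * s) (\<lambda>y. cnj (?v y)))"
  have b: "summable_coeffs b"
    unfolding b_def using \<tau>
    by (intro summable_coeffs_mult[OF summable_coeffs_conj_coeffs[OF a(1)] norm_phi_symbol_le]) simp
  have w: "w \<in> L2_torus" "fourier_coeff w = b"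
    using L2_integral_schroedinger[OF L2_torus_cnj[OF v(1)], of \<tau>] \<tau> v a
    by (simp_all add: w_def b_def fourier_coeff_cnj summable_coeffs_conj_coeffs)
  define G where "G = (\<lambda>x. fser a x - \<i> * of_real \<mu> * ((fser a x)\<^sup>2 * fser b x))"
  have gw: "g x = ?v x - \<i> * of_real \<mu> * ((?v x)\<^sup>2 * w x)" for x
    using \<tau> by (simp add: g_def phi1_def w_def)
  \<comment> \<open>Up to null sets the update is a continuous function built from Fourier series.\<close>
  have ae: "AE x in torus. g x = G x"
    using AE_eq_fser[OF v(1)] AE_eq_fser[OF w(1)] unfolding v w
    by (auto simp: gw G_def a b elim!: eventually_rev_mp)
  have [measurable]: "?v \<in> borel_measurable torus" "w \<in> borel_measurable torus"
    using v w L2_torus_measurable by auto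
  have mg: "g \<in> borel_measurable torus"
    unfolding gw[abs_def] by measurable
  have cG: "continuous_on UNIV G" "continuous_on UNIV (\<lambda>x. (fser a x)\<^sup>2 * fser b x)"
    unfolding G_def by (intro continuous_intros a b)+
  have "fourier_coeff g = fourier_coeff G"
    by (rule fourier_coeff_cong_AE[OF ae mg measurable_period_continuous[OF cG(1)]])
  also have "fourier_coeff G = (\<lambda>k. a k - \<i> * of_real \<mu> * scheme_cubic \<tau> a k)"
  proof
    fix k
    have i: "integrable torus (\<lambda>x. fser a x * mode (- k) x)"
      "integrable torus (\<lambda>x. (fser a x)\<^sup>2 * fser b x * mode (- k) x)"
      by (intro integrable_period_continuous continuous_intros a b cG)+
    have "fourier_coeff G k = (LINT x|torus. fser a x * mode (- k) x
          - \<i> * of_real \<mu> * ((fser a x)\<^sup>2 * fser b x * mode (- k) x))"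
      by (simp add: fourier_coeff_mode G_def left_diff_distrib mult.assoc)
    also have "\<dots> = fourier_coeff (fser a) k - \<i> * of_real \<mu> * scheme_cubic \<tau> a k"
      using i by (simp add: scheme_cubic_def fourier_coeff_mode b_def)
    finally show "fourier_coeff G k = a k - \<i> * of_real \<mu> * scheme_cubic \<tau> a k"
      by (simp add: fourier_coeff_fser a)
  qed
  finally have cg: "fourier_coeff g = (\<lambda>k. a k - \<i> * of_real \<mu> * scheme_cubic \<tau> a k)" .
  have "summable_coeffs (fourier_coeff g)"
    unfolding cg
    by (intro summable_coeffs_diff a summable_coeffs_mult[where L = "\<bar>\<mu>\<bar>"]) (simp add: norm_mult)
  from schroedinger_summable[OF this, of \<tau>]
  show "scheme \<tau> \<mu> u0 (Suc n) \<in> L2_torus"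
    and "fourier_coeff (scheme \<tau> \<mu> u0 (Suc n)) = scheme_step \<tau> \<mu> a"
    by (simp_all add: g_def[symmetric] cg scheme_step_def)
qed

section \<open>Lipschitz estimates for the nonlinearities\<close>

lemma fourier_coeff_diff:
  assumes "continuous_on UNIV f" "continuous_on UNIV g"
  shows "fourier_coeff (\<lambda>x. f x - g x) k = fourier_coeff f k - fourier_coeff g k"
proof -
  have "integrable torus (\<lambda>x. f x * mode (- k) x)" "integrable torus (\<lambda>x. g x * mode (- k) x)"
    by (intro integrable_period_continuous continuous_intros assms)+
  then show ?thesis by (simp add: fourier_coeff_mode left_diff_distrib)
qed

lemma integral_period_mono:
  fixes f g :: "real \<Rightarrow> real"
  assumes "continuous_on UNIV f" "continuous_on UNIV g" "\<And>x. f x \<le> g x"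
  shows "(LINT x|torus. f x) \<le> (LINT x|torus. g x)"
  by (intro integral_mono integrable_period_continuous assms)

definition cubic :: "(int \<Rightarrow> complex) \<Rightarrow> int \<Rightarrow> complex" where
  "cubic a = fourier_coeff (\<lambda>x. (of_real (cmod (fser a x)))\<^sup>2 * fser a x)"

text \<open>The sup norm of a function is at most the \<open>l\<^sup>1\<close> norm of its coefficients. Hence differences of
  cubic expressions are bounded pointwise by a multiple of the difference of the functions;
  Parseval's identity and Bessel's inequality translate this to coefficients.\<close>

lemma cubic_lipschitz:
  assumes a: "l1_le a R" and b: "l1_le b R" and d: "l2_le (\<lambda>k. a k - b k) B"
  shows "l2_le (\<lambda>k. cubic a k - cubic b k) (3 * R\<^sup>2 * B)"
proof -
  note s = l1_le_summable_coeffs[OF a] l1_le_summable_coeffs[OF b]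
  define f where "f = (\<lambda>c x. (complex_of_real (cmod (fser c x)))\<^sup>2 * fser c x)"
  have cf: "continuous_on UNIV (f a)" "continuous_on UNIV (f b)"
    unfolding f_def by (intro continuous_intros s)+
  have R: "0 \<le> R" and B: "0 \<le> B" using l1_le_nonneg[OF a] l2_le_nonneg[OF d] by auto
  have pw: "cmod (f a x - f b x) \<le> 3 * R\<^sup>2 * cmod (fser (\<lambda>k. a k - b k) x)" for x
  proof -
    define z w where "z = fser a x" "w = fser b x"
    have zw: "cmod z \<le> R" "cmod w \<le> R" using norm_fser_le a b by (auto simp: z_w_def)
    have "f a x - f b x = z * cnj z * (z - w) + z * w * cnj (z - w) + w * cnj w * (z - w)"
      by (simp add: f_def z_w_def[symmetric] complex_norm_square[symmetric] flip: of_real_power)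
        (simp add: complex_norm_square algebra_simps del: of_real_power)
    also have "cmod \<dots> \<le> cmod (z * cnj z * (z - w)) + cmod (z * w * cnj (z - w)) + cmod (w * cnj w * (z - w))"
      by (meson norm_triangle_ineq norm_triangle_le add_mono order_refl)
    also have "\<dots> = (cmod z * cmod z + cmod z * cmod w + cmod w * cmod w) * cmod (z - w)"
      unfolding norm_mult complex_mod_cnj by (simp add: algebra_simps)
    also have "\<dots> \<le> (R * R + R * R + R * R) * cmod (z - w)"
      using zw R by (intro mult_right_mono add_mono mult_mono) auto
    finally show ?thesis
      by (simp add: z_w_def fser_diff[OF s] power2_eq_square)
  qed
  have "l2_le (fourier_coeff (\<lambda>x. f a x - f b x)) (3 * R\<^sup>2 * B)"
  proof (rule bessel)
    have "(LINT x|torus. (cmod (f a x - f b x))\<^sup>2) \<le>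
        (LINT x|torus. (3 * R\<^sup>2)\<^sup>2 * (cmod (fser (\<lambda>k. a k - b k) x))\<^sup>2)"
      unfolding power_mult_distrib[symmetric]
      by (intro integral_period_mono continuous_intros cf summable_coeffs_diff s power_mono pw norm_ge_zero)
    also have "\<dots> \<le> (3 * R\<^sup>2)\<^sup>2 * B\<^sup>2"
      using parseval_le[OF summable_coeffs_diff[OF s] d] by (simp add: mult_left_mono)
    finally show "(LINT x|torus. (cmod (f a x - f b x))\<^sup>2) \<le> (3 * R\<^sup>2 * B)\<^sup>2"
      by (simp add: power_mult_distrib)
  qed (use B in \<open>auto intro!: continuous_intros cf\<close>)
  moreover have "fourier_coeff (\<lambda>x. f a x - f b x) = (\<lambda>k. cubic a k - cubic b k)"
    by (rule ext, subst fourier_coeff_diff[OF cf]) (simp add: cubic_def f_def)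
  ultimately show ?thesis by simp
qed

lemma cubic_0: "cubic (\<lambda>k. 0) = (\<lambda>k. 0)"
  by (rule ext) (simp add: cubic_def fser_def fourier_coeff_def)

lemma cubic_bound:
  assumes a: "l1_le a R" "l2_le a B"
  shows "l2_le (cubic a) (3 * R\<^sup>2 * B)"
  using cubic_lipschitz[OF a(1) l1_le_mono[of "\<lambda>k. 0" 0 R], of B] a l1_le_nonneg[OF a(1)]
  by (simp add: cubic_0 l1_le_def)

text \<open>The same argument as for \<open>cubic\<close>, with one modification: the third factor results
  from a nonlocal operator, so it is not controlled pointwise by the difference of the functions.
  Its \<open>L\<^sup>2\<close> norm is controlled, because the symbol is bounded by \<open>\<tau>\<close>.\<close>

lemma scheme_cubic_lipschitz:
  assumes a: "l1_le a R" and b: "l1_le b R" and d: "l2_le (\<lambda>k. a k - b k) B" and \<tau>: "0 \<le> \<tau>"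
  shows "l2_le (\<lambda>k. scheme_cubic \<tau> a k - scheme_cubic \<tau> b k) (4 * \<tau> * R\<^sup>2 * B)"
proof -
  note s = l1_le_summable_coeffs[OF a] l1_le_summable_coeffs[OF b]
  have R: "0 \<le> R" and B: "0 \<le> B" using l1_le_nonneg[OF a] l2_le_nonneg[OF d] by auto
  define p where "p = (\<lambda>c k. phi_symbol \<tau> k * conj_coeffs c k)"
  have p1: "l1_le (p c) (\<tau> * R)" if "l1_le c R" for c
    unfolding p_def using norm_phi_symbol_le[OF \<tau>] l1_le_conj_coeffs[OF that] by (intro l1_le_mult)
  note sp = l1_le_summable_coeffs[OF p1[OF a]] l1_le_summable_coeffs[OF p1[OF b]]
  have p2: "l2_le (\<lambda>k. p a k - p b k) (\<tau> * B)"
  proof -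
    have "l2_le (\<lambda>k. phi_symbol \<tau> k * conj_coeffs (\<lambda>k. a k - b k) k) (\<tau> * B)"
      by (rule l2_le_mult[OF l2_le_conj_coeffs[OF d] norm_phi_symbol_le[OF \<tau>]])
    then show ?thesis by (simp add: p_def conj_coeffs_def algebra_simps)
  qed
  define f where "f = (\<lambda>c x. (fser c x)\<^sup>2 * fser (p c) x)"
  have cf: "continuous_on UNIV (f a)" "continuous_on UNIV (f b)"
    unfolding f_def by (intro continuous_intros s sp)+
  define D E where "D = (\<lambda>x. cmod (fser (\<lambda>k. a k - b k) x))"
    and "E = (\<lambda>x. cmod (fser (\<lambda>k. p a k - p b k) x))"
  have DE: "continuous_on UNIV D" "continuous_on UNIV E"
    unfolding D_def E_def by (intro continuous_intros summable_coeffs_diff s sp)+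
  have pw: "(cmod (f a x - f b x))\<^sup>2 \<le> 8 * (\<tau> * R\<^sup>2)\<^sup>2 * (D x)\<^sup>2 + 2 * (R\<^sup>2)\<^sup>2 * (E x)\<^sup>2" for x
  proof -
    define z w y v where "z = fser a x" "w = fser b x" "y = fser (p a) x" "v = fser (p b) x"
    note df = z_w_y_v_def
    have zw: "cmod z \<le> R" "cmod w \<le> R" "cmod y \<le> \<tau> * R" "cmod v \<le> \<tau> * R"
      unfolding df by (intro norm_fser_le p1 a b)+
    have "f a x - f b x = (z - w) * (z + w) * y + w * w * (y - v)"
      by (simp add: f_def df[symmetric] power2_eq_square algebra_simps)
    also have "cmod \<dots> \<le> cmod (z - w) * cmod (z + w) * cmod y + cmod w * cmod w * cmod (y - v)"
      using norm_triangle_ineq by (simp only: norm_mult[symmetric])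
    also have "\<dots> \<le> cmod (z - w) * (R + R) * (\<tau> * R) + R * R * cmod (y - v)"
      using zw R \<tau> norm_triangle_ineq[of z w]
      by (intro add_mono mult_mono mult_left_mono) auto
    also have "\<dots> = 2 * (\<tau> * R\<^sup>2) * D x + R\<^sup>2 * E x"
      by (simp add: D_def E_def fser_diff[OF s] fser_diff[OF sp] df power2_eq_square algebra_simps)
    finally have "(cmod (f a x - f b x))\<^sup>2 \<le> (2 * (\<tau> * R\<^sup>2) * D x + R\<^sup>2 * E x)\<^sup>2"
      by (rule power_mono) simp
    also have "\<dots> \<le> 2 * (2 * (\<tau> * R\<^sup>2) * D x)\<^sup>2 + 2 * (R\<^sup>2 * E x)\<^sup>2"
      using sum_squares_bound[of "2 * (\<tau> * R\<^sup>2) * D x" "R\<^sup>2 * E x"] unfolding power2_sum by linarith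
    finally show ?thesis by (simp add: power_mult_distrib)
  qed
  have "l2_le (fourier_coeff (\<lambda>x. f a x - f b x)) (4 * \<tau> * R\<^sup>2 * B)"
  proof (rule bessel)
    have "(LINT x|torus. (cmod (f a x - f b x))\<^sup>2) \<le>
        (LINT x|torus. 8 * (\<tau> * R\<^sup>2)\<^sup>2 * (D x)\<^sup>2 + 2 * (R\<^sup>2)\<^sup>2 * (E x)\<^sup>2)"
      by (intro integral_period_mono continuous_intros cf pw DE)
    also have "\<dots> = 8 * (\<tau> * R\<^sup>2)\<^sup>2 * (LINT x|torus. (D x)\<^sup>2) + 2 * (R\<^sup>2)\<^sup>2 * (LINT x|torus. (E x)\<^sup>2)"
    proof -
      have "integrable torus (\<lambda>x. (D x)\<^sup>2)" "integrable torus (\<lambda>x. (E x)\<^sup>2)"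
        by (intro integrable_period_continuous continuous_intros DE)+
      then show ?thesis by simp
    qed
    also have "\<dots> \<le> 8 * (\<tau> * R\<^sup>2)\<^sup>2 * B\<^sup>2 + 2 * (R\<^sup>2)\<^sup>2 * (\<tau> * B)\<^sup>2"
      using parseval_le[OF summable_coeffs_diff[OF s] d] parseval_le[OF summable_coeffs_diff[OF sp] p2]
      by (intro add_mono mult_left_mono) (auto simp: D_def E_def)
    also have "\<dots> \<le> (4 * \<tau> * R\<^sup>2 * B)\<^sup>2"
      by (simp add: power_mult_distrib)
    finally show "(LINT x|torus. (cmod (f a x - f b x))\<^sup>2) \<le> (4 * \<tau> * R\<^sup>2 * B)\<^sup>2" .
  qed (use B \<tau> in \<open>auto intro!: continuous_intros cf\<close>)
  moreover have "fourier_coeff (\<lambda>x. f a x - f b x) = (\<lambda>k. scheme_cubic \<tau> a k - scheme_cubic \<tau> b k)"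
    by (rule ext, subst fourier_coeff_diff[OF cf]) (simp add: scheme_cubic_def f_def p_def)
  ultimately show ?thesis by simp
qed

lemma scheme_cubic_0: "scheme_cubic \<tau> (\<lambda>k. 0) = (\<lambda>k. 0)"
  by (rule ext) (simp add: scheme_cubic_def fser_def fourier_coeff_def)

lemma scheme_cubic_bound:
  assumes a: "l1_le a R" "l2_le a B" and \<tau>: "0 \<le> \<tau>"
  shows "l2_le (scheme_cubic \<tau> a) (4 * \<tau> * R\<^sup>2 * B)"
  using scheme_cubic_lipschitz[OF a(1) l1_le_mono[of "\<lambda>k. 0" 0 R], of B \<tau>] a l1_le_nonneg[OF a(1)] \<tau>
  by (simp add: scheme_cubic_0 l1_le_def)

section \<open>Translations and derivatives\<close>

lemma integral_period_shift:
  fixes f :: "real \<Rightarrow> complex"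
  assumes f: "continuous_on UNIV f" and per: "\<And>x. f (x + 1) = f x" and h: "0 \<le> h" "h \<le> 1"
  shows "integral {0..1} (\<lambda>x. f (x + h)) = integral {0..1} f"
proof -
  have i: "f integrable_on {a..b}" for a b
    by (intro integrable_continuous_interval continuous_on_subset[OF f]) auto
  have shift: "integral {a..b} (\<lambda>x. f (x + c)) = integral {a + c..b + c} f" for a b c
    using integral_shift_Icc_real[of a b f c] by (simp add: o_def add.commute)
  have "integral {0..1} (\<lambda>x. f (x + h)) = integral {h..1 + h} f"
    using shift[of 0 1 h] by simp
  also have "\<dots> = integral {h..1} f + integral {1..1 + h} f"
    using h by (intro Henstock_Kurzweil_Integration.integral_combine[symmetric] i) auto
  also have "integral {1..1 + h} f = integral {0..h} (\<lambda>x. f (x + 1))"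
    using shift[of 0 h 1] by (simp add: add.commute)
  also have "\<dots> = integral {0..h} f" by (simp add: per)
  also have "integral {h..1} f + integral {0..h} f = integral {0..1} f"
    using Henstock_Kurzweil_Integration.integral_combine[OF h i] by (simp add: add.commute)
  finally show ?thesis .
qed

lemma fourier_coeff_shift:
  assumes f: "continuous_on UNIV f" and per: "\<And>x. f (x + 1) = f x" and h: "0 \<le> h" "h \<le> 1"
  shows "fourier_coeff (\<lambda>x. f (x + h)) k = mode k h * fourier_coeff f k"
proof -
  have c: "continuous_on UNIV (\<lambda>x. f x * mode (- k) x)"
    by (intro continuous_intros f)
  have ch: "continuous_on UNIV (\<lambda>x. f (x + h) * mode (- k) x)"
    by (intro continuous_intros continuous_on_compose2[OF f]) auto
  have mm: "mode k h * mode (- k) h = 1"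
    using mode_add_left[of k "- k" h] by simp
  have "f (x + h) * mode (- k) x = mode k h * (f (x + h) * mode (- k) (x + h))" for x
    unfolding mode_add_right using mm by (simp add: mult.assoc mult.left_commute)
  then have "integral {0..1} (\<lambda>x. f (x + h) * mode (- k) x) =
      integral {0..1} (\<lambda>x. mode k h * (f (x + h) * mode (- k) (x + h)))"
    by (simp only:)
  then have "fourier_coeff (\<lambda>x. f (x + h)) k = mode k h * integral {0..1} (\<lambda>x. f (x + h) * mode (- k) (x + h))"
    unfolding fourier_coeff_mode integral_period_eq_integral[OF ch] by simp
  also have "integral {0..1} (\<lambda>x. f (x + h) * mode (- k) (x + h)) = integral {0..1} (\<lambda>x. f x * mode (- k) x)"
    by (rule integral_period_shift[OF c _ h]) (simp add: per)
  also have "\<dots> = fourier_coeff f k"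
    unfolding fourier_coeff_mode integral_period_eq_integral[OF c] ..
  finally show ?thesis .
qed

definition shift :: "real \<Rightarrow> (int \<Rightarrow> complex) \<Rightarrow> int \<Rightarrow> complex" where
  "shift h c k = mode k h * c k"

lemma norm_shift [simp]: "cmod (shift h c k) = cmod (c k)"
  by (simp add: shift_def norm_mult)

lemma l1_le_shift [simp]: "l1_le (shift h c) R = l1_le c R"
  by (simp add: l1_le_def)

lemma fser_shift: "fser (shift h c) x = fser c (x + h)"
  by (simp add: fser_def shift_def mode_add_right ac_simps)

lemma cubic_shift:
  assumes "summable_coeffs a" "0 \<le> h" "h \<le> 1"
  shows "cubic (shift h a) = shift h (cubic a)"
proof
  fix k
  have "fourier_coeff (\<lambda>x. (complex_of_real (cmod (fser a (x + h))))\<^sup>2 * fser a (x + h)) k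
      = mode k h * cubic a k"
    unfolding cubic_def
    by (rule fourier_coeff_shift[where f = "\<lambda>x. (complex_of_real (cmod (fser a x)))\<^sup>2 * fser a x", OF _ _ assms(2,3)])
      (auto intro!: continuous_intros assms)
  then show "cubic (shift h a) k = shift h (cubic a) k"
    by (simp add: cubic_def fser_shift shift_def[of h "cubic a", unfolded cubic_def])
qed

lemma scheme_cubic_shift:
  assumes "summable_coeffs a" "0 \<le> h" "h \<le> 1" "0 \<le> \<tau>"
  shows "scheme_cubic \<tau> (shift h a) = shift h (scheme_cubic \<tau> a)"
proof
  fix k
  define b where "b = (\<lambda>k. phi_symbol \<tau> k * conj_coeffs a k)"
  have b: "summable_coeffs b"
    unfolding b_def using assms
    by (intro summable_coeffs_mult[OF summable_coeffs_conj_coeffs norm_phi_symbol_le])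
  have sb: "(\<lambda>k. phi_symbol \<tau> k * conj_coeffs (shift h a) k) = shift h b"
    by (rule ext) (simp add: b_def shift_def conj_coeffs_def cnj_mode)
  have "fourier_coeff (\<lambda>x. (fser a (x + h))\<^sup>2 * fser b (x + h)) k = mode k h * scheme_cubic \<tau> a k"
    unfolding scheme_cubic_def b_def[symmetric]
    by (rule fourier_coeff_shift[where f = "\<lambda>x. (fser a x)\<^sup>2 * fser b x", OF _ _ assms(2,3)])
      (auto intro!: continuous_intros assms b)
  then show "scheme_cubic \<tau> (shift h a) k = shift h (scheme_cubic \<tau> a) k"
    unfolding shift_def[of h "scheme_cubic \<tau> a"] by (simp add: scheme_cubic_def sb fser_shift)
qed

definition dx :: "(int \<Rightarrow> complex) \<Rightarrow> int \<Rightarrow> complex" where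
  "dx c k = 2 * pi * \<i> * of_int k * c k"

lemma norm_mode_diff: "cmod (mode k h - 1) \<le> \<bar>h\<bar> * (2 * pi * \<bar>of_int k\<bar>)"
proof -
  have "cmod (mode k h - 1) \<le> \<bar>2 * pi * of_int k * h\<bar>"
    using dist_exp_i_1[of "2 * pi * of_int k * h"] abs_sin_x_le_abs_x[of "pi * of_int k * h"]
    by (simp add: mode_def cis_conv_exp dist_norm abs_mult mult_ac)
  then show ?thesis by (simp add: abs_mult mult_ac)
qed

lemma l2_le_shift_diff:
  assumes "l2_le (dx c) B"
  shows "l2_le (\<lambda>k. shift h c k - c k) (\<bar>h\<bar> * B)"
proof -
  have "l2_le (\<lambda>k. of_real \<bar>h\<bar> * dx c k) (\<bar>h\<bar> * B)"
    by (rule l2_le_mult[OF assms]) simp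
  moreover have "cmod (shift h c k - c k) \<le> cmod (of_real \<bar>h\<bar> * dx c k)" for k
  proof -
    have "shift h c k - c k = (mode k h - 1) * c k" by (simp add: shift_def algebra_simps)
    then show ?thesis
      using mult_right_mono[OF norm_mode_diff[of k h] norm_ge_zero[of "c k"]]
      by (simp add: norm_mult dx_def mult_ac)
  qed
  ultimately show ?thesis by (rule l2_le_cmod_mono)
qed

text \<open>Translations characterise \<open>H\<^sup>1\<close>. Together with the previous lemma this upgrades any \<open>L\<^sup>2\<close> Lipschitz
  bound for a translation invariant map to a bound for derivatives, without a product rule.\<close>

lemma l2_le_dx_of_shift_diff:
  assumes "\<And>h. 0 < h \<Longrightarrow> h \<le> 1 \<Longrightarrow> l2_le (\<lambda>k. shift h c k - c k) (h * B)"
  shows "l2_le (dx c) B"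
  unfolding l2_le_def
proof (intro allI impI)
  fix K :: "int set" assume K: "finite K"
  \<comment> \<open>Difference quotients of a single mode converge to its derivative; only finitely many modes matter.\<close>
  have lim: "((\<lambda>h. (shift h c k - c k) / of_real h) \<longlongrightarrow> dx c k) (at_right 0)" for k
  proof -
    let ?w = "2 * of_real pi * \<i> * of_int k :: complex"
    have "((\<lambda>z. exp (?w * z)) has_field_derivative ?w) (at 0)"
      by (auto intro!: derivative_eq_intros)
    then have "((\<lambda>z. (exp (?w * z) - 1) / z) \<longlongrightarrow> ?w) (at 0)"
      by (simp add: DERIV_def)
    moreover have "filterlim complex_of_real (at 0) (at_right 0)"
      by (auto simp: filterlim_at eventually_at_filter intro!: tendsto_eq_intros)
    ultimately have "((\<lambda>h. (exp (?w * of_real h) - 1) / of_real h) \<longlongrightarrow> ?w) (at_right 0)"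
      by (rule filterlim_compose)
    then have "((\<lambda>h. (exp (?w * of_real h) - 1) / of_real h * c k) \<longlongrightarrow> ?w * c k) (at_right 0)"
      by (intro tendsto_intros)
    moreover have "(exp (?w * of_real h) - 1) / of_real h * c k = (shift h c k - c k) / of_real h" for h
      by (simp add: shift_def mode_def cis_conv_exp mult_ac right_diff_distrib)
    ultimately show ?thesis by (simp only: dx_def of_real_mult of_real_numeral)
  qed
  have "((\<lambda>h. L2_set (\<lambda>k. cmod ((shift h c k - c k) / of_real h)) K) \<longlongrightarrow> L2_set (\<lambda>k. cmod (dx c k)) K) (at_right 0)"
    unfolding L2_set_def by (intro tendsto_intros lim)
  moreover have "\<forall>\<^sub>F h in at_right 0. L2_set (\<lambda>k. cmod ((shift h c k - c k) / of_real h)) K \<le> B"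
  proof -
    have "L2_set (\<lambda>k. cmod ((shift h c k - c k) / of_real h)) K \<le> B" if h: "0 < h" "h < 1" for h :: real
    proof -
      have "l2_le (\<lambda>k. of_real (1 / h) * (shift h c k - c k)) (1 / h * (h * B))"
        using h by (intro l2_le_mult assms) (auto simp: norm_divide)
      then have "l2_le (\<lambda>k. (shift h c k - c k) / of_real h) B" using h by simp
      then show ?thesis using K by (rule l2_leD)
    qed
    then show ?thesis
      by (auto simp: eventually_at_right_field intro!: exI[of _ 1])
  qed
  ultimately show "L2_set (\<lambda>k. cmod (dx c k)) K \<le> B"
    by (rule tendsto_upperbound) simp
qed

lemma scheme_cubic_dx:
  assumes a: "l1_le a R" "l2_le (dx a) B" and \<tau>: "0 \<le> \<tau>"
  shows "l2_le (dx (scheme_cubic \<tau> a)) (4 * \<tau> * R\<^sup>2 * B)"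
proof (rule l2_le_dx_of_shift_diff)
  fix h :: real assume h: "0 < h" "h \<le> 1"
  have "l2_le (\<lambda>k. scheme_cubic \<tau> (shift h a) k - scheme_cubic \<tau> a k) (4 * \<tau> * R\<^sup>2 * (h * B))"
    using a h l2_le_shift_diff[OF a(2), of h] by (intro scheme_cubic_lipschitz \<tau>) auto
  then show "l2_le (\<lambda>k. shift h (scheme_cubic \<tau> a) k - scheme_cubic \<tau> a k) (h * (4 * \<tau> * R\<^sup>2 * B))"
    using h \<tau> by (simp add: scheme_cubic_shift l1_le_summable_coeffs[OF a(1)] mult_ac)
qed

lemma cubic_dx:
  assumes a: "l1_le a R" "l2_le (dx a) B"
  shows "l2_le (dx (cubic a)) (3 * R\<^sup>2 * B)"
proof (rule l2_le_dx_of_shift_diff)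
  fix h :: real assume h: "0 < h" "h \<le> 1"
  have "l2_le (\<lambda>k. cubic (shift h a) k - cubic a k) (3 * R\<^sup>2 * (h * B))"
    using a h l2_le_shift_diff[OF a(2), of h] by (intro cubic_lipschitz) auto
  then show "l2_le (\<lambda>k. shift h (cubic a) k - cubic a k) (h * (3 * R\<^sup>2 * B))"
    using h by (simp add: cubic_shift l1_le_summable_coeffs[OF a(1)] mult_ac)
qed

section \<open>Embedding of the first Sobolev space into absolutely convergent series\<close>

lemma summable_inverse_freq: "(\<lambda>k. 1 / (1 + freq k)) summable_on UNIV"
proof -
  have nat: "(\<lambda>n. 1 / (1 + freq (int n))) summable_on UNIV"
  proof (rule norm_summable_imp_summable_on)
    have "summable (\<lambda>n. inverse ((real n)\<^sup>2))" by (rule inverse_power_summable) simp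
    then show "summable (\<lambda>n. norm (1 / (1 + freq (int n))))"
    proof (rule summable_comparison_test'[where N = 1])
      fix n :: nat assume "n \<ge> 1"
      have "1 * real n \<le> 2 * pi * real n" using pi_gt3 by (intro mult_right_mono) auto
      then have "(real n)\<^sup>2 \<le> (2 * pi * real n)\<^sup>2" by (intro power_mono) auto
      then have "(real n)\<^sup>2 \<le> 1 + (2 * pi * real n)\<^sup>2" by linarith
      then have "1 / (1 + (2 * pi * real n)\<^sup>2) \<le> 1 / (real n)\<^sup>2"
        using \<open>n \<ge> 1\<close> by (intro frac_le) simp_all
      then show "norm (norm (1 / (1 + freq (int n)))) \<le> inverse ((real n)\<^sup>2)"
        by (simp only: freq_def inverse_eq_divide of_int_of_nat_eq) simp
    qed
  qed
  have "(\<lambda>k. 1 / (1 + freq k)) summable_on {0..}"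
  proof -
    have "bij_betw int UNIV {0..}" by (rule bij_betwI[of _ _ _ nat]) auto
    from summable_on_reindex_bij_betw[OF this, of "\<lambda>k. 1 / (1 + freq k)"] nat show ?thesis by simp
  qed
  moreover have "(\<lambda>k. 1 / (1 + freq k)) summable_on {..0}"
  proof -
    have "bij_betw (\<lambda>n. - int n) UNIV {..0}" by (rule bij_betwI[of _ _ _ "\<lambda>k. nat (- k)"]) auto
    from summable_on_reindex_bij_betw[OF this, of "\<lambda>k. 1 / (1 + freq k)"] nat
    show ?thesis by (simp add: freq_def)
  qed
  then have "(\<lambda>k. 1 / (1 + freq k)) summable_on {..<0}"
    by (rule summable_on_subset_banach) auto
  ultimately have "(\<lambda>k. 1 / (1 + freq k)) summable_on ({0..} \<union> {..<0})"
    by (rule summable_on_Un_disjoint) auto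
  moreover have "{0..} \<union> {..<0} = (UNIV :: int set)" by auto
  ultimately show ?thesis by simp
qed

definition h1_le :: "(int \<Rightarrow> complex) \<Rightarrow> real \<Rightarrow> bool" where
  "h1_le c B \<longleftrightarrow> l2_le (\<lambda>k. of_real (sqrt (1 + freq k)) * c k) B"

lemma freq_nonneg [simp]: "0 \<le> freq k"
  by (simp add: freq_def)

lemma h1_le_l2_le: "h1_le c B \<Longrightarrow> l2_le c B"
  unfolding h1_le_def
  by (erule l2_le_cmod_mono) (simp add: norm_mult mult_le_cancel_right1)

lemma cmod_dx: "cmod (dx c k) = sqrt (freq k) * cmod (c k)"
  by (simp add: dx_def norm_mult freq_def abs_mult)

lemma h1_le_dx: "h1_le c B \<Longrightarrow> l2_le (dx c) B"
  unfolding h1_le_def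
  by (erule l2_le_cmod_mono) (simp add: norm_mult cmod_dx mult_right_mono)

lemma h1_leI:
  assumes "l2_le c A" "l2_le (dx c) B"
  shows "h1_le c (A + B)"
  unfolding h1_le_def l2_le_def
proof (intro allI impI)
  fix K :: "int set" assume K: "finite K"
  have "sqrt (1 + freq k) \<le> 1 + sqrt (freq k)" for k
    using sqrt_add_le_add_sqrt[of 1 "freq k"] by simp
  then have "L2_set (\<lambda>k. cmod (of_real (sqrt (1 + freq k)) * c k)) K \<le> L2_set (\<lambda>k. cmod (c k) + cmod (dx c k)) K"
    by (intro L2_set_mono)
      (auto simp: norm_mult cmod_dx distrib_right[of 1 "sqrt _", simplified, symmetric] intro!: mult_right_mono)
  also have "\<dots> \<le> L2_set (\<lambda>k. cmod (c k)) K + L2_set (\<lambda>k. cmod (dx c k)) K"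
    by (rule L2_set_triangle_ineq)
  also have "\<dots> \<le> A + B" using assms K by (intro add_mono l2_leD)
  finally show "L2_set (\<lambda>k. cmod (of_real (sqrt (1 + freq k)) * c k)) K \<le> A + B" .
qed

lemma h1_le_sum_le:
  assumes "h1_le c B" "finite K"
  shows "(\<Sum>k\<in>K. cmod (c k)) \<le> sqrt (\<Sum>k\<in>K. 1 / (1 + freq k)) * B"
proof -
  \<comment> \<open>Cauchy-Schwarz with the Sobolev weight.\<close>
  define w where "w = (\<lambda>k. sqrt (1 + freq k))"
  have w: "w k > 0" for k by (simp add: w_def add_pos_nonneg)
  have "(\<Sum>k\<in>K. cmod (c k)) = (\<Sum>k\<in>K. \<bar>1 / w k\<bar> * \<bar>cmod (of_real (w k) * c k)\<bar>)"
    using w by (intro sum.cong refl) (simp add: norm_mult abs_mult less_imp_neq[OF w, symmetric])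
  also have "\<dots> \<le> L2_set (\<lambda>k. 1 / w k) K * L2_set (\<lambda>k. cmod (of_real (w k) * c k)) K"
    by (rule L2_set_mult_ineq)
  also have "\<dots> \<le> L2_set (\<lambda>k. 1 / w k) K * B"
    using assms by (intro mult_left_mono) (auto simp: h1_le_def w_def intro!: l2_leD)
  also have "L2_set (\<lambda>k. 1 / w k) K = sqrt (\<Sum>k\<in>K. 1 / (1 + freq k))"
    by (simp add: L2_set_def w_def power_divide)
  finally show ?thesis .
qed

definition embed_const :: real where
  "embed_const = sqrt (\<Sum>\<^sub>\<infinity>k. 1 / (1 + freq k))"

lemma h1_le_l1_le:
  assumes "h1_le c B"
  shows "l1_le c (embed_const * B)"
  unfolding l1_le_def
proof (intro allI impI)
  fix K :: "int set" assume K: "finite K"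
  have "(\<Sum>k\<in>K. 1 / (1 + freq k)) \<le> (\<Sum>\<^sub>\<infinity>k. 1 / (1 + freq k))"
    using K by (intro finite_sum_le_infsum summable_inverse_freq) auto
  then show "(\<Sum>k\<in>K. cmod (c k)) \<le> embed_const * B"
    using h1_le_sum_le[OF assms K] l2_le_nonneg[OF h1_le_l2_le[OF assms]]
    unfolding embed_const_def by (meson mult_right_mono order_trans real_sqrt_le_mono)
qed

text \<open>The high frequencies of a bounded set in \<open>H\<^sup>1\<close> are uniformly small in \<open>l\<^sup>1\<close>; this is what closes the
  bootstrap argument.\<close>

lemma h1_le_l1_tail:
  assumes "\<epsilon> > 0"
  obtains J where "finite J" "\<And>c B K. h1_le c B \<Longrightarrow> finite K \<Longrightarrow> K \<inter> J = {} \<Longrightarrow> (\<Sum>k\<in>K. cmod (c k)) \<le> \<epsilon> * B"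
proof -
  define S where "S = (\<Sum>\<^sub>\<infinity>k. 1 / (1 + freq k))"
  obtain J where J: "finite J" "dist (\<Sum>k\<in>J. 1 / (1 + freq k)) S \<le> \<epsilon>\<^sup>2"
    using infsum_finite_approximation[OF summable_inverse_freq, of "\<epsilon>\<^sup>2"] assms by (auto simp: S_def)
  show ?thesis
  proof (rule that[OF J(1)])
    fix c :: "int \<Rightarrow> complex" and B K assume c: "h1_le c B" and K: "finite K" "K \<inter> J = {}"
    have "(\<Sum>k\<in>K. 1 / (1 + freq k)) + (\<Sum>k\<in>J. 1 / (1 + freq k)) = (\<Sum>k\<in>K \<union> J. 1 / (1 + freq k))"
      using J K by (intro sum.union_disjoint[symmetric]) auto
    also have "\<dots> \<le> S" unfolding S_def
      using J K by (intro finite_sum_le_infsum summable_inverse_freq) auto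
    finally have "(\<Sum>k\<in>K. 1 / (1 + freq k)) \<le> \<epsilon>\<^sup>2"
      using J(2) by (simp add: dist_real_def)
    then have "sqrt (\<Sum>k\<in>K. 1 / (1 + freq k)) \<le> \<epsilon>"
      using assms by (simp add: real_le_lsqrt sum_nonneg)
    then show "(\<Sum>k\<in>K. cmod (c k)) \<le> \<epsilon> * B"
      using h1_le_sum_le[OF c K(1)] l2_le_nonneg[OF h1_le_l2_le[OF c]] by (meson mult_right_mono order_trans)
  qed
qed

section \<open>The periodic Strichartz estimate\<close>

definition freqs_below :: "nat \<Rightarrow> int set" where
  "freqs_below N = {- int N..int N}"

lemma finite_freqs_below [simp]: "finite (freqs_below N)"
  by (simp add: freqs_below_def)

lemma uminus_freqs_below [simp]: "- k \<in> freqs_below N \<longleftrightarrow> k \<in> freqs_below N"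
  by (auto simp: freqs_below_def)

definition band_limited :: "nat \<Rightarrow> (int \<Rightarrow> complex) \<Rightarrow> bool" where
  "band_limited N c \<longleftrightarrow> (\<forall>k. k \<notin> freqs_below N \<longrightarrow> c k = 0)"

lemma band_limited_summable: "band_limited N c \<Longrightarrow> summable_coeffs c"
  by (rule summable_coeffs_finite, rule finite_subset[of _ "freqs_below N"]) (auto simp: band_limited_def)

lemma fser_band_limited: "band_limited N c \<Longrightarrow> fser c x = (\<Sum>k\<in>freqs_below N. c k * mode k x)"
  by (rule fser_finite) (auto simp: band_limited_def)

lemma band_limited_flow [simp]: "band_limited N c \<Longrightarrow> band_limited N (flow t c)"
  by (simp add: band_limited_def flow_def)

lemma band_limited_conj_coeffs [simp]: "band_limited N c \<Longrightarrow> band_limited N (conj_coeffs c)"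
  by (simp add: band_limited_def conj_coeffs_def)

lemma band_limited_dx [simp]: "band_limited N c \<Longrightarrow> band_limited N (dx c)"
  by (simp add: band_limited_def dx_def)

lemma band_limited_mono: "band_limited M c \<Longrightarrow> M \<le> N \<Longrightarrow> band_limited N c"
  by (auto simp: band_limited_def freqs_below_def)

lemma dx_flow: "dx (flow t c) = flow t (dx c)"
  by (rule ext) (simp add: dx_def flow_def)

lemma dx_conj_coeffs: "dx (conj_coeffs c) = conj_coeffs (dx c)"
  by (rule ext) (simp add: dx_def conj_coeffs_def)

lemma freq_uminus [simp]: "freq (- k) = freq k"
  by (simp add: freq_def)

lemma sum_mult_pair:
  fixes f :: "'a \<Rightarrow> 'c :: comm_semiring_0"
  shows "(\<Sum>i\<in>A. f i) * (\<Sum>y\<in>B. g y) = (\<Sum>(i, y)\<in>A \<times> B. f i * g y)"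
  by (simp add: sum_product sum.cartesian_product)

definition quad :: "(int \<Rightarrow> complex) \<Rightarrow> (int \<Rightarrow> complex) \<Rightarrow> (int \<Rightarrow> complex) \<Rightarrow> (int \<Rightarrow> complex) \<Rightarrow> complex" where
  "quad a b c d = (LINT x|torus. fser a x * (fser b x * (fser c x * cnj (fser d x))))"

lemma quad_band_limited:
  assumes "band_limited N a" "band_limited N b" "band_limited N c" "band_limited N d"
  shows "quad a b c d =
    (\<Sum>(i, j, k, l)\<in>freqs_below N \<times> freqs_below N \<times> freqs_below N \<times> freqs_below N.
       if i + j + k = l then a i * b j * c k * cnj (d l) else 0)"
proof -
  let ?A = "freqs_below N"
  have eq: "fser a x * (fser b x * (fser c x * cnj (fser d x))) =
      (\<Sum>q\<in>?A \<times> ?A \<times> ?A \<times> ?A. case q of (i, j, k, l) \<Rightarrow>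
         a i * b j * c k * cnj (d l) * mode (i + j + k - l) x)" for x
    unfolding assms[THEN fser_band_limited] cnj_sum sum_mult_pair
    by (intro sum.cong refl) (simp add: case_prod_beta cnj_mode mode_add_left mult_ac
        flip: add_uminus_conv_diff)
  have "quad a b c d =
      (\<Sum>q\<in>?A \<times> ?A \<times> ?A \<times> ?A. LINT x|torus. (case q of (i, j, k, l) \<Rightarrow>
         a i * b j * c k * cnj (d l) * mode (i + j + k - l) x))"
    unfolding quad_def eq
    by (intro Bochner_Integration.integral_sum)
      (auto intro!: integrable_mult_right integrable_period_continuous continuous_intros)
  also have "\<dots> = (\<Sum>(i, j, k, l)\<in>?A \<times> ?A \<times> ?A \<times> ?A.
       if i + j + k = l then a i * b j * c k * cnj (d l) else 0)"
    by (intro sum.cong refl) (auto simp: integral_mode)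
  finally show ?thesis .
qed

text \<open>The fourth power of the \<open>L\<^sup>4\<close> norm in space of a linear Schroedinger flow.\<close>

definition quartic :: "(int \<Rightarrow> complex) \<Rightarrow> real \<Rightarrow> real" where
  "quartic c t = (LINT x|torus. (cmod (fser (flow t c) x)) ^ 4)"

lemma quartic_nonneg: "0 \<le> quartic c t"
  by (simp add: quartic_def)

lemma quartic_expand:
  assumes p: "band_limited N p"
  shows "of_real (quartic p t) =
    (\<Sum>(i, j, k, l)\<in>freqs_below N \<times> freqs_below N \<times> freqs_below N \<times> freqs_below N.
       (if i + j + k = l then p i * p j * conj_coeffs p k * cnj (p l) else 0) *
       cis (- ((freq i + freq j - freq k - freq l) * t)))"
proof -
  have "of_real ((cmod z) ^ 4) = z * (z * (cnj z * cnj z))" for z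
  proof -
    have "of_real ((cmod z) ^ 4) = complex_of_real ((cmod z)\<^sup>2) * of_real ((cmod z)\<^sup>2)"
      by (simp flip: of_real_mult power_add)
    then show ?thesis unfolding complex_norm_square by (simp add: mult_ac)
  qed
  then have "of_real (quartic p t) = quad (flow t p) (flow t p) (conj_coeffs (flow t p)) (flow t p)"
    unfolding quartic_def quad_def integral_complex_of_real[symmetric] fser_conj_coeffs by presburger
  also have "\<dots> = (\<Sum>(i, j, k, l)\<in>freqs_below N \<times> freqs_below N \<times> freqs_below N \<times> freqs_below N.
       if i + j + k = l then flow t p i * flow t p j * conj_coeffs (flow t p) k * cnj (flow t p l) else 0)"
    by (intro quad_band_limited) (simp_all add: p)
  also have "\<dots> = (\<Sum>(i, j, k, l)\<in>freqs_below N \<times> freqs_below N \<times> freqs_below N \<times> freqs_below N.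
       (if i + j + k = l then p i * p j * conj_coeffs p k * cnj (p l) else 0) *
       cis (- ((freq i + freq j - freq k - freq l) * t)))"
  proof (intro sum.cong refl, clarify)
    fix i j k l
    have "cis (- ((freq i + freq j - freq k - freq l) * t)) =
        cis (- (freq i * t)) * cis (- (freq j * t)) * cis (freq k * t) * cis (freq l * t)"
      by (simp add: cis_mult algebra_simps)
    then show "(if i + j + k = l then flow t p i * flow t p j * conj_coeffs (flow t p) k * cnj (flow t p l) else 0) =
      (if i + j + k = l then p i * p j * conj_coeffs p k * cnj (p l) else 0) *
       cis (- ((freq i + freq j - freq k - freq l) * t))"
      by (simp add: flow_def conj_coeffs_def cis_cnj mult_ac)
  qed
  finally show ?thesis .
qed

lemma continuous_on_quartic:
  assumes "band_limited N p"
  shows "continuous_on A (quartic p)"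
proof -
  have "continuous_on A (\<lambda>t. Re (of_real (quartic p t)))"
    unfolding quartic_expand[OF assms] case_prod_beta by (intro continuous_intros)
  then show ?thesis by simp
qed

text \<open>The substitution \<open>l = i + j - k\<close> turns the second equation into \<open>(i - k) (k - j) = 0\<close>.\<close>

lemma two_squares_resonance:
  fixes i j k l :: int
  assumes "i + j = k + l" "i\<^sup>2 + j\<^sup>2 = k\<^sup>2 + l\<^sup>2"
  shows "(k = i \<and> l = j) \<or> (l = i \<and> k = j)"
proof -
  have l: "l = i + j - k" using assms(1) by simp
  have "(i - k) * (k - j) = 0"
    using assms(2) unfolding l by (simp add: power2_eq_square algebra_simps)
  then show ?thesis using l by auto
qed

lemma cis_has_integral_periods:
  fixes n :: int and m :: nat
  shows "((\<lambda>t. cis (- ((2 * pi)\<^sup>2 * of_int n * t))) has_integral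
      (if n = 0 then of_real (real m / (2 * pi)) else 0)) {0..real m / (2 * pi)}"
proof (cases "n = 0")
  case True
  then show ?thesis using has_integral_const_real[of "1 :: complex" 0 "real m / (2 * pi)"]
    by (simp add: scaleR_conv_of_real)
next
  case False
  define w where "w = (2 * pi)\<^sup>2 * of_int n"
  have w: "w \<noteq> 0" using False by (simp add: w_def)
  define F where "F = (\<lambda>t. cis (- (w * t)) * (\<i> / w))"
  have "((\<lambda>t. cis (- (w * t))) has_integral (F (real m / (2 * pi)) - F 0)) {0..real m / (2 * pi)}"
  proof (rule fundamental_theorem_of_calculus)
    fix t
    have "((\<lambda>t. cis (- (w * t))) has_vector_derivative (- w) *\<^sub>R (\<i> * cis (- (w * t)))) (at t within {0..real m / (2 * pi)})"
      unfolding has_vector_derivative_def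
      by (auto intro!: derivative_eq_intros simp: algebra_simps)
    then have "(F has_vector_derivative (- w) *\<^sub>R (\<i> * cis (- (w * t))) * (\<i> / w)) (at t within {0..real m / (2 * pi)})"
      unfolding F_def by (rule has_vector_derivative_mult_left)
    moreover have "(- w) *\<^sub>R (\<i> * cis (- (w * t))) * (\<i> / w) = cis (- (w * t))"
      using w by (simp add: scaleR_conv_of_real complex_eq_iff)
    ultimately show "(F has_vector_derivative cis (- (w * t))) (at t within {0..real m / (2 * pi)})" by simp
  qed simp
  moreover have "cis (- (w * (real m / (2 * pi)))) = 1"
  proof -
    have "- (w * (real m / (2 * pi))) = 2 * pi * of_int (- n * int m)"
      by (simp add: w_def power2_eq_square)
    then show ?thesis using cis_multiple_2pi[of "of_int (- n * int m)"] by (simp only: Ints_of_int)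
  qed
  ultimately show ?thesis using False by (simp add: F_def w_def)
qed

text \<open>Integration over whole time periods \<open>1 / (2 \<pi>)\<close> leaves only those quadruples of frequencies for
  which both the frequencies and their squares balance. These are the trivial ones, and each of the
  two trivial families contributes the fourth power of the \<open>l\<^sup>2\<close> norm.\<close>

theorem strichartz_periodic:
  assumes p: "band_limited N p" and B: "l2_le p B"
  shows "integral {0..real m / (2 * pi)} (quartic p) \<le> 2 * (real m / (2 * pi)) * B ^ 4"
proof -
  let ?A = "freqs_below N"
  define L where "L = real m / (2 * pi)"
  let ?A4 = "?A \<times> ?A \<times> ?A \<times> ?A"
  define C where "C = (\<lambda>(i, j, k, l). if i + j + k = l then p i * p j * conj_coeffs p k * cnj (p l) else 0)"
  define w where "w = (\<lambda>(i, j, k, l). i\<^sup>2 + j\<^sup>2 - k\<^sup>2 - l\<^sup>2 :: int)"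
  define a where "a = (\<lambda>k. cmod (p k))"
  have L: "0 \<le> L" by (simp add: L_def)
  \<comment> \<open>Only resonant quadruples survive integration over whole time periods.\<close>
  have "((\<lambda>t. \<Sum>q\<in>?A4. C q * cis (- ((2 * pi)\<^sup>2 * of_int (w q) * t))) has_integral
      (\<Sum>q\<in>?A4. C q * (if w q = 0 then of_real L else 0))) {0..L}"
    unfolding L_def by (intro has_integral_sum has_integral_mult_right cis_has_integral_periods) auto
  moreover have "(\<Sum>q\<in>?A4. C q * cis (- ((2 * pi)\<^sup>2 * of_int (w q) * t))) = of_real (quartic p t)" for t
    unfolding quartic_expand[OF p]
    by (intro sum.cong refl) (auto simp: C_def w_def freq_def power_mult_distrib algebra_simps)
  ultimately have *: "((\<lambda>t. complex_of_real (quartic p t)) has_integral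
      (\<Sum>q\<in>?A4. C q * (if w q = 0 then of_real L else 0))) {0..L}" by simp
  have "(quartic p has_integral integral {0..L} (quartic p)) {0..L}"
    by (intro integrable_integral integrable_continuous_interval continuous_on_quartic[OF p])
  then have "((\<lambda>t. complex_of_real (quartic p t)) has_integral of_real (integral {0..L} (quartic p))) {0..L}"
    using has_integral_linear[OF _ bounded_linear_of_real] by (simp add: o_def)
  then have "complex_of_real (integral {0..L} (quartic p)) = (\<Sum>q\<in>?A4. C q * (if w q = 0 then of_real L else 0))"
    using * has_integral_unique by blast
  then have "integral {0..L} (quartic p) = Re (\<Sum>q\<in>?A4. C q * (if w q = 0 then of_real L else 0))"
    by (metis Re_complex_of_real)
  also have "\<dots> \<le> cmod (\<Sum>q\<in>?A4. C q * (if w q = 0 then of_real L else 0))"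
    by (rule complex_Re_le_cmod)
  also have "\<dots> \<le> (\<Sum>(i, j, k, l)\<in>?A4. L * ((if l = j then if k = - i then (a i)\<^sup>2 * (a j)\<^sup>2 else 0 else 0)
      + (if l = i then if k = - j then (a i)\<^sup>2 * (a j)\<^sup>2 else 0 else 0)))"
  proof (rule sum_norm_le, clarify)
    fix i j k l
    \<comment> \<open>The third factor is a reflected conjugate, so its frequency enters as \<open>- k\<close>.\<close>
    show "cmod (C (i, j, k, l) * (if w (i, j, k, l) = 0 then of_real L else 0)) \<le>
      L * ((if l = j then if k = - i then (a i)\<^sup>2 * (a j)\<^sup>2 else 0 else 0)
      + (if l = i then if k = - j then (a i)\<^sup>2 * (a j)\<^sup>2 else 0 else 0))"
    proof (cases "i + j + k = l \<and> w (i, j, k, l) = 0")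
      case True
      then have "i + j = - k + l" "i\<^sup>2 + j\<^sup>2 = (- k)\<^sup>2 + l\<^sup>2" by (auto simp: w_def)
      then have "(- k = i \<and> l = j) \<or> (l = i \<and> - k = j)" by (rule two_squares_resonance)
      moreover have "cmod (C (i, j, k, l) * (if w (i, j, k, l) = 0 then of_real L else 0))
          = L * (a i * a j * a (- k) * a l)"
        using True L by (simp add: C_def norm_mult a_def conj_coeffs_def norm_divide)
      ultimately show ?thesis
        using L by (auto simp: power2_eq_square mult_ac a_def intro!: mult_left_mono mult_nonneg_nonneg)
    next
      case False
      then have "cmod (C (i, j, k, l) * (if w (i, j, k, l) = 0 then of_real L else 0)) = 0"
        by (auto simp: C_def)
      then show ?thesis using L by (auto intro!: mult_nonneg_nonneg add_nonneg_nonneg)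
    qed
  qed
  also have "\<dots> = L * ((\<Sum>i\<in>?A. \<Sum>j\<in>?A. (a i)\<^sup>2 * (a j)\<^sup>2) + (\<Sum>i\<in>?A. \<Sum>j\<in>?A. (a i)\<^sup>2 * (a j)\<^sup>2))"
    unfolding sum.cartesian_product[symmetric]
    by (simp add: sum_distrib_left[symmetric] sum.distrib sum.delta sum.delta' cong: sum.cong if_cong)
  also have "(\<Sum>i\<in>?A. \<Sum>j\<in>?A. (a i)\<^sup>2 * (a j)\<^sup>2) = (\<Sum>k\<in>?A. (a k)\<^sup>2)\<^sup>2"
    by (simp add: sum_product power2_eq_square[of "sum _ _"])
  also have "(\<Sum>k\<in>?A. (a k)\<^sup>2)\<^sup>2 \<le> (B\<^sup>2)\<^sup>2"
    using B by (intro power_mono) (auto simp: l2_le_iff a_def sum_nonneg)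
  finally show ?thesis using L by (simp add: mult_left_mono flip: L_def)
qed

section \<open>The resonance error\<close>

lemma integral_cnj_fser:
  assumes F: "continuous_on UNIV F" and c: "\<And>k. k \<notin> K \<Longrightarrow> c k = 0" "finite K"
  shows "(LINT x|torus. F x * cnj (fser c x)) = (\<Sum>k\<in>K. fourier_coeff F k * cnj (c k))"
proof -
  have eq: "F x * cnj (fser c x) = (\<Sum>k\<in>K. F x * mode (- k) x * cnj (c k))" for x
    by (simp add: fser_finite[of K c, OF c(2,1)] sum_distrib_left cnj_mode mult_ac)
  have "(LINT x|torus. F x * cnj (fser c x)) =
      (\<Sum>k\<in>K. LINT x|torus. F x * mode (- k) x * cnj (c k))"
    unfolding eq
    by (intro Bochner_Integration.integral_sum integrable_period_continuous continuous_intros F)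
  then show ?thesis by (simp add: fourier_coeff_mode)
qed

lemma integral_reverse:
  fixes g :: "real \<Rightarrow> real"
  shows "integral {0..s} (\<lambda>\<sigma>. g (2 * s - \<sigma>)) = integral {s..2 * s} g"
proof -
  define G where "G = (\<lambda>y. g (- y))"
  have "integral {0..s} (\<lambda>\<sigma>. g (2 * s - \<sigma>)) = integral {0..s} (G \<circ> (+) (- (2 * s)))"
    by (simp add: G_def o_def)
  also have "\<dots> = integral {- (2 * s)..- s} G"
    by (subst integral_shift_Icc_real) simp
  also have "\<dots> = integral {s..2 * s} g"
    unfolding G_def by (rule Henstock_Kurzweil_Integration.integral_reflect_real)
  finally show ?thesis .
qed

lemma quadrilinear_bound:
  fixes p px y yx h :: "real \<Rightarrow> complex"
  assumes c: "continuous_on UNIV p" "continuous_on UNIV px" "continuous_on UNIV y"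
      "continuous_on UNIV yx" "continuous_on UNIV h"
    and R: "\<And>x. cmod (p x) \<le> R" "\<And>x. cmod (y x) \<le> R" "0 \<le> R"
  shows "cmod ((LINT x|torus. px x * (px x * (y x * cnj (h x)))) +
      (LINT x|torus. px x * (p x * (yx x * cnj (h x)))) +
      (LINT x|torus. p x * (px x * (yx x * cnj (h x)))))
    \<le> R / 2 * (2 * (LINT x|torus. cmod (px x) ^ 4) + (LINT x|torus. cmod (yx x) ^ 4)
        + 3 * (LINT x|torus. (cmod (h x))\<^sup>2))"
proof -
  have i: "integrable torus (\<lambda>x. px x * (px x * (y x * cnj (h x))))"
    "integrable torus (\<lambda>x. px x * (p x * (yx x * cnj (h x))))"
    "integrable torus (\<lambda>x. p x * (px x * (yx x * cnj (h x))))"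
    "integrable torus (\<lambda>x. cmod (px x) ^ 4)" "integrable torus (\<lambda>x. cmod (yx x) ^ 4)"
    "integrable torus (\<lambda>x. (cmod (h x))\<^sup>2)"
    by (intro integrable_period_continuous continuous_intros c)+
  have eq1: "(LINT x|torus. px x * (px x * (y x * cnj (h x)))) +
      (LINT x|torus. px x * (p x * (yx x * cnj (h x)))) +
      (LINT x|torus. p x * (px x * (yx x * cnj (h x)))) =
      (LINT x|torus. (px x * (px x * (y x * cnj (h x))) +
        px x * (p x * (yx x * cnj (h x))) + p x * (px x * (yx x * cnj (h x)))))"
    using i by (simp only: Bochner_Integration.integral_add Bochner_Integration.integrable_add)
  have le: "cmod (LINT x|torus. (px x * (px x * (y x * cnj (h x))) +
        px x * (p x * (yx x * cnj (h x))) + p x * (px x * (yx x * cnj (h x)))))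
      \<le> (LINT x|torus. R / 2 * (2 * cmod (px x) ^ 4 + cmod (yx x) ^ 4 + 3 * (cmod (h x))\<^sup>2))"
  proof (rule Bochner_Integration.integral_norm_bound_integral)
    show "integrable torus (\<lambda>x. px x * (px x * (y x * cnj (h x))) +
        px x * (p x * (yx x * cnj (h x))) + p x * (px x * (yx x * cnj (h x))))"
      by (rule Bochner_Integration.integrable_add[OF Bochner_Integration.integrable_add[OF i(1,2)] i(3)])
    show "integrable torus (\<lambda>x. R / 2 * (2 * cmod (px x) ^ 4 + cmod (yx x) ^ 4 + 3 * (cmod (h x))\<^sup>2))"
      by (intro integrable_period_continuous continuous_intros c)
    fix x
    define a b e where "a = cmod (px x)" "b = cmod (yx x)" "e = cmod (h x)"
    note df = a_b_e_def
    have abe: "0 \<le> a" "0 \<le> b" "0 \<le> e" by (simp_all add: df)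
    have "cmod (px x * (px x * (y x * cnj (h x))) +
        px x * (p x * (yx x * cnj (h x))) + p x * (px x * (yx x * cnj (h x)))) \<le>
        cmod (px x * (px x * (y x * cnj (h x)))) +
        cmod (px x * (p x * (yx x * cnj (h x)))) + cmod (p x * (px x * (yx x * cnj (h x))))"
      by (meson norm_triangle_ineq norm_triangle_le add_mono order_refl)
    also have "\<dots> = cmod (y x) * (a * a * e) + cmod (p x) * (a * b * e) + cmod (p x) * (a * b * e)"
      by (simp add: norm_mult df mult_ac)
    also have "\<dots> \<le> R * (a * a * e) + R * (a * b * e) + R * (a * b * e)"
      using abe R by (intro add_mono mult_right_mono) auto
    also have "\<dots> = R * (e * a\<^sup>2 + e * (2 * a * b))"
      by (simp add: power2_eq_square algebra_simps)
    also have "\<dots> \<le> R * (e * a\<^sup>2 + e * (a\<^sup>2 + b\<^sup>2))"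
      using abe R sum_squares_bound[of a b] by (intro mult_left_mono add_mono) auto
    also have "\<dots> = R / 2 * (2 * (2 * a\<^sup>2 * e) + 2 * b\<^sup>2 * e)"
      by (simp add: algebra_simps)
    also have "\<dots> \<le> R / 2 * (2 * ((a\<^sup>2)\<^sup>2 + e\<^sup>2) + ((b\<^sup>2)\<^sup>2 + e\<^sup>2))"
      using R sum_squares_bound[of "a\<^sup>2" e] sum_squares_bound[of "b\<^sup>2" e]
      by (intro mult_left_mono add_mono) auto
    also have "\<dots> = R / 2 * (2 * a ^ 4 + b ^ 4 + 3 * e\<^sup>2)"
      by (simp add: algebra_simps)
    finally show "norm (px x * (px x * (y x * cnj (h x))) +
        px x * (p x * (yx x * cnj (h x))) + p x * (px x * (yx x * cnj (h x))))
        \<le> R / 2 * (2 * cmod (px x) ^ 4 + cmod (yx x) ^ 4 + 3 * (cmod (h x))\<^sup>2)"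
      by (simp add: df)
  qed
  have eq2: "(LINT x|torus. R / 2 * (2 * cmod (px x) ^ 4 + cmod (yx x) ^ 4 + 3 * (cmod (h x))\<^sup>2))
      = R / 2 * (2 * (LINT x|torus. cmod (px x) ^ 4) + (LINT x|torus. cmod (yx x) ^ 4)
        + 3 * (LINT x|torus. (cmod (h x))\<^sup>2))"
  proof -
    have j: "integrable torus (\<lambda>x. 2 * cmod (px x) ^ 4)" "integrable torus (\<lambda>x. 3 * (cmod (h x))\<^sup>2)"
      by (intro integrable_mult_right i)+
    show ?thesis
      unfolding integral_mult_right_zero
        Bochner_Integration.integral_add[OF Bochner_Integration.integrable_add[OF j(1) i(5)] j(2)]
        Bochner_Integration.integral_add[OF j(1) i(5)] ..
  qed
  show ?thesis by (rule ord_eq_le_trans[OF arg_cong[OF eq1, of cmod] ord_le_eq_trans[OF le eq2]])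
qed

text \<open>In differentiating the quadrilinear form along the flow, the second derivatives that fall on single
  factors cancel against the one on the test function. What remains has one derivative on each
  of two factors.\<close>

lemma quad_flow_deriv:
  assumes b: "band_limited N p" "band_limited N y" "band_limited N h"
  shows "((\<lambda>\<sigma>. quad (flow \<sigma> p) (flow \<sigma> p) (flow \<sigma> y) (flow \<sigma> h))
    has_vector_derivative - 2 * \<i> *
     (quad (flow \<sigma> (dx p)) (flow \<sigma> (dx p)) (flow \<sigma> y) (flow \<sigma> h) +
      quad (flow \<sigma> (dx p)) (flow \<sigma> p) (flow \<sigma> (dx y)) (flow \<sigma> h) +
      quad (flow \<sigma> p) (flow \<sigma> (dx p)) (flow \<sigma> (dx y)) (flow \<sigma> h)))
    (at \<sigma> within A)"
proof -
  let ?A = "freqs_below N"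
  let ?A4 = "?A \<times> ?A \<times> ?A \<times> ?A"
  define w where "w = (\<lambda>(i, j, k, l). freq i + freq j + freq k - freq l)"
  define C where "C = (\<lambda>(a, b, c, d) (i :: int, j :: int, k :: int, l :: int).
      if i + j + k = l then a i * b j * c k * cnj (d l) else (0 :: complex))"
  have expand: "quad (flow \<sigma> a) (flow \<sigma> b) (flow \<sigma> c) (flow \<sigma> d)
      = (\<Sum>q\<in>?A4. cis (- (w q * \<sigma>)) * C (a, b, c, d) q)"
    if bl: "band_limited N a" "band_limited N b" "band_limited N c" "band_limited N d" for a b c d \<sigma>
  proof -
    have "quad (flow \<sigma> a) (flow \<sigma> b) (flow \<sigma> c) (flow \<sigma> d)
      = (\<Sum>(i, j, k, l)\<in>?A4. if i + j + k = l then flow \<sigma> a i * flow \<sigma> b j * flow \<sigma> c k * cnj (flow \<sigma> d l) else 0)"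
      by (intro quad_band_limited band_limited_flow bl)
    also have "\<dots> = (\<Sum>q\<in>?A4. cis (- (w q * \<sigma>)) * C (a, b, c, d) q)"
    proof (intro sum.cong refl, clarify)
      fix i j k l
      have "cis (- (w (i, j, k, l) * \<sigma>)) =
          cis (- (freq i * \<sigma>)) * cis (- (freq j * \<sigma>)) * cis (- (freq k * \<sigma>)) * cis (freq l * \<sigma>)"
        by (simp add: w_def cis_mult algebra_simps)
      then show "(if i + j + k = l then flow \<sigma> a i * flow \<sigma> b j * flow \<sigma> c k * cnj (flow \<sigma> d l) else 0)
          = cis (- (w (i, j, k, l) * \<sigma>)) * C (a, b, c, d) (i, j, k, l)"
        by (simp add: C_def flow_def cis_cnj mult_ac)
    qed
    finally show ?thesis .
  qed
  have "((\<lambda>\<sigma>. \<Sum>q\<in>?A4. cis (- (w q * \<sigma>)) * C (p, p, y, h) q) has_vector_derivative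
      (\<Sum>q\<in>?A4. (- w q) *\<^sub>R (\<i> * cis (- (w q * \<sigma>))) * C (p, p, y, h) q)) (at \<sigma> within A)"
  proof (intro has_vector_derivative_sum has_vector_derivative_mult_left)
    fix q :: "int \<times> int \<times> int \<times> int"
    show "((\<lambda>\<sigma>. cis (- (w q * \<sigma>))) has_vector_derivative (- w q) *\<^sub>R (\<i> * cis (- (w q * \<sigma>)))) (at \<sigma> within A)"
      unfolding has_vector_derivative_def
      by (auto intro!: derivative_eq_intros simp: algebra_simps)
  qed
  also have "(\<Sum>q\<in>?A4. (- w q) *\<^sub>R (\<i> * cis (- (w q * \<sigma>))) * C (p, p, y, h) q) =
      (\<Sum>q\<in>?A4. - 2 * \<i> * (cis (- (w q * \<sigma>)) * C (dx p, dx p, y, h) q +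
        cis (- (w q * \<sigma>)) * C (dx p, p, dx y, h) q + cis (- (w q * \<sigma>)) * C (p, dx p, dx y, h) q))"
  proof (intro sum.cong refl)
    fix q :: "int \<times> int \<times> int \<times> int"
    obtain i j k l where q: "q = (i, j, k, l)" by (cases q) auto
    show "(- w q) *\<^sub>R (\<i> * cis (- (w q * \<sigma>))) * C (p, p, y, h) q =
        - 2 * \<i> * (cis (- (w q * \<sigma>)) * C (dx p, dx p, y, h) q +
        cis (- (w q * \<sigma>)) * C (dx p, p, dx y, h) q + cis (- (w q * \<sigma>)) * C (p, dx p, dx y, h) q)"
    proof (cases "i + j + k = l")
      case True
      define z where "z = cis (- (w q * \<sigma>))"
      \<comment> \<open>On \<open>i + j + k = l\<close> the quadratic terms of the phase cancel and only products of two
        frequencies remain; each product is a pair of derivatives.\<close>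
      have "w q = - 2 * (2 * pi)\<^sup>2 * (i * j + i * k + j * k)"
        by (simp add: q w_def freq_def True[symmetric] power2_eq_square algebra_simps)
      then have wq: "complex_of_real (w q) = - 2 * (2 * of_real pi)\<^sup>2 * (of_int i * of_int j + of_int i * of_int k + of_int j * of_int k)"
        by simp
      show ?thesis
        unfolding z_def[symmetric] scaleR_conv_of_real of_real_minus wq
        using True by (simp add: q C_def dx_def power2_eq_square algebra_simps)
    qed (simp add: q C_def)
  qed
  also have "\<dots> = - 2 * \<i> * ((\<Sum>q\<in>?A4. cis (- (w q * \<sigma>)) * C (dx p, dx p, y, h) q) +
      (\<Sum>q\<in>?A4. cis (- (w q * \<sigma>)) * C (dx p, p, dx y, h) q) + (\<Sum>q\<in>?A4. cis (- (w q * \<sigma>)) * C (p, dx p, dx y, h) q))"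
    unfolding sum.distrib[symmetric] by (rule sum_distrib_left[symmetric])
  finally show ?thesis
    by (simp only: expand b band_limited_dx)
qed

text \<open>The error of freezing two of the three factors. The path
  \<open>\<sigma> \<mapsto> quad (flow \<sigma> p) (flow \<sigma> p) (flow \<sigma> y) (flow \<sigma> h)\<close>
  joins the two nonlinearities, and its speed contains only products of two differentiated flows.
  The bound does not depend on the frequency support of \<open>p\<close>.\<close>

lemma resonance_error:
  assumes p: "band_limited N p" and R: "l1_le p R" and s: "0 \<le> s" "s \<le> \<tau>"
  defines "y \<equiv> (\<lambda>k. cis (2 * freq k * s) * conj_coeffs p k)"
  shows "l2_le (\<lambda>k. flow (- s) (cubic (flow s p)) k - fourier_coeff (\<lambda>x. (fser p x)\<^sup>2 * fser y x) k)
     (R * (3 * integral {0..2 * \<tau>} (quartic (dx p)) + 3 * \<tau>))"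
proof (rule l2_le_duality)
  let ?Q = "quartic (dx p)"
  have R0: "0 \<le> R" using R by (rule l1_le_nonneg)
  have \<tau>: "0 \<le> \<tau>" using s by simp
  have Qint: "?Q integrable_on {a..b}" for a b
    by (intro integrable_continuous_interval continuous_on_quartic[OF band_limited_dx[OF p]])
  have Q0: "0 \<le> integral {a..b} ?Q" for a b
    by (intro Henstock_Kurzweil_Integration.integral_nonneg Qint quartic_nonneg)
  show "0 \<le> R * (3 * integral {0..2 * \<tau>} ?Q + 3 * \<tau>)"
    using R0 Q0 \<tau> by (intro mult_nonneg_nonneg add_nonneg_nonneg) auto
  fix K :: "int set" and h0 :: "int \<Rightarrow> complex"
  assume K: "finite K" and h0: "L2_set (\<lambda>k. cmod (h0 k)) K \<le> 1"
  define h where "h = (\<lambda>k. if k \<in> K then h0 k else 0)"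
  obtain N' where N': "\<And>k. k \<in> K \<Longrightarrow> nat \<bar>k\<bar> \<le> N'"
    using finite_nat_set_iff_bounded_le[of "(\<lambda>k. nat \<bar>k\<bar>) ` K"] K by auto
  \<comment> \<open>A common frequency bound for \<open>p\<close> and for the test sequence.\<close>
  define M where "M = max N N'"
  have yb: "band_limited N y" using p by (simp add: y_def band_limited_def conj_coeffs_def)
  have pb: "band_limited M p" "band_limited M y"
    using band_limited_mono[OF p] band_limited_mono[OF yb] by (auto simp: M_def)
  have hb: "band_limited M h"
    using N' unfolding band_limited_def freqs_below_def h_def M_def by force
  have h2: "l2_le h 1"
    unfolding l2_le_def
  proof (intro allI impI)
    fix F :: "int set" assume "finite F"
    have "L2_set (\<lambda>k. cmod (h k)) F \<le> L2_set (\<lambda>k. cmod (h0 k)) K"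
      unfolding L2_set_def
    proof (rule real_sqrt_le_mono)
      have "(\<Sum>k\<in>F. (cmod (h k))\<^sup>2) = (\<Sum>k\<in>F \<inter> K. (cmod (h0 k))\<^sup>2)"
        using \<open>finite F\<close> by (intro sum.mono_neutral_cong_right) (auto simp: h_def)
      also have "\<dots> \<le> (\<Sum>k\<in>K. (cmod (h0 k))\<^sup>2)"
        using K by (intro sum_mono2) auto
      finally show "(\<Sum>k\<in>F. (cmod (h k))\<^sup>2) \<le> (\<Sum>k\<in>K. (cmod (h0 k))\<^sup>2)" .
    qed
    then show "L2_set (\<lambda>k. cmod (h k)) F \<le> 1" using h0 by simp
  qed
  \<comment> \<open>\<open>\<phi>\<close> interpolates between the exact nonlinearity (at \<open>s\<close>) and the one frozen by the
    scheme (at \<open>0\<close>), both tested against \<open>h\<close>.\<close>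
  define \<phi> where "\<phi> = (\<lambda>\<sigma>. quad (flow \<sigma> p) (flow \<sigma> p) (flow \<sigma> y) (flow \<sigma> h))"
  define D where "D = (\<lambda>\<sigma>. - 2 * \<i> *
     (quad (flow \<sigma> (dx p)) (flow \<sigma> (dx p)) (flow \<sigma> y) (flow \<sigma> h) +
      quad (flow \<sigma> (dx p)) (flow \<sigma> p) (flow \<sigma> (dx y)) (flow \<sigma> h) +
      quad (flow \<sigma> p) (flow \<sigma> (dx p)) (flow \<sigma> (dx y)) (flow \<sigma> h)))"
  have D: "(D has_integral (\<phi> s - \<phi> 0)) {0..s}"
    using s unfolding D_def \<phi>_def
    by (intro fundamental_theorem_of_calculus quad_flow_deriv[OF pb hb]) auto
  note summ = pb[THEN band_limited_summable] hb[THEN band_limited_summable]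
    pb[THEN band_limited_dx, THEN band_limited_summable]
  \<comment> \<open>All times that occur lie in \<open>[0, 2 s]\<close>, hence the window of length \<open>2 \<tau>\<close>.\<close>
  have fy: "flow \<sigma> y = conj_coeffs (flow (2 * s - \<sigma>) p)" for \<sigma>
  proof
    fix k
    have "cis (- (freq k * \<sigma>)) * cis (2 * freq k * s) = cis (freq k * (2 * s - \<sigma>))"
      by (simp add: cis_mult algebra_simps)
    then show "flow \<sigma> y k = conj_coeffs (flow (2 * s - \<sigma>) p) k"
      by (simp add: flow_def conj_coeffs_def y_def cis_cnj flip: mult.assoc)
  qed
  have dy: "flow \<sigma> (dx y) = conj_coeffs (flow (2 * s - \<sigma>) (dx p))" for \<sigma>
    by (simp add: fy dx_conj_coeffs flip: dx_flow)
  have Dle: "cmod (D \<sigma>) \<le> R * (2 * ?Q \<sigma> + ?Q (2 * s - \<sigma>) + 3)" for \<sigma>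
  proof -
    have l1: "l1_le (flow t p) R" for t using R by (simp add: l1_le_def)
    have P: "cmod (fser (flow \<sigma> p) x) \<le> R" "cmod (fser (flow \<sigma> y) x) \<le> R" for x
      unfolding fy using norm_fser_le[OF l1] norm_fser_le[OF l1_le_conj_coeffs[OF l1]] by auto
    have hh: "(LINT x|torus. (cmod (fser (flow \<sigma> h) x))\<^sup>2) \<le> 1"
      using parseval_le[of "flow \<sigma> h" 1] h2 summ by (simp add: l2_le_def)
    have "cmod (D \<sigma>) = 2 * cmod (quad (flow \<sigma> (dx p)) (flow \<sigma> (dx p)) (flow \<sigma> y) (flow \<sigma> h) +
      quad (flow \<sigma> (dx p)) (flow \<sigma> p) (flow \<sigma> (dx y)) (flow \<sigma> h) +
      quad (flow \<sigma> p) (flow \<sigma> (dx p)) (flow \<sigma> (dx y)) (flow \<sigma> h))"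
      unfolding D_def norm_mult by simp
    also have "\<dots> \<le> 2 * (R / 2 * (2 * (LINT x|torus. cmod (fser (flow \<sigma> (dx p)) x) ^ 4)
       + (LINT x|torus. cmod (fser (flow \<sigma> (dx y)) x) ^ 4)
        + 3 * (LINT x|torus. (cmod (fser (flow \<sigma> h) x))\<^sup>2)))"
      unfolding quad_def
      by (intro mult_left_mono quadrilinear_bound continuous_on_fser P R0) (simp_all add: summ)
    also have "(LINT x|torus. cmod (fser (flow \<sigma> (dx p)) x) ^ 4) = ?Q \<sigma>"
      by (simp add: quartic_def)
    also have "(LINT x|torus. cmod (fser (flow \<sigma> (dx y)) x) ^ 4) = ?Q (2 * s - \<sigma>)"
      by (simp add: quartic_def dy fser_conj_coeffs)
    also have "2 * (R / 2 * (2 * ?Q \<sigma> + ?Q (2 * s - \<sigma>) + 3 * (LINT x|torus. (cmod (fser (flow \<sigma> h) x))\<^sup>2)))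
       \<le> R * (2 * ?Q \<sigma> + ?Q (2 * s - \<sigma>) + 3)"
      using hh R0 by (simp add: mult_left_mono)
    finally show ?thesis .
  qed
  have i: "(\<lambda>\<sigma>. R * (2 * ?Q \<sigma> + ?Q (2 * s - \<sigma>) + 3)) integrable_on {0..s}"
    "(\<lambda>\<sigma>. ?Q (2 * s - \<sigma>)) integrable_on {0..s}"
    by (intro integrable_continuous_interval continuous_intros continuous_on_quartic[OF band_limited_dx[OF p]]
        continuous_on_compose2[OF continuous_on_quartic[OF band_limited_dx[OF p], of UNIV]]; simp)+
  have "cmod (\<phi> s - \<phi> 0) = cmod (integral {0..s} D)" using D by (simp add: integral_unique)
  also have "\<dots> \<le> integral {0..s} (\<lambda>\<sigma>. R * (2 * ?Q \<sigma> + ?Q (2 * s - \<sigma>) + 3))"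
    using D i(1) Dle by (intro Henstock_Kurzweil_Integration.integral_norm_bound_integral) auto
  also have "\<dots> = R * (2 * integral {0..s} ?Q + integral {0..s} (\<lambda>\<sigma>. ?Q (2 * s - \<sigma>)) + 3 * s)"
  proof (rule integral_unique)
    have "((\<lambda>\<sigma>. 3) has_integral 3 * s) {0..s}"
      using has_integral_const_real[of "3 :: real" 0 s] s by (simp add: mult.commute)
    then show "((\<lambda>\<sigma>. R * (2 * ?Q \<sigma> + ?Q (2 * s - \<sigma>) + 3)) has_integral
        R * (2 * integral {0..s} ?Q + integral {0..s} (\<lambda>\<sigma>. ?Q (2 * s - \<sigma>)) + 3 * s)) {0..s}"
      using Qint[of 0 s] i(2)
      by (intro has_integral_mult_right has_integral_add integrable_integral)
  qed
  also have "\<dots> \<le> R * (2 * integral {0..2 * \<tau>} ?Q + integral {0..2 * \<tau>} ?Q + 3 * \<tau>)"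
    unfolding integral_reverse using s R0
    by (intro mult_left_mono add_mono integral_subset_le Qint) (auto simp: quartic_nonneg)
  finally have bound: "cmod (\<phi> s - \<phi> 0) \<le> R * (3 * integral {0..2 * \<tau>} ?Q + 3 * \<tau>)"
    by simp
  have hK: "flow \<sigma> h k = 0" if "k \<notin> K" for \<sigma> k using that by (simp add: flow_def h_def)
  have "\<phi> s = (\<Sum>k\<in>K. flow (- s) (cubic (flow s p)) k * cnj (h0 k))"
  proof -
    have "fser (flow s p) x * (fser (flow s p) x * (fser (flow s y) x * z)) =
        (complex_of_real (cmod (fser (flow s p) x)))\<^sup>2 * fser (flow s p) x * z" for x z
      unfolding of_real_power[symmetric] complex_norm_square by (simp add: fy fser_conj_coeffs mult_ac)
    then have "\<phi> s = (LINT x|torus. (complex_of_real (cmod (fser (flow s p) x)))\<^sup>2 * fser (flow s p) x * cnj (fser (flow s h) x))"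
      by (simp only: \<phi>_def quad_def)
    also have "\<dots> = (\<Sum>k\<in>K. cubic (flow s p) k * cnj (flow s h k))"
      unfolding cubic_def
      by (intro integral_cnj_fser hK K continuous_intros) (simp_all add: summ)
    also have "\<dots> = (\<Sum>k\<in>K. flow (- s) (cubic (flow s p)) k * cnj (h0 k))"
      by (intro sum.cong refl) (simp add: flow_def h_def cis_cnj mult_ac)
    finally show ?thesis .
  qed
  moreover have "\<phi> 0 = (\<Sum>k\<in>K. fourier_coeff (\<lambda>x. (fser p x)\<^sup>2 * fser y x) k * cnj (h0 k))"
  proof -
    have "\<phi> 0 = (LINT x|torus. (fser p x)\<^sup>2 * fser y x * cnj (fser h x))"
      by (simp add: \<phi>_def quad_def power2_eq_square mult_ac)
    also have "\<dots> = (\<Sum>k\<in>K. fourier_coeff (\<lambda>x. (fser p x)\<^sup>2 * fser y x) k * cnj (h k))"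
      using hK[of _ 0] by (intro integral_cnj_fser K continuous_intros) (simp_all add: summ)
    finally show ?thesis by (simp add: h_def cong: sum.cong)
  qed
  ultimately have "\<phi> s - \<phi> 0 = (\<Sum>k\<in>K. (flow (- s) (cubic (flow s p)) k - fourier_coeff (\<lambda>x. (fser p x)\<^sup>2 * fser y x) k) * cnj (h0 k))"
    by (simp add: sum_subtractf left_diff_distrib)
  then show "cmod (\<Sum>k\<in>K. (flow (- s) (cubic (flow s p)) k - fourier_coeff (\<lambda>x. (fser p x)\<^sup>2 * fser y x) k) * cnj (h0 k))
      \<le> R * (3 * integral {0..2 * \<tau>} ?Q + 3 * \<tau>)"
    using bound by simp
qed

section \<open>The Strichartz estimate along a slowly varying profile\<close>

text \<open>Jensen's inequality for the fourth power with weights \<open>d j\<close>, obtained from two applications of the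
  Cauchy-Schwarz inequality.\<close>

lemma weighted_fourth_power_sum:
  fixes z d :: "'a \<Rightarrow> real"
  assumes d: "\<And>j. j \<in> A \<Longrightarrow> 0 < d j" "sum d A \<le> D"
  shows "(\<Sum>j\<in>A. z j) ^ 4 \<le> D ^ 3 * (\<Sum>j\<in>A. z j ^ 4 / d j ^ 3)"
proof -
  have sq: "(\<Sum>j\<in>A. y j)\<^sup>2 \<le> D * (\<Sum>j\<in>A. (y j)\<^sup>2 / d j)" for y :: "'a \<Rightarrow> real"
  proof -
    have "(\<Sum>j\<in>A. y j) = (\<Sum>j\<in>A. sqrt (d j) * (y j / sqrt (d j)))"
      using d(1) by (intro sum.cong refl) (simp add: less_imp_neq[symmetric])
    then have "(\<Sum>j\<in>A. y j)\<^sup>2 \<le> (\<Sum>j\<in>A. (sqrt (d j))\<^sup>2) * (\<Sum>j\<in>A. (y j / sqrt (d j))\<^sup>2)"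
      using Cauchy_Schwarz_ineq_sum[of "\<lambda>j. sqrt (d j)" "\<lambda>j. y j / sqrt (d j)" A] by simp
    also have "\<dots> = sum d A * (\<Sum>j\<in>A. (y j)\<^sup>2 / d j)"
      using d(1) by (intro arg_cong2[where f = "(*)"] sum.cong refl) (auto simp: power_divide less_imp_le)
    also have "\<dots> \<le> D * (\<Sum>j\<in>A. (y j)\<^sup>2 / d j)"
      using d by (intro mult_right_mono sum_nonneg) (auto simp: less_imp_le)
    finally show ?thesis .
  qed
  have D: "0 \<le> D" using d sum_nonneg[of A d] by (meson less_imp_le order_trans)
  have "(\<Sum>j\<in>A. z j) ^ 4 = ((\<Sum>j\<in>A. z j)\<^sup>2)\<^sup>2" by (simp flip: power_mult)
  also have "\<dots> \<le> (D * (\<Sum>j\<in>A. (z j)\<^sup>2 / d j))\<^sup>2"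
    by (intro power_mono sq) simp
  also have "\<dots> = D\<^sup>2 * (\<Sum>j\<in>A. (z j)\<^sup>2 / d j)\<^sup>2" by (simp add: power_mult_distrib)
  also have "\<dots> \<le> D\<^sup>2 * (D * (\<Sum>j\<in>A. ((z j)\<^sup>2 / d j)\<^sup>2 / d j))"
    by (intro mult_left_mono sq) simp
  also have "\<dots> = D ^ 3 * (\<Sum>j\<in>A. z j ^ 4 / d j ^ 3)"
    by (simp add: power_divide eval_nat_numeral mult_ac)
  finally show ?thesis .
qed

text \<open>Apart from end points, each time lies in at most two of the windows.\<close>

lemma sum_overlapping_integrals:
  fixes H :: "real \<Rightarrow> real"
  assumes H: "continuous_on UNIV H" "\<And>t. 0 \<le> H t" and \<tau>: "0 \<le> \<tau>"
  shows "(\<Sum>n<N. integral {real n * \<tau>..real n * \<tau> + 2 * \<tau>} H) \<le> 2 * integral {0..(real N + 1) * \<tau>} H"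
proof -
  have i: "H integrable_on {a..b}" for a b
    by (intro integrable_continuous_interval continuous_on_subset[OF H(1)]) simp
  have comb: "integral {0..a} H + integral {a..b} H = integral {0..b} H" if "0 \<le> a" "a \<le> b" for a b
    using that by (intro Henstock_Kurzweil_Integration.integral_combine i)
  have "(\<Sum>n<N. integral {real n * \<tau>..real n * \<tau> + 2 * \<tau>} H)
      \<le> integral {0..real N * \<tau>} H + integral {0..(real N + 1) * \<tau>} H"
  proof (induction N)
    case 0
    show ?case using \<tau> by (simp add: Henstock_Kurzweil_Integration.integral_nonneg i H)
  next
    case (Suc N)
    have "integral {0..real N * \<tau>} H + integral {real N * \<tau>..real N * \<tau> + 2 * \<tau>} H
        = integral {0..real N * \<tau> + 2 * \<tau>} H"
      using \<tau> by (intro comb) auto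
    then show ?case using Suc by (simp add: algebra_simps)
  qed
  also have "integral {0..real N * \<tau>} H \<le> integral {0..(real N + 1) * \<tau>} H"
    using \<tau> by (intro integral_subset_le i) (auto simp: algebra_simps H)
  finally show ?thesis by simp
qed

lemma fser_sum:
  assumes "finite A" "\<And>j. j \<in> A \<Longrightarrow> summable_coeffs (c j)"
  shows "fser (\<lambda>k. \<Sum>j\<in>A. c j k) x = (\<Sum>j\<in>A. fser (c j) x)"
proof -
  have "summable_coeffs (\<lambda>k. \<Sum>j\<in>A. c j k) \<and> fser (\<lambda>k. \<Sum>j\<in>A. c j k) x = (\<Sum>j\<in>A. fser (c j) x)"
    using assms
  proof (induction A)
    case empty
    show ?case by (simp add: summable_coeffs_def fser_def)
  next
    case (insert i A)
    then show ?case by (simp add: fser_add summable_coeffs_add)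
  qed
  then show ?thesis ..
qed

lemma quartic_flow: "quartic (flow s c) t = quartic c (s + t)"
  by (simp add: quartic_def flow_flow add.commute)

text \<open>A Strichartz estimate for data that change from one window to the next: only the total size of the
  increments enters. The flow of each increment is estimated over all windows at once, and Jensen's
  inequality with weights equal to their sizes sums their fourth powers without loss.\<close>

lemma strichartz_along_profile:
  fixes w :: "nat \<Rightarrow> int \<Rightarrow> complex"
  assumes bl: "\<And>n. band_limited J (w n)"
    and w0: "l2_le (dx (w 0)) B" "B > 0"
    and inc: "\<And>n. Suc n < N \<Longrightarrow> l2_le (dx (\<lambda>k. w (Suc n) k - w n k)) \<delta>" "\<delta> > 0"
    and \<tau>: "\<tau> \<ge> 0" and L: "(real N + 1) * \<tau> \<le> real m / (2 * pi)" and D: "B + real N * \<delta> \<le> D"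
  shows "(\<Sum>n<N. integral {0..2 * \<tau>} (quartic (dx (flow (real n * \<tau>) (w n)))))
      \<le> 4 * (real m / (2 * pi)) * D ^ 4"
proof -
  \<comment> \<open>The profiles telescope: \<open>w n\<close> has derivative \<open>x 0 + ... + x n\<close>, and \<open>d j\<close> bounds \<open>x j\<close>
    in \<open>L\<^sup>2\<close>.\<close>
  define x where "x = (\<lambda>j. case j of 0 \<Rightarrow> dx (w 0) | Suc i \<Rightarrow> dx (\<lambda>k. w (Suc i) k - w i k))"
  define d where "d = (\<lambda>j :: nat. case j of 0 \<Rightarrow> B | Suc i \<Rightarrow> \<delta>)"
  define L where "L = real m / (2 * pi)"
  have d: "0 < d j" for j using w0 inc by (simp add: d_def split: nat.split)
  have sd: "sum d {..<N} \<le> D"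
  proof -
    have "sum d {..<N} \<le> (\<Sum>j<N. (if j = 0 then B else 0) + \<delta>)"
      using w0 inc by (intro sum_mono) (auto simp: d_def split: nat.split)
    also have "\<dots> \<le> B + real N * \<delta>" using w0 by (simp add: sum.distrib)
    finally show ?thesis using D by simp
  qed
  have D0: "0 \<le> D" using sd d by (meson less_imp_le order_trans sum_nonneg)
  have xb: "band_limited J (x j)" for j
    using bl by (auto simp: x_def band_limited_def dx_def split: nat.split)
  have x2: "l2_le (x j) (d j)" if "j < N" for j
    using that w0 inc by (auto simp: x_def d_def split: nat.split)
  have tel: "dx (w n) k = (\<Sum>j\<le>n. x j k)" for n k
    by (induction n) (auto simp: x_def dx_def right_diff_distrib)
  \<comment> \<open>A majorant for all \<open>n\<close> at once, built from free solutions with data that do not depend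
    on \<open>n\<close>.\<close>
  define H where "H = (\<lambda>t. D ^ 3 * (\<Sum>j<N. quartic (x j) t / d j ^ 3))"
  have cH: "continuous_on A H" for A
    unfolding H_def by (intro continuous_intros continuous_on_quartic[OF xb]) (use d in \<open>auto simp: less_imp_neq[symmetric]\<close>)
  have H0: "0 \<le> H t" for t
    unfolding H_def using D0 d quartic_nonneg by (intro mult_nonneg_nonneg sum_nonneg divide_nonneg_nonneg) (auto simp: less_imp_le)
  \<comment> \<open>Adding the increments beyond \<open>n\<close> only increases the sum of moduli.\<close>
  have pw: "quartic (dx (flow (real n * \<tau>) (w n))) r \<le> H (real n * \<tau> + r)" if n: "n < N" for n r
  proof -
    define t where "t = real n * \<tau> + r"
    define z where "z = (\<lambda>j y. cmod (fser (flow t (x j)) y))"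
    have cz: "continuous_on UNIV (z j)" for j
      unfolding z_def by (intro continuous_intros band_limited_summable[OF band_limited_flow[OF xb]])
    have "flow t (dx (w n)) = (\<lambda>k. \<Sum>j\<le>n. flow t (x j) k)"
      by (rule ext) (simp add: flow_def tel sum_distrib_left)
    then have "cmod (fser (flow t (dx (w n))) y) \<le> (\<Sum>j\<le>n. z j y)" for y
      using fser_sum[of "{..n}" "\<lambda>j. flow t (x j)" y] band_limited_summable[OF band_limited_flow[OF xb]]
      by (simp add: z_def norm_sum)
    moreover have "(\<Sum>j\<le>n. z j y) \<le> (\<Sum>j<N. z j y)" for y
      using n by (intro sum_mono2) (auto simp: z_def)
    ultimately have z1: "cmod (fser (flow t (dx (w n))) y) \<le> (\<Sum>j<N. z j y)" for y
      using order_trans by blast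
    have z2: "cmod (fser (flow t (dx (w n))) y) ^ 4 \<le> D ^ 3 * (\<Sum>j<N. z j y ^ 4 / d j ^ 3)" for y
      using power_mono[OF z1 norm_ge_zero, of y 4] weighted_fourth_power_sum[of "{..<N}" d D "\<lambda>j. z j y"] d sd
      by (meson order_trans)
    have "quartic (dx (flow (real n * \<tau>) (w n))) r = (LINT y|torus. cmod (fser (flow t (dx (w n))) y) ^ 4)"
      by (simp add: dx_flow quartic_flow t_def) (simp add: quartic_def)
    also have "\<dots> \<le> (LINT y|torus. D ^ 3 * (\<Sum>j<N. z j y ^ 4 / d j ^ 3))"
    proof (rule integral_period_mono[OF _ _ z2])
      show "continuous_on UNIV (\<lambda>y. cmod (fser (flow t (dx (w n))) y) ^ 4)"
        by (intro continuous_intros band_limited_summable[OF band_limited_flow[OF band_limited_dx[OF bl]]])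
      show "continuous_on UNIV (\<lambda>y. D ^ 3 * (\<Sum>j<N. z j y ^ 4 / d j ^ 3))"
        by (intro continuous_intros cz) (use d in \<open>auto simp: less_imp_neq[symmetric]\<close>)
    qed
    also have "\<dots> = D ^ 3 * (\<Sum>j<N. LINT y|torus. z j y ^ 4 / d j ^ 3)"
    proof -
      have "integrable torus (\<lambda>y. z j y ^ 4 / d j ^ 3)" for j
        using d[of j] by (intro integrable_period_continuous continuous_intros cz) auto
      then show ?thesis by simp
    qed
    also have "\<dots> = H t" by (simp add: H_def quartic_def z_def)
    finally show ?thesis by (simp add: t_def)
  qed
  have "(\<Sum>n<N. integral {0..2 * \<tau>} (quartic (dx (flow (real n * \<tau>) (w n)))))
      \<le> (\<Sum>n<N. integral {real n * \<tau>..real n * \<tau> + 2 * \<tau>} H)"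
  proof (rule sum_mono)
    fix n assume n: "n \<in> {..<N}"
    have "integral {0..2 * \<tau>} (quartic (dx (flow (real n * \<tau>) (w n)))) \<le> integral {0..2 * \<tau>} (H \<circ> (+) (real n * \<tau>))"
      using n pw unfolding o_def
      by (intro integral_le integrable_continuous_interval continuous_on_quartic[OF band_limited_dx[OF band_limited_flow[OF bl]]]
          continuous_on_compose2[OF cH[of UNIV]] continuous_intros) auto
    also have "\<dots> = integral {real n * \<tau>..real n * \<tau> + 2 * \<tau>} H"
      by (subst integral_shift_Icc_real) (simp add: add.commute)
    finally show "integral {0..2 * \<tau>} (quartic (dx (flow (real n * \<tau>) (w n)))) \<le> integral {real n * \<tau>..real n * \<tau> + 2 * \<tau>} H" .
  qed
  also have "\<dots> \<le> 2 * integral {0..(real N + 1) * \<tau>} H"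
    by (rule sum_overlapping_integrals[OF cH H0 \<tau>])
  also have "\<dots> \<le> 2 * integral {0..L} H"
    using assms(7) by (intro mult_left_mono integral_subset_le integrable_continuous_interval cH) (auto simp: H0 L_def)
  also have "integral {0..L} H = D ^ 3 * (\<Sum>j<N. integral {0..L} (quartic (x j)) / d j ^ 3)"
  proof (rule integral_unique)
    have "(quartic (x j) has_integral integral {0..L} (quartic (x j))) {0..L}" for j
      by (intro integrable_integral integrable_continuous_interval continuous_on_quartic[OF xb])
    then show "(H has_integral D ^ 3 * (\<Sum>j<N. integral {0..L} (quartic (x j)) / d j ^ 3)) {0..L}"
      unfolding H_def by (intro has_integral_mult_right has_integral_sum has_integral_divide) auto
  qed
  also have "\<dots> \<le> D ^ 3 * (\<Sum>j<N. 2 * L * d j)"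
  proof (intro mult_left_mono sum_mono)
    fix j assume "j \<in> {..<N}"
    then have "integral {0..L} (quartic (x j)) \<le> 2 * L * d j ^ 4"
      unfolding L_def using strichartz_periodic[OF xb x2] by simp
    then have "integral {0..L} (quartic (x j)) / d j ^ 3 \<le> 2 * L * d j ^ 4 / d j ^ 3"
      using d[of j] by (intro divide_right_mono) auto
    then show "integral {0..L} (quartic (x j)) / d j ^ 3 \<le> 2 * L * d j"
      using d[of j] by (simp add: eval_nat_numeral)
  qed (use D0 in simp)
  also have "\<dots> = D ^ 3 * (2 * L) * sum d {..<N}" by (simp only: sum_distrib_left mult.assoc)
  also have "\<dots> \<le> D ^ 3 * (2 * L) * D"
    using sd D0 by (intro mult_left_mono) (auto simp: L_def)
  finally show ?thesis by (simp add: L_def eval_nat_numeral mult_ac)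
qed

section \<open>The local error\<close>

definition trunc :: "nat \<Rightarrow> (int \<Rightarrow> complex) \<Rightarrow> int \<Rightarrow> complex" where
  "trunc J c k = (if k \<in> freqs_below J then c k else 0)"

lemma band_limited_trunc [simp]: "band_limited J (trunc J c)"
  by (simp add: band_limited_def trunc_def)

lemma trunc_flow: "trunc J (flow t c) = flow t (trunc J c)"
  by (rule ext) (simp add: trunc_def flow_def)

lemma l1_le_trunc: "l1_le c R \<Longrightarrow> l1_le (trunc J c) R"
  by (erule l1_le_cmod_mono) (simp add: trunc_def)

lemma l2_le_trunc_error:
  assumes c: "l2_le (dx c) B" and J: "1 \<le> real J * \<tau>" "0 \<le> \<tau>"
  shows "l2_le (\<lambda>k. c k - trunc J c k) (\<tau> * B)"
proof -
  have "l2_le (\<lambda>k. of_real \<tau> * dx c k) (\<tau> * B)"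
    by (rule l2_le_mult[OF c]) (use J in simp)
  moreover have "cmod (c k - trunc J c k) \<le> cmod (of_real \<tau> * dx c k)" for k
  proof (cases "k \<in> freqs_below J")
    case True
    then show ?thesis by (simp add: trunc_def)
  next
    case False
    then have "real J \<le> \<bar>of_int k\<bar>" by (auto simp: freqs_below_def)
    then have "1 \<le> \<tau> * \<bar>of_int k\<bar>"
      using J mult_right_mono[of "real J" "\<bar>of_int k\<bar>" \<tau>] by (simp add: mult.commute)
    also have "\<dots> \<le> \<tau> * (2 * pi * \<bar>of_int k\<bar>)"
      using J pi_gt3 by (intro mult_left_mono) (auto simp: mult_le_cancel_right1)
    finally have "1 * cmod (c k) \<le> \<tau> * (2 * pi * \<bar>of_int k\<bar>) * cmod (c k)"
      by (rule mult_right_mono) simp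
    then show ?thesis using False J by (simp add: trunc_def dx_def norm_mult mult_ac)
  qed
  ultimately show ?thesis by (rule l2_le_cmod_mono)
qed

lemma fourier_coeff_mult_band_limited:
  assumes F: "continuous_on UNIV F" and b: "band_limited J b"
  shows "fourier_coeff (\<lambda>x. F x * fser b x) k = (\<Sum>j\<in>freqs_below J. b j * fourier_coeff (\<lambda>x. F x * mode j x) k)"
proof -
  have eq: "F x * fser b x * mode (- k) x = (\<Sum>j\<in>freqs_below J. b j * (F x * mode j x * mode (- k) x))" for x
    by (simp add: fser_band_limited[OF b] sum_distrib_left sum_distrib_right mult_ac)
  have "fourier_coeff (\<lambda>x. F x * fser b x) k =
      (\<Sum>j\<in>freqs_below J. LINT x|torus. b j * (F x * mode j x * mode (- k) x))"
    unfolding fourier_coeff_mode eq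
    by (intro Bochner_Integration.integral_sum integrable_period_continuous continuous_intros F)
  then show ?thesis by (simp add: fourier_coeff_mode)
qed

lemma scheme_cubic_deriv:
  assumes p: "band_limited J p" and s: "s \<in> {0..\<tau>}"
  shows "((\<lambda>s. scheme_cubic s p k) has_vector_derivative
      fourier_coeff (\<lambda>x. (fser p x)\<^sup>2 * fser (\<lambda>k. cis (2 * freq k * s) * conj_coeffs p k) x) k) (at s within {0..\<tau>})"
proof -
  let ?F = "\<lambda>x. (fser p x)\<^sup>2"
  have F: "continuous_on UNIV ?F"
    by (intro continuous_intros band_limited_summable[OF p])
  have bl: "band_limited J (\<lambda>k. m k * conj_coeffs p k)" for m
    using p by (simp add: band_limited_def conj_coeffs_def)
  show ?thesis
    unfolding scheme_cubic_def fourier_coeff_mult_band_limited[OF F bl]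
    by (intro has_vector_derivative_sum has_vector_derivative_mult_left phi_symbol_deriv s)
qed

text \<open>A solution of the nonlinear Schroedinger equation in terms of its Fourier coefficients.\<close>

locale coefficient_solution =
  fixes T \<mu> M R :: real and c :: "real \<Rightarrow> int \<Rightarrow> complex"
  assumes \<mu>: "\<bar>\<mu>\<bar> = 1"
    and h1: "t \<in> {0..T} \<Longrightarrow> h1_le (c t) M"
    and l1: "t \<in> {0..T} \<Longrightarrow> l1_le (c t) R"
    and ode: "t \<in> {0..T} \<Longrightarrow> ((\<lambda>t. c t k) has_vector_derivative
        - \<i> * of_real (freq k) * c t k - \<i> * of_real \<mu> * cubic (c t) k) (at t within {0..T})"
begin

lemma l2_le_c: "t \<in> {0..T} \<Longrightarrow> l2_le (c t) M"
  using h1 h1_le_l2_le by blast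

lemma l2_le_dx_c: "t \<in> {0..T} \<Longrightarrow> l2_le (dx (c t)) M"
  using h1 h1_le_dx by blast

lemma profile_deriv:
  assumes "t0 + s \<in> {0..T}" "s \<in> S" "(+) t0 ` S \<subseteq> {0..T}"
  shows "((\<lambda>s. flow (- s) (c (t0 + s)) k) has_vector_derivative
     - \<i> * of_real \<mu> * flow (- s) (cubic (c (t0 + s))) k) (at s within S)"
proof -
  have "((\<lambda>s. c (t0 + s) k) has_vector_derivative
        - \<i> * of_real (freq k) * c (t0 + s) k - \<i> * of_real \<mu> * cubic (c (t0 + s)) k) (at s within S)"
  proof -
    have "((\<lambda>s. t0 + s) has_vector_derivative 1) (at s within S)"
      by (auto intro!: derivative_eq_intros)
    from vector_diff_chain_within[OF this has_vector_derivative_within_subset[OF ode[OF assms(1), of k] assms(3)]]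
    show ?thesis by (simp add: o_def)
  qed
  moreover have "((\<lambda>s. cis (freq k * s)) has_vector_derivative freq k *\<^sub>R (\<i> * cis (freq k * s))) (at s within S)"
    unfolding has_vector_derivative_def
    by (auto intro!: derivative_eq_intros simp: algebra_simps)
  ultimately have "((\<lambda>s. cis (freq k * s) * c (t0 + s) k) has_vector_derivative
      cis (freq k * s) * (- \<i> * of_real (freq k) * c (t0 + s) k - \<i> * of_real \<mu> * cubic (c (t0 + s)) k)
      + freq k *\<^sub>R (\<i> * cis (freq k * s)) * c (t0 + s) k) (at s within S)"
    by (intro has_vector_derivative_mult)
  then show ?thesis
    by (simp add: flow_def scaleR_conv_of_real algebra_simps)
qed

lemma norm_i_mu [simp]: "cmod (\<i> * of_real \<mu>) = 1"
  using \<mu> by (simp add: norm_mult)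

lemma l2_le_flow [simp]: "l2_le (flow t a) B = l2_le a B"
  by (simp add: l2_le_def)

lemma l1_le_flow [simp]: "l1_le (flow t a) B = l1_le a B"
  by (simp add: l1_le_def)

text \<open>In the profile \<open>flow (- s) (c (t0 + s))\<close> the second derivative of the equation is removed, so its
  speed is the nonlinearity, which is bounded in \<open>H\<^sup>1\<close>.\<close>

lemma profile_lipschitz:
  assumes "t0 \<in> {0..T}" "t0 + s \<in> {0..T}" "0 \<le> s"
  shows "l2_le (\<lambda>k. flow (- s) (c (t0 + s)) k - c t0 k) (s * (3 * R\<^sup>2 * M))"
    and "l2_le (dx (\<lambda>k. flow (- s) (c (t0 + s)) k - c t0 k)) (s * (3 * R\<^sup>2 * M))"
proof -
  have sub: "t0 + r \<in> {0..T}" if "r \<in> {0..s}" for r using assms that by auto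
  have d: "((\<lambda>s. flow (- s) (c (t0 + s)) k) has_vector_derivative
     - \<i> * of_real \<mu> * flow (- r) (cubic (c (t0 + r))) k) (at r within {0..s})" if "r \<in> {0..s}" for r k
    using assms that by (intro profile_deriv) auto
  have "l2_le (\<lambda>k. flow (- s) (c (t0 + s)) k - flow (- 0) (c (t0 + 0)) k) ((s - 0) * (1 * (3 * R\<^sup>2 * M)))"
    by (rule l2_le_mean_value[OF assms(3) l2_le_mult[where m = "\<lambda>k. - \<i> * of_real \<mu>"]])
      (use d l1 l2_le_c sub in \<open>auto intro!: cubic_bound\<close>)
  then show "l2_le (\<lambda>k. flow (- s) (c (t0 + s)) k - c t0 k) (s * (3 * R\<^sup>2 * M))" by simp
  have "l2_le (\<lambda>k. dx (flow (- s) (c (t0 + s))) k - dx (flow (- 0) (c (t0 + 0))) k) ((s - 0) * (1 * (3 * R\<^sup>2 * M)))"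
  proof (rule l2_le_mean_value[OF assms(3) l2_le_mult[where m = "\<lambda>k. - \<i> * of_real \<mu>"]])
    fix r assume r: "r \<in> {0..s}"
    show "l2_le (flow (- r) (dx (cubic (c (t0 + r))))) (3 * R\<^sup>2 * M)"
      using l1 l2_le_dx_c sub[OF r] by (auto intro!: cubic_dx)
    fix k
    have "((\<lambda>s. 2 * pi * \<i> * of_int k * flow (- s) (c (t0 + s)) k) has_vector_derivative
       2 * pi * \<i> * of_int k * (- \<i> * of_real \<mu> * flow (- r) (cubic (c (t0 + r))) k)) (at r within {0..s})"
      by (rule has_vector_derivative_mult_right[OF d[OF r]])
    then show "((\<lambda>s. dx (flow (- s) (c (t0 + s))) k) has_vector_derivative
       - \<i> * of_real \<mu> * flow (- r) (dx (cubic (c (t0 + r)))) k) (at r within {0..s})"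
      by (simp add: dx_def flow_def mult_ac)
  qed simp
  then show "l2_le (dx (\<lambda>k. flow (- s) (c (t0 + s)) k - c t0 k)) (s * (3 * R\<^sup>2 * M))"
    by (simp add: dx_def[abs_def] right_diff_distrib)
qed

text \<open>The nonlinear parts of both the solution and the scheme are curves in the step size, and their
  speeds differ by the resonance error plus the error of replacing the solution by its linear flow.
  The truncation \<open>p\<close> of the data makes all sums in the resonance estimate finite.\<close>

lemma local_error:
  assumes t: "t \<in> {0..T}" "t + \<tau> \<in> {0..T}" and \<tau>: "0 \<le> \<tau>" and J: "1 \<le> real J * \<tau>"
  shows "l2_le (\<lambda>k. c (t + \<tau>) k - scheme_step \<tau> \<mu> (c t) k)
    (\<tau> * (3 * R\<^sup>2 * (\<tau> * (3 * R\<^sup>2 * M) + \<tau> * M) +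
       R * (3 * integral {0..2 * \<tau>} (quartic (dx (trunc J (c t)))) + 3 * \<tau>)) + 4 * \<tau> * R\<^sup>2 * (\<tau> * M))"
proof -
  define p where "p = trunc J (c t)"
  have p: "band_limited J p" "l1_le p R" "l2_le (\<lambda>k. c t k - p k) (\<tau> * M)"
    unfolding p_def using l2_le_trunc_error[OF l2_le_dx_c[OF t(1)] J \<tau>] l1_le_trunc[OF l1[OF t(1)]] by auto
  define F where "F = (\<lambda>s. fourier_coeff (\<lambda>x. (fser p x)\<^sup>2 * fser (\<lambda>k. cis (2 * freq k * s) * conj_coeffs p k) x))"
  define I where "I = integral {0..2 * \<tau>} (quartic (dx p))"
  have sub: "t + s \<in> {0..T}" if "s \<in> {0..\<tau>}" for s using t that by auto
  have close: "l2_le (\<lambda>k. c (t + s) k - flow s p k) (\<tau> * (3 * R\<^sup>2 * M) + \<tau> * M)" if s: "s \<in> {0..\<tau>}" for s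
  proof -
    have "l2_le (\<lambda>k. (flow (- s) (c (t + s)) k - c t k) + (c t k - p k)) (s * (3 * R\<^sup>2 * M) + \<tau> * M)"
      using s by (intro l2_le_add profile_lipschitz(1) p t sub) auto
    then have "l2_le (flow s (\<lambda>k. flow (- s) (c (t + s)) k - p k)) (s * (3 * R\<^sup>2 * M) + \<tau> * M)"
      by simp
    moreover have "flow s (\<lambda>k. flow (- s) (c (t + s)) k - p k) = (\<lambda>k. c (t + s) k - flow s p k)"
      using flow_flow[of s "- s" "c (t + s)"] by (auto simp: flow_def fun_eq_iff right_diff_distrib)
    moreover have "s * (3 * R\<^sup>2 * M) \<le> \<tau> * (3 * R\<^sup>2 * M)"
      using s l2_le_nonneg[OF l2_le_c[OF t(1)]] by (intro mult_right_mono) auto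
    ultimately show ?thesis by (auto intro: l2_le_mono)
  qed
  have "l2_le (\<lambda>k. (flow (- \<tau>) (c (t + \<tau>)) k - - \<i> * of_real \<mu> * scheme_cubic \<tau> p k)
        - (flow (- 0) (c (t + 0)) k - - \<i> * of_real \<mu> * scheme_cubic 0 p k))
      ((\<tau> - 0) * (1 * (3 * R\<^sup>2 * (\<tau> * (3 * R\<^sup>2 * M) + \<tau> * M) + R * (3 * I + 3 * \<tau>))))"
  proof (rule l2_le_mean_value[OF \<tau> l2_le_mult[where m = "\<lambda>k. - \<i> * of_real \<mu>"]])
    fix s assume s: "s \<in> {0..\<tau>}"
    have "l2_le (flow (- s) (\<lambda>k. cubic (c (t + s)) k - cubic (flow s p) k)) (3 * R\<^sup>2 * (\<tau> * (3 * R\<^sup>2 * M) + \<tau> * M))"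
      using cubic_lipschitz[OF l1[OF sub[OF s]] _ close[OF s]] p by simp
    moreover have "l2_le (\<lambda>k. flow (- s) (cubic (flow s p)) k - F s k) (R * (3 * I + 3 * \<tau>))"
      unfolding F_def I_def using s by (intro resonance_error[OF p(1,2)]) auto
    ultimately have "l2_le (\<lambda>k. flow (- s) (\<lambda>k. cubic (c (t + s)) k - cubic (flow s p) k) k
        + (flow (- s) (cubic (flow s p)) k - F s k))
      (3 * R\<^sup>2 * (\<tau> * (3 * R\<^sup>2 * M) + \<tau> * M) + R * (3 * I + 3 * \<tau>))"
      by (rule l2_le_add)
    moreover have "flow (- s) (\<lambda>k. cubic (c (t + s)) k - cubic (flow s p) k) k
        + (flow (- s) (cubic (flow s p)) k - F s k) = flow (- s) (cubic (c (t + s))) k - F s k" for k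
      by (simp add: flow_def right_diff_distrib)
    ultimately show "l2_le (\<lambda>k. flow (- s) (cubic (c (t + s))) k - F s k)
        (3 * R\<^sup>2 * (\<tau> * (3 * R\<^sup>2 * M) + \<tau> * M) + R * (3 * I + 3 * \<tau>))" by simp
    fix k
    have "((\<lambda>s. flow (- s) (c (t + s)) k - - \<i> * of_real \<mu> * scheme_cubic s p k) has_vector_derivative
        - \<i> * of_real \<mu> * flow (- s) (cubic (c (t + s))) k - - \<i> * of_real \<mu> * F s k) (at s within {0..\<tau>})"
      unfolding F_def using s t
      by (intro has_vector_derivative_diff has_vector_derivative_mult_right scheme_cubic_deriv[OF p(1)] profile_deriv) auto
    then show "((\<lambda>s. flow (- s) (c (t + s)) k - - \<i> * of_real \<mu> * scheme_cubic s p k) has_vector_derivative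
        - \<i> * of_real \<mu> * (flow (- s) (cubic (c (t + s))) k - F s k)) (at s within {0..\<tau>})"
      by (simp add: right_diff_distrib)
  qed simp
  moreover have "scheme_cubic 0 p k = 0" for k
    by (simp add: scheme_cubic_def fser_def fourier_coeff_def)
  ultimately have A: "l2_le (\<lambda>k. flow (- \<tau>) (c (t + \<tau>)) k + \<i> * of_real \<mu> * scheme_cubic \<tau> p k - c t k)
      (\<tau> * (3 * R\<^sup>2 * (\<tau> * (3 * R\<^sup>2 * M) + \<tau> * M) + R * (3 * I + 3 * \<tau>)))"
    by simp
  have "l2_le (\<lambda>k. \<i> * of_real \<mu> * (scheme_cubic \<tau> (c t) k - scheme_cubic \<tau> p k)) (1 * (4 * \<tau> * R\<^sup>2 * (\<tau> * M)))"
    by (intro l2_le_mult scheme_cubic_lipschitz p l1 t \<tau>) (use \<mu> in \<open>simp add: norm_mult\<close>)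
  from l2_le_add[OF A this]
  have X: "l2_le (flow \<tau> (\<lambda>k. flow (- \<tau>) (c (t + \<tau>)) k + \<i> * of_real \<mu> * scheme_cubic \<tau> p k - c t k
       + \<i> * of_real \<mu> * (scheme_cubic \<tau> (c t) k - scheme_cubic \<tau> p k)))
    (\<tau> * (3 * R\<^sup>2 * (\<tau> * (3 * R\<^sup>2 * M) + \<tau> * M) + R * (3 * I + 3 * \<tau>)) + 4 * \<tau> * R\<^sup>2 * (\<tau> * M))"
    by simp
  have E: "flow \<tau> (\<lambda>k. flow (- \<tau>) (c (t + \<tau>)) k + \<i> * of_real \<mu> * scheme_cubic \<tau> p k - c t k
       + \<i> * of_real \<mu> * (scheme_cubic \<tau> (c t) k - scheme_cubic \<tau> p k)) = (\<lambda>k. c (t + \<tau>) k - scheme_step \<tau> \<mu> (c t) k)"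
    using flow_flow[of \<tau> "- \<tau>" "c (t + \<tau>)"]
    by (auto simp: flow_def scheme_step_def fun_eq_iff algebra_simps)
  show ?thesis using X unfolding E by (simp only: I_def p_def)
qed

end

section \<open>From the equation to its Fourier coefficients\<close>

lemma sobolev_spaceD: "c \<in> sobolev_space r \<Longrightarrow> (\<lambda>k. (1 + freq k) powr r * (cmod (c k))\<^sup>2) summable_on UNIV"
  by (simp add: sobolev_space_def freq_def)

lemma sobolev_norm_freq: "sobolev_norm r c = sqrt (\<Sum>\<^sub>\<infinity>k. (1 + freq k) powr r * (cmod (c k))\<^sup>2)"
  by (simp add: sobolev_norm_def freq_def)

lemma sobolev_space_cmult: "c \<in> sobolev_space r \<Longrightarrow> (\<lambda>k. a * c k) \<in> sobolev_space r"
  unfolding sobolev_space_def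
  by (auto simp: norm_mult power_mult_distrib mult.left_commute intro!: summable_on_cmult_right)

lemma sobolev_space_diff:
  assumes "c \<in> sobolev_space r" "d \<in> sobolev_space r"
  shows "(\<lambda>k. c k - d k) \<in> sobolev_space r"
proof -
  define g where "g = (\<lambda>k. 2 * ((1 + freq k) powr r * (cmod (c k))\<^sup>2) + 2 * ((1 + freq k) powr r * (cmod (d k))\<^sup>2))"
  have "g summable_on UNIV"
    unfolding g_def by (intro summable_on_add summable_on_cmult_right sobolev_spaceD assms)
  moreover have "(1 + freq k) powr r * (cmod (c k - d k))\<^sup>2 \<le> g k" for k
  proof -
    have "(cmod (c k - d k))\<^sup>2 \<le> (cmod (c k) + cmod (d k))\<^sup>2"
      by (intro power_mono norm_triangle_ineq4) simp
    also have "\<dots> \<le> 2 * (cmod (c k))\<^sup>2 + 2 * (cmod (d k))\<^sup>2"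
      using sum_squares_bound[of "cmod (c k)" "cmod (d k)"] unfolding power2_sum by linarith
    finally have "(1 + freq k) powr r * (cmod (c k - d k))\<^sup>2 \<le> (1 + freq k) powr r * (2 * (cmod (c k))\<^sup>2 + 2 * (cmod (d k))\<^sup>2)"
      by (rule mult_left_mono) simp
    then show ?thesis by (simp add: g_def algebra_simps)
  qed
  ultimately have "(\<lambda>k. (1 + freq k) powr r * (cmod (c k - d k))\<^sup>2) summable_on UNIV"
    by (rule summable_on_comparison_test) auto
  then show ?thesis by (simp add: sobolev_space_def freq_def)
qed

lemma sobolev_norm_component:
  assumes "c \<in> sobolev_space r"
  shows "cmod (c k) \<le> (1 + freq k) powr (- r / 2) * sobolev_norm r c"
proof -
  have f: "1 + freq k > 0" by (simp add: add_pos_nonneg)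
  have "(1 + freq k) powr r * (cmod (c k))\<^sup>2 \<le> (\<Sum>\<^sub>\<infinity>k. (1 + freq k) powr r * (cmod (c k))\<^sup>2)"
    using finite_sum_le_infsum[OF sobolev_spaceD[OF assms], of "{k}"] by simp
  then have "sqrt ((1 + freq k) powr r * (cmod (c k))\<^sup>2) \<le> sobolev_norm r c"
    unfolding sobolev_norm_freq by (rule real_sqrt_le_mono)
  moreover have "sqrt ((1 + freq k) powr r * (cmod (c k))\<^sup>2) = (1 + freq k) powr (r / 2) * cmod (c k)"
    using f by (simp add: real_sqrt_mult powr_half_sqrt[symmetric] powr_powr)
  ultimately have "(1 + freq k) powr (- r / 2) * ((1 + freq k) powr (r / 2) * cmod (c k)) \<le> (1 + freq k) powr (- r / 2) * sobolev_norm r c"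
    by (intro mult_left_mono) auto
  moreover have "(1 + freq k) powr (- r / 2) * ((1 + freq k) powr (r / 2) * cmod (c k)) = cmod (c k)"
    using f by (simp add: powr_add[symmetric] mult.assoc[symmetric])
  ultimately show ?thesis by (simp only:)
qed

lemma sobolev_has_derivative_component:
  assumes d: "sobolev_has_derivative r T c v" and t: "t \<in> {0..T}"
  shows "((\<lambda>t. c t k) has_vector_derivative v t k) (at t within {0..T})"
proof -
  define q where "q = (\<lambda>s. (c s k - c t k) / of_real (s - t) - v t k)"
  define e where "e = (\<lambda>s. sobolev_norm r (\<lambda>k. (c s k - c t k) / of_real (s - t) - v t k))"
  have "(e \<longlongrightarrow> 0) (at t within {0..T})"
    using d t by (simp add: sobolev_has_derivative_def e_def)
  then have lim: "((\<lambda>s. (1 + freq k) powr (- r / 2) * e s) \<longlongrightarrow> 0) (at t within {0..T})"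
    by (auto intro: tendsto_eq_intros)
  have mem: "(\<lambda>k. (c s k - c t k) / of_real (s - t) - v t k) \<in> sobolev_space r" if "s \<in> {0..T}" for s
    using d t that sobolev_space_cmult[OF sobolev_space_diff, of "c s" r "c t" "1 / of_real (s - t)"]
    by (intro sobolev_space_diff) (auto simp: sobolev_has_derivative_def)
  have "\<forall>\<^sub>F s in at t within {0..T}. norm (q s) \<le> (1 + freq k) powr (- r / 2) * e s"
    unfolding eventually_at_filter q_def e_def
    using sobolev_norm_component[OF mem] by (intro always_eventually allI impI)
  then have "(q \<longlongrightarrow> 0) (at t within {0..T})"
    using lim by (rule Lim_null_comparison)
  then have "((\<lambda>s. norm (q s)) \<longlongrightarrow> 0) (at t within {0..T})"
    by (rule tendsto_norm_zero)
  moreover have "norm ((1 / norm (s - t)) *\<^sub>R (c s k - (c t k + (s - t) *\<^sub>R v t k))) = norm (q s)"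
    if "s \<noteq> t" for s
  proof -
    have "q s = (c s k - (c t k + (s - t) *\<^sub>R v t k)) / of_real (s - t)"
      using that by (simp add: q_def scaleR_conv_of_real field_simps flip: of_real_diff)
    then show ?thesis by (simp add: norm_divide flip: of_real_diff)
  qed
  then have "\<forall>\<^sub>F s in at t within {0..T}. norm (q s) =
      norm ((1 / norm (s - t)) *\<^sub>R (c s k - (c t k + (s - t) *\<^sub>R v t k)))"
    unfolding eventually_at_filter by (intro always_eventually) auto
  ultimately have "((\<lambda>s. norm ((1 / norm (s - t)) *\<^sub>R (c s k - (c t k + (s - t) *\<^sub>R v t k)))) \<longlongrightarrow> 0) (at t within {0..T})"
    by (rule Lim_transform_eventually)
  then have "((\<lambda>s. (1 / norm (s - t)) *\<^sub>R (c s k - (c t k + (s - t) *\<^sub>R v t k))) \<longlongrightarrow> 0) (at t within {0..T})"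
    by (rule tendsto_norm_zero_cancel)
  then show ?thesis
    unfolding has_vector_derivative_def has_derivative_within by (simp add: bounded_linear_scaleR_left)
qed

lemma H1_torus_h1_le:
  assumes "f \<in> H1_torus"
  shows "h1_le (fourier_coeff f) (H1_norm f)"
  unfolding h1_le_def l2_le_def
proof (intro allI impI)
  fix K :: "int set" assume "finite K"
  have "(\<lambda>k. (1 + freq k) powr 1 * (cmod (fourier_coeff f k))\<^sup>2) summable_on UNIV"
    using assms by (intro sobolev_spaceD) (simp add: H1_torus_def)
  from finite_sum_le_infsum[OF this \<open>finite K\<close>]
  have "(\<Sum>k\<in>K. (1 + freq k) powr 1 * (cmod (fourier_coeff f k))\<^sup>2) \<le> (H1_norm f)\<^sup>2"
    unfolding H1_norm_def sobolev_norm_freq by (simp add: infsum_nonneg)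
  moreover have "0 \<le> H1_norm f" unfolding H1_norm_def sobolev_norm_freq by (simp add: infsum_nonneg)
  ultimately show "L2_set (\<lambda>k. cmod (of_real (sqrt (1 + freq k)) * fourier_coeff f k)) K \<le> H1_norm f"
    unfolding L2_set_def by (intro real_le_lsqrt) (auto simp: norm_mult power_mult_distrib add_nonneg_nonneg)
qed

lemma le_of_AE_le:
  fixes f :: "real \<Rightarrow> real"
  assumes f: "continuous_on {0..T} f" and T: "T > 0" and ae: "AE t in lebesgue_on {0..T}. f t \<le> M"
    and t: "t \<in> {0..T}"
  shows "f t \<le> M"
proof -
  define g where "g = (\<lambda>t. f (max 0 (min T t)))"
  have g: "continuous_on UNIV g"
    unfolding g_def using T by (intro continuous_on_compose2[OF f] continuous_intros) auto
  then have C: "closed {t. g t \<le> M}" by (intro closed_Collect_le continuous_on_const)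
  have "AE t in lebesgue. t \<in> {0..T} \<longrightarrow> f t \<le> M"
    using ae by (subst (asm) AE_restrict_space_iff) auto
  then have "AE t \<in> {0<..<T} in lebesgue. t \<in> {t. g t \<le> M}"
    by eventually_elim (auto simp: g_def)
  then have "{0<..<T} \<subseteq> {t. g t \<le> M}"
    using mem_closed_if_AE_lebesgue_open[OF open_greaterThanLessThan C] by blast
  then have "closure {0<..<T} \<subseteq> {t. g t \<le> M}" using C by (rule closure_minimal)
  then show ?thesis using t T by (auto simp: g_def closure_greaterThanLessThan)
qed

text \<open>The Sobolev bound passes from almost all to all times because each finite partial sum of the norm is
  continuous in time. The absolute value of \<open>M\<close> provides a nonnegative constant before any solution
  is known to exist.\<close>

lemma NLS_coefficient_solution:
  assumes T: "T > 0" and \<mu>: "\<mu> \<in> {1, -1}" and sol: "NLS_solution T \<mu> u0 u"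
    and M: "Linf_H1_norm T u = ereal M"
  shows "coefficient_solution T \<mu> \<bar>M\<bar> (embed_const * \<bar>M\<bar>) (\<lambda>t. fourier_coeff (u t))"
proof
  show "\<bar>\<mu>\<bar> = 1" using \<mu> by auto
  obtain v where v: "sobolev_has_derivative (-1) T (\<lambda>t. fourier_coeff (u t)) v"
    "\<And>t k. t \<in> {0..T} \<Longrightarrow> \<i> * v t k + dist_deriv (dist_deriv (fourier_coeff (u t))) k =
             of_real \<mu> * fourier_coeff (\<lambda>x. (of_real (cmod (u t x)))\<^sup>2 * u t x) k"
    using sol unfolding NLS_solution_def by blast
  have H1: "u t \<in> H1_torus" if "t \<in> {0..T}" for t
    using sol that by (simp add: NLS_solution_def)
  have deriv: "((\<lambda>t. fourier_coeff (u t) k) has_vector_derivative v t k) (at t within {0..T})" if "t \<in> {0..T}" for t k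
    by (rule sobolev_has_derivative_component[OF v(1) that])
  have cont: "continuous_on {0..T} (\<lambda>t. fourier_coeff (u t) k)" for k
    using has_vector_derivative_continuous[OF deriv] by (simp add: continuous_on_eq_continuous_within)
  have ae: "AE t in lebesgue_on {0..T}. H1_norm (u t) \<le> M"
    using esssup_AE[of "\<lambda>t. ereal (H1_norm (u t))" "lebesgue_on {0..T}"] M
    by (simp add: Linf_H1_norm_def)
  fix t assume t: "t \<in> {0..T}"
  show h1: "h1_le (fourier_coeff (u t)) \<bar>M\<bar>"
    unfolding h1_le_def l2_le_def
  proof (intro allI impI)
    fix K :: "int set" assume K: "finite K"
    define f where "f = (\<lambda>t. L2_set (\<lambda>k. cmod (of_real (sqrt (1 + freq k)) * fourier_coeff (u t) k)) K)"
    have "continuous_on {0..T} f"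
      unfolding f_def L2_set_def by (intro continuous_intros cont)
    moreover have "AE t in lebesgue_on {0..T}. f t \<le> M"
      using ae AE_space
    proof eventually_elim
      case (elim t)
      have "f t \<le> H1_norm (u t)"
        using H1_torus_h1_le[OF H1, of t] elim K by (auto simp: h1_le_def l2_le_def f_def)
      then show ?case using elim by simp
    qed
    ultimately have "f t \<le> M" using T t by (intro le_of_AE_le[of T f M t])
    then show "L2_set (\<lambda>k. cmod (of_real (sqrt (1 + freq k)) * fourier_coeff (u t) k)) K \<le> \<bar>M\<bar>"
      by (simp add: f_def)
  qed
  show l1: "l1_le (fourier_coeff (u t)) (embed_const * \<bar>M\<bar>)"
    by (rule h1_le_l1_le[OF h1])
  fix k
  have L2: "u t \<in> L2_torus" using H1[OF t] by (simp add: H1_torus_def)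
  note s = l1_le_summable_coeffs[OF l1]
  have "fourier_coeff (\<lambda>x. (of_real (cmod (u t x)))\<^sup>2 * u t x) = cubic (fourier_coeff (u t))"
    unfolding cubic_def
  proof (rule fourier_coeff_cong_AE)
    show "AE x in torus. (complex_of_real (cmod (u t x)))\<^sup>2 * u t x =
        (complex_of_real (cmod (fser (fourier_coeff (u t)) x)))\<^sup>2 * fser (fourier_coeff (u t)) x"
      using AE_eq_fser[OF L2 s] by eventually_elim simp
    have [measurable]: "u t \<in> borel_measurable torus" using L2 by (rule L2_torus_measurable)
    show "(\<lambda>x. (complex_of_real (cmod (u t x)))\<^sup>2 * u t x) \<in> borel_measurable torus"
      by measurable
    show "(\<lambda>x. (complex_of_real (cmod (fser (fourier_coeff (u t)) x)))\<^sup>2 * fser (fourier_coeff (u t)) x) \<in> borel_measurable torus"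
      by (intro measurable_period_continuous continuous_intros s)
  qed
  then have "\<i> * v t k + dist_deriv (dist_deriv (fourier_coeff (u t))) k = of_real \<mu> * cubic (fourier_coeff (u t)) k"
    using v(2)[OF t, of k] by simp
  moreover have "dist_deriv (dist_deriv (fourier_coeff (u t))) k = - of_real (freq k) * fourier_coeff (u t) k"
    by (simp add: dist_deriv_def freq_def power2_eq_square mult_ac)
  ultimately have iv: "\<i> * v t k = of_real \<mu> * cubic (fourier_coeff (u t)) k + of_real (freq k) * fourier_coeff (u t) k"
    by (simp add: algebra_simps)
  have "v t k = - \<i> * (\<i> * v t k)" by simp
  then have "v t k = - \<i> * of_real (freq k) * fourier_coeff (u t) k - \<i> * of_real \<mu> * cubic (fourier_coeff (u t)) k"
    unfolding iv by (simp add: distrib_left mult.assoc)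
  then show "((\<lambda>t. fourier_coeff (u t) k) has_vector_derivative
        - \<i> * of_real (freq k) * fourier_coeff (u t) k - \<i> * of_real \<mu> * cubic (fourier_coeff (u t)) k) (at t within {0..T})"
    using deriv[OF t, of k] by simp
qed

section \<open>Stability and convergence\<close>

lemma h1_le_diff: "h1_le c A \<Longrightarrow> h1_le d B \<Longrightarrow> h1_le (\<lambda>k. c k - d k) (A + B)"
  unfolding h1_le_def using l2_le_diff by (fastforce simp: right_diff_distrib)

lemma scheme_step_lipschitz:
  assumes "l1_le a R" "l1_le b R" "l2_le (\<lambda>k. a k - b k) B" "0 \<le> \<tau>" "\<bar>\<mu>\<bar> = 1"
  shows "l2_le (\<lambda>k. scheme_step \<tau> \<mu> a k - scheme_step \<tau> \<mu> b k) ((1 + 4 * \<tau> * R\<^sup>2) * B)"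
proof -
  have "l2_le (\<lambda>k. (a k - b k) - \<i> * of_real \<mu> * (scheme_cubic \<tau> a k - scheme_cubic \<tau> b k))
      (B + 1 * (4 * \<tau> * R\<^sup>2 * B))"
    using assms by (intro l2_le_diff l2_le_mult scheme_cubic_lipschitz) (auto simp: norm_mult)
  then have "l2_le (flow \<tau> (\<lambda>k. (a k - b k) - \<i> * of_real \<mu> * (scheme_cubic \<tau> a k - scheme_cubic \<tau> b k)))
      (B + 1 * (4 * \<tau> * R\<^sup>2 * B))"
    by (simp add: l2_le_def)
  moreover have "flow \<tau> (\<lambda>k. (a k - b k) - \<i> * of_real \<mu> * (scheme_cubic \<tau> a k - scheme_cubic \<tau> b k))
      = (\<lambda>k. scheme_step \<tau> \<mu> a k - scheme_step \<tau> \<mu> b k)"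
    by (auto simp: scheme_step_def flow_def algebra_simps)
  ultimately show ?thesis by (simp add: algebra_simps)
qed

lemma scheme_step_l2_le:
  assumes "l1_le a R" "l2_le a B" "0 \<le> \<tau>" "\<bar>\<mu>\<bar> = 1"
  shows "l2_le (scheme_step \<tau> \<mu> a) ((1 + 4 * \<tau> * R\<^sup>2) * B)"
proof -
  have "l2_le (\<lambda>k. scheme_step \<tau> \<mu> a k - scheme_step \<tau> \<mu> (\<lambda>k. 0) k) ((1 + 4 * \<tau> * R\<^sup>2) * B)"
    using assms l1_le_nonneg[OF assms(1)] by (intro scheme_step_lipschitz) (auto simp: l1_le_def)
  moreover have "scheme_step \<tau> \<mu> (\<lambda>k. 0) = (\<lambda>k. 0)"
    by (rule ext) (simp add: scheme_step_def flow_def scheme_cubic_0)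
  ultimately show ?thesis by simp
qed

lemma scheme_step_dx:
  assumes "l1_le a R" "l2_le (dx a) B" "0 \<le> \<tau>" "\<bar>\<mu>\<bar> = 1"
  shows "l2_le (dx (scheme_step \<tau> \<mu> a)) ((1 + 4 * \<tau> * R\<^sup>2) * B)"
proof -
  have "l2_le (\<lambda>k. dx a k - \<i> * of_real \<mu> * dx (scheme_cubic \<tau> a) k) (B + 1 * (4 * \<tau> * R\<^sup>2 * B))"
    using assms by (intro l2_le_diff l2_le_mult scheme_cubic_dx) (auto simp: norm_mult)
  then have "l2_le (flow \<tau> (\<lambda>k. dx a k - \<i> * of_real \<mu> * dx (scheme_cubic \<tau> a) k)) (B + 1 * (4 * \<tau> * R\<^sup>2 * B))"
    by (simp add: l2_le_def)
  moreover have "flow \<tau> (\<lambda>k. dx a k - \<i> * of_real \<mu> * dx (scheme_cubic \<tau> a) k) = dx (scheme_step \<tau> \<mu> a)"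
    by (auto simp: scheme_step_def flow_def dx_def algebra_simps)
  ultimately show ?thesis by (simp add: algebra_simps)
qed

text \<open>The constant in the bound for the sum of all local errors. The second summand stems from the Strichartz
  estimate on an interval that covers \<open>[0, T + 1]\<close>.\<close>

definition consistency_const :: "real \<Rightarrow> real \<Rightarrow> real \<Rightarrow> real" where
  "consistency_const T M R =
     T * (3 * R\<^sup>2 * (3 * R\<^sup>2 * M + M) + 3 * R + 4 * R\<^sup>2 * M) +
     3 * R * (4 * (real (nat \<lceil>2 * pi * (T + 1)\<rceil>) / (2 * pi)) * (M + 1 + T * (3 * R\<^sup>2 * M + 1)) ^ 4)"

context coefficient_solution
begin

lemma summed_local_error:
  assumes T: "0 < T" and \<tau>: "0 < \<tau>" "\<tau> \<le> 1" and N: "real N * \<tau> \<le> T"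
  obtains \<delta> where "\<And>n. n < N \<Longrightarrow> l2_le (\<lambda>k. c (real (Suc n) * \<tau>) k - scheme_step \<tau> \<mu> (c (real n * \<tau>)) k) (\<delta> n)"
    and "\<And>n. 0 \<le> \<delta> n" and "sum \<delta> {..<N} \<le> consistency_const T M R * \<tau>"
proof -
  have M0: "0 \<le> M" using l2_le_nonneg[OF l2_le_c[of 0]] T by simp
  have R0: "0 \<le> R" using l1_le_nonneg[OF l1[of 0]] T by simp
  have tn: "real n * \<tau> \<in> {0..T}" if "n \<le> N" for n
  proof -
    have "real n * \<tau> \<le> real N * \<tau>" using that \<tau> by simp
    with N have "real n * \<tau> \<le> T" by linarith
    then show ?thesis using \<tau> by simp
  qed
  \<comment> \<open>Cutting off at frequency \<open>1 / \<tau>\<close> costs only \<open>O(\<tau>)\<close> in \<open>L\<^sup>2\<close>.\<close>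
  define J where "J = nat \<lceil>1 / \<tau>\<rceil>"
  have "1 / \<tau> \<le> real J" unfolding J_def by linarith
  then have J: "1 \<le> real J * \<tau>" using \<tau> by (simp add: field_simps)
  define w where "w = (\<lambda>n. trunc J (flow (- (real n * \<tau>)) (c (real n * \<tau>))))"
  have fw: "flow (real n * \<tau>) (w n) = trunc J (c (real n * \<tau>))" for n
    by (simp add: w_def flow_flow flip: trunc_flow)
  define I where "I = (\<lambda>n. integral {0..2 * \<tau>} (quartic (dx (trunc J (c (real n * \<tau>))))))"
  have I0: "0 \<le> I n" for n
    unfolding I_def
    by (intro Henstock_Kurzweil_Integration.integral_nonneg integrable_continuous_interval
        continuous_on_quartic[OF band_limited_dx[OF band_limited_trunc]] quartic_nonneg)
  \<comment> \<open>The interval of \<open>m\<close> periods \<open>1 / (2 \<pi>)\<close> covers \<open>[0, T + 1]\<close>.\<close>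
  define m where "m = nat \<lceil>2 * pi * (T + 1)\<rceil>"
  \<comment> \<open>The added ones only serve to keep the weights in the telescoping argument positive.\<close>
  define D where "D = M + 1 + T * (3 * R\<^sup>2 * M + 1)"
  have sumI: "(\<Sum>n<N. I n) \<le> 4 * (real m / (2 * pi)) * D ^ 4"
    unfolding I_def fw[symmetric]
  proof (rule strichartz_along_profile)
    show "band_limited J (w n)" for n by (simp add: w_def)
    show "l2_le (dx (w 0)) (M + 1)"
      by (rule l2_le_cmod_mono[OF l2_le_mono[OF l2_le_dx_c[of 0]]])
        (use T in \<open>auto simp: w_def trunc_def dx_def\<close>)
    show "0 < M + 1" using M0 by simp
    show "0 < \<tau> * (3 * R\<^sup>2 * M + 1)" using \<tau> M0 by (intro mult_pos_pos add_nonneg_pos) auto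
    show "0 \<le> \<tau>" using \<tau> by simp
    show "l2_le (dx (\<lambda>k. w (Suc n) k - w n k)) (\<tau> * (3 * R\<^sup>2 * M + 1))" if n: "Suc n < N" for n
    proof -
      have "real n * \<tau> + \<tau> = real (Suc n) * \<tau>" by (simp add: algebra_simps)
      then have "l2_le (dx (\<lambda>k. flow (- \<tau>) (c (real (Suc n) * \<tau>)) k - c (real n * \<tau>) k)) (\<tau> * (3 * R\<^sup>2 * M))"
        using profile_lipschitz(2)[of "real n * \<tau>" \<tau>] tn[of n] tn[of "Suc n"] n \<tau> by simp
      then have "l2_le (dx (\<lambda>k. flow (- \<tau>) (c (real (Suc n) * \<tau>)) k - c (real n * \<tau>) k)) (\<tau> * (3 * R\<^sup>2 * M + 1))"
        using \<tau> by (elim l2_le_mono) (simp add: algebra_simps)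
      then show ?thesis
      proof (rule l2_le_cmod_mono)
        fix k
        have "dx (\<lambda>k. w (Suc n) k - w n k) k =
            trunc J (flow (- (real n * \<tau>)) (dx (\<lambda>k. flow (- \<tau>) (c (real (Suc n) * \<tau>)) k - c (real n * \<tau>) k))) k"
        proof -
          have "cis (freq k * (real (Suc n) * \<tau>)) = cis (freq k * (real n * \<tau>)) * cis (freq k * \<tau>)"
            by (simp add: cis_mult algebra_simps)
          then show ?thesis
            by (simp add: w_def trunc_def flow_def dx_def algebra_simps del: of_nat_Suc)
        qed
        then show "cmod (dx (\<lambda>k. w (Suc n) k - w n k) k) \<le>
            cmod (dx (\<lambda>k. flow (- \<tau>) (c (real (Suc n) * \<tau>)) k - c (real n * \<tau>) k) k)"
          by (simp add: trunc_def)
      qed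
    qed
    show "(real N + 1) * \<tau> \<le> real m / (2 * pi)"
    proof -
      have "(real N + 1) * \<tau> \<le> T + 1" using N \<tau> by (simp add: algebra_simps)
      moreover have "2 * pi * (T + 1) \<le> real m" unfolding m_def by linarith
      then have "T + 1 \<le> real m / (2 * pi)" by (simp add: field_simps)
      ultimately show ?thesis by simp
    qed
    show "M + 1 + real N * (\<tau> * (3 * R\<^sup>2 * M + 1)) \<le> D"
    proof -
      have "real N * \<tau> * (3 * R\<^sup>2 * M + 1) \<le> T * (3 * R\<^sup>2 * M + 1)"
        using N M0 by (intro mult_right_mono) auto
      then show ?thesis by (simp add: D_def mult_ac)
    qed
  qed
  define A where "A = 3 * R\<^sup>2 * (3 * R\<^sup>2 * M + M) + 3 * R + 4 * R\<^sup>2 * M"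
  have A0: "0 \<le> A" unfolding A_def using M0 R0 by simp
  define \<delta> where "\<delta> = (\<lambda>n. \<tau> * \<tau> * A + 3 * R * \<tau> * I n)"
  show ?thesis
  proof (rule that[of \<delta>])
    show "0 \<le> \<delta> n" for n unfolding \<delta>_def using \<tau> R0 A0 I0 by simp
    fix n assume n: "n < N"
    have e: "real n * \<tau> + \<tau> = real (Suc n) * \<tau>" by (simp add: algebra_simps)
    have "l2_le (\<lambda>k. c (real n * \<tau> + \<tau>) k - scheme_step \<tau> \<mu> (c (real n * \<tau>)) k)
      (\<tau> * (3 * R\<^sup>2 * (\<tau> * (3 * R\<^sup>2 * M) + \<tau> * M) +
       R * (3 * integral {0..2 * \<tau>} (quartic (dx (trunc J (c (real n * \<tau>))))) + 3 * \<tau>)) + 4 * \<tau> * R\<^sup>2 * (\<tau> * M))"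
      using tn[of n] tn[of "Suc n"] n \<tau> J unfolding e by (intro local_error[of "real n * \<tau>" \<tau> J, unfolded e]) auto
    moreover have "\<tau> * (3 * R\<^sup>2 * (\<tau> * (3 * R\<^sup>2 * M) + \<tau> * M) +
       R * (3 * I n + 3 * \<tau>)) + 4 * \<tau> * R\<^sup>2 * (\<tau> * M) = \<delta> n"
      by (simp add: \<delta>_def A_def algebra_simps)
    ultimately show "l2_le (\<lambda>k. c (real (Suc n) * \<tau>) k - scheme_step \<tau> \<mu> (c (real n * \<tau>)) k) (\<delta> n)"
      unfolding e I_def by simp
  next
    have "sum \<delta> {..<N} = real N * \<tau> * A * \<tau> + 3 * R * (\<Sum>n<N. I n) * \<tau>"
      by (simp add: \<delta>_def sum.distrib sum_distrib_left sum_distrib_right mult_ac)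
    also have "\<dots> \<le> T * A * \<tau> + 3 * R * (4 * (real m / (2 * pi)) * D ^ 4) * \<tau>"
      using N A0 \<tau> R0 sumI by (intro add_mono mult_right_mono mult_left_mono) auto
    also have "\<dots> = consistency_const T M R * \<tau>"
      by (simp only: consistency_const_def A_def D_def m_def distrib_right)
    finally show "sum \<delta> {..<N} \<le> consistency_const T M R * \<tau>" .
  qed
qed

text \<open>Discrete Gronwall argument, conditional on an \<open>l\<^sup>1\<close> bound for the previous iterates only.\<close>

lemma conditional_bounds:
  fixes a :: "nat \<Rightarrow> int \<Rightarrow> complex"
  assumes T: "0 < T" and \<tau>: "0 < \<tau>" "\<tau> \<le> 1" and N: "real N * \<tau> \<le> T"
    and a: "a 0 = c 0" "\<And>n. n < N \<Longrightarrow> a (Suc n) = scheme_step \<tau> \<mu> (a n)"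
    and S: "\<And>n. n < N \<Longrightarrow> l1_le (a n) S" "R \<le> S"
  shows "l2_le (\<lambda>k. c (real N * \<tau>) k - a N k) (exp (4 * S\<^sup>2 * T) * consistency_const T M R * \<tau>)"
    and "h1_le (a N) (2 * exp (4 * S\<^sup>2 * T) * M)"
proof -
  have M0: "0 \<le> M" using l2_le_nonneg[OF l2_le_c[of 0]] T by simp
  \<comment> \<open>Growth factor of one step of the scheme, in \<open>L\<^sup>2\<close> and for the derivative alike.\<close>
  define q where "q = 1 + 4 * \<tau> * S\<^sup>2"
  have q: "1 \<le> q" using \<tau> by (simp add: q_def)
  have qN: "q ^ N \<le> exp (4 * S\<^sup>2 * T)"
  proof -
    have "q \<le> exp (4 * \<tau> * S\<^sup>2)" unfolding q_def by (rule exp_ge_add_one_self)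
    then have "q ^ N \<le> exp (4 * \<tau> * S\<^sup>2) ^ N" using q by (intro power_mono) auto
    also have "\<dots> = exp (4 * S\<^sup>2 * (real N * \<tau>))" by (simp add: mult_ac flip: exp_of_nat_mult)
    also have "\<dots> \<le> exp (4 * S\<^sup>2 * T)" using N by (simp add: mult_left_mono)
    finally show ?thesis .
  qed
  obtain \<delta> where \<delta>: "\<And>n. n < N \<Longrightarrow> l2_le (\<lambda>k. c (real (Suc n) * \<tau>) k - scheme_step \<tau> \<mu> (c (real n * \<tau>)) k) (\<delta> n)"
    "\<And>n. 0 \<le> \<delta> n" "sum \<delta> {..<N} \<le> consistency_const T M R * \<tau>"
    using summed_local_error[OF T \<tau> N] by blast
  have tn: "real n * \<tau> \<in> {0..T}" if "n \<le> N" for n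
  proof -
    have "real n * \<tau> \<le> real N * \<tau>" using that \<tau> by simp
    with N have "real n * \<tau> \<le> T" by linarith
    then show ?thesis using \<tau> by simp
  qed
  have "l2_le (\<lambda>k. c (real n * \<tau>) k - a n k) (q ^ n * sum \<delta> {..<n})" if "n \<le> N" for n
    using that
  proof (induction n)
    case 0
    then show ?case by (simp add: a l2_le_def L2_set_def)
  next
    case (Suc n)
    have "l2_le (\<lambda>k. scheme_step \<tau> \<mu> (c (real n * \<tau>)) k - scheme_step \<tau> \<mu> (a n) k) (q * (q ^ n * sum \<delta> {..<n}))"
      unfolding q_def
      using Suc S \<tau> \<mu> tn[of n] by (intro scheme_step_lipschitz l1_le_mono[OF l1]) (auto simp: q_def)
    from l2_le_add[OF \<delta>(1)[of n] this] Suc.prems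
    have "l2_le (\<lambda>k. c (real (Suc n) * \<tau>) k - a (Suc n) k) (\<delta> n + q * (q ^ n * sum \<delta> {..<n}))"
      by (simp add: a)
    moreover have "1 * \<delta> n \<le> q ^ Suc n * \<delta> n"
      using q \<delta>(2) by (intro mult_right_mono one_le_power) auto
    then have "\<delta> n + q * (q ^ n * sum \<delta> {..<n}) \<le> q ^ Suc n * sum \<delta> {..<Suc n}"
      by (simp add: algebra_simps)
    ultimately show ?case by (rule l2_le_mono)
  qed
  from this[of N] have "l2_le (\<lambda>k. c (real N * \<tau>) k - a N k) (q ^ N * sum \<delta> {..<N})" by simp
  moreover have "q ^ N * sum \<delta> {..<N} \<le> exp (4 * S\<^sup>2 * T) * (consistency_const T M R * \<tau>)"
    using qN \<delta> by (intro mult_mono sum_nonneg) auto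
  ultimately show "l2_le (\<lambda>k. c (real N * \<tau>) k - a N k) (exp (4 * S\<^sup>2 * T) * consistency_const T M R * \<tau>)"
    by (auto intro: l2_le_mono simp: mult.assoc)
  have "l2_le (a n) (q ^ n * M) \<and> l2_le (dx (a n)) (q ^ n * M)" if "n \<le> N" for n
    using that
  proof (induction n)
    case 0
    then show ?case using l2_le_c l2_le_dx_c T by (simp add: a)
  next
    case (Suc n)
    then show ?case
      using scheme_step_l2_le[OF S(1)[of n], of "q ^ n * M" \<tau> \<mu>] scheme_step_dx[OF S(1)[of n], of "q ^ n * M" \<tau> \<mu>] \<tau> \<mu>
      by (simp add: a q_def mult.assoc)
  qed
  from this[of N] have "h1_le (a N) (q ^ N * M + q ^ N * M)" by (intro h1_leI) auto
  moreover have "q ^ N * M + q ^ N * M \<le> 2 * exp (4 * S\<^sup>2 * T) * M"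
    using mult_right_mono[OF qN M0] by linarith
  ultimately show "h1_le (a N) (2 * exp (4 * S\<^sup>2 * T) * M)"
    unfolding h1_le_def by (rule l2_le_mono)
qed

end

lemma l1_le_from_low_and_high:
  assumes "\<And>K. finite K \<Longrightarrow> K \<inter> J = {} \<Longrightarrow> (\<Sum>k\<in>K. cmod (e k)) \<le> A" and J: "finite J" and e: "l2_le e B"
  shows "l1_le e (sqrt (real (card J)) * B + A)"
  unfolding l1_le_def
proof (intro allI impI)
  fix K :: "int set" assume K: "finite K"
  have "(\<Sum>k\<in>K \<inter> J. cmod (e k)) \<le> (\<Sum>k\<in>J. \<bar>1\<bar> * \<bar>cmod (e k)\<bar>)"
    using J by (simp, intro sum_mono2) auto
  also have "\<dots> \<le> L2_set (\<lambda>k. 1) J * L2_set (\<lambda>k. cmod (e k)) J"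
    by (rule L2_set_mult_ineq)
  also have "\<dots> \<le> sqrt (real (card J)) * B"
  proof (rule mult_mono[OF _ l2_leD[OF e J]])
    show "L2_set (\<lambda>k. 1) J \<le> sqrt (real (card J))" by (simp add: L2_set_def)
  qed (simp_all add: L2_set_nonneg)
  finally have "(\<Sum>k\<in>K \<inter> J. cmod (e k)) \<le> sqrt (real (card J)) * B" .
  moreover have "(\<Sum>k\<in>K - J. cmod (e k)) \<le> A" using K by (intro assms(1)) auto
  moreover have "(\<Sum>k\<in>K. cmod (e k)) = (\<Sum>k\<in>K \<inter> J. cmod (e k)) + (\<Sum>k\<in>K - J. cmod (e k))"
    using K by (subst sum.union_disjoint[symmetric]) (auto intro: sum.cong)
  ultimately show "(\<Sum>k\<in>K. cmod (e k)) \<le> sqrt (real (card J)) * B + A" by simp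
qed

text \<open>The bootstrap argument. As long as the earlier iterates are bounded in \<open>l\<^sup>1\<close> by \<open>R + 1\<close>, the error of
  the next one is at most \<open>C \<tau>\<close> in \<open>L\<^sup>2\<close> and bounded in \<open>H\<^sup>1\<close>. Hence it is at most \<open>1\<close> in \<open>l\<^sup>1\<close> for
  small \<open>\<tau>\<close>, and the bound \<open>R + 1\<close> persists.\<close>

theorem coefficient_convergence:
  fixes T M R :: real
  assumes T: "0 < T"
  obtains C \<tau>0 where "C > 0" "0 < \<tau>0" "\<tau>0 \<le> 1"
    "\<And>\<mu> c \<tau> N. coefficient_solution T \<mu> M R c \<Longrightarrow> 0 < \<tau> \<Longrightarrow> \<tau> \<le> \<tau>0 \<Longrightarrow> real N * \<tau> \<le> T \<Longrightarrow>
      l2_le (\<lambda>k. c (real N * \<tau>) k - (scheme_step \<tau> \<mu> ^^ N) (c 0) k) (C * \<tau>) \<and>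
      l1_le ((scheme_step \<tau> \<mu> ^^ N) (c 0)) (R + 1) \<and> (\<exists>B. h1_le ((scheme_step \<tau> \<mu> ^^ N) (c 0)) B)"
proof -
  define S where "S = R + 1"
  define C where "C = \<bar>exp (4 * S\<^sup>2 * T) * consistency_const T M R\<bar> + 1"
  define G where "G = \<bar>M\<bar> + \<bar>2 * exp (4 * S\<^sup>2 * T) * M\<bar>"
  have C: "C > 0" by (simp add: C_def add_nonneg_pos)
  have G: "G \<ge> 0" by (simp add: G_def)
  obtain J where J: "finite J"
    "\<And>c B K. h1_le c B \<Longrightarrow> finite K \<Longrightarrow> K \<inter> J = {} \<Longrightarrow> (\<Sum>k\<in>K. cmod (c k)) \<le> 1 / (2 * (G + 1)) * B"
    using h1_le_l1_tail[of "1 / (2 * (G + 1))"] G by auto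
  define Q where "Q = sqrt (real (card J))"
  \<comment> \<open>This makes the low frequencies contribute at most \<open>1 / 2\<close>; the choice of \<open>J\<close> does the same
    for the high ones.\<close>
  define \<tau>0 where "\<tau>0 = min 1 (1 / (2 * (Q * C + 1)))"
  have Q: "0 \<le> Q" by (simp add: Q_def)
  then have QC: "0 < 2 * (Q * C + 1)" using C by (simp add: add_nonneg_pos)
  show ?thesis
  proof (rule that[OF C])
    show "0 < \<tau>0" "\<tau>0 \<le> 1" using QC by (auto simp: \<tau>0_def)
    fix \<mu> c \<tau> N
    assume sol: "coefficient_solution T \<mu> M R c" and \<tau>: "0 < \<tau>" "\<tau> \<le> \<tau>0" and N: "real N * \<tau> \<le> T"
    interpret coefficient_solution T \<mu> M R c by fact
    have \<tau>1: "\<tau> \<le> 1" using \<tau> by (simp add: \<tau>0_def)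
    define a where "a = (\<lambda>n. (scheme_step \<tau> \<mu> ^^ n) (c 0))"
    have small: "Q * (C * \<tau>) \<le> 1 / 2"
    proof -
      have "\<tau> \<le> 1 / (2 * (Q * C + 1))" using \<tau> by (simp add: \<tau>0_def)
      then have "\<tau> * (2 * (Q * C + 1)) \<le> 1" using QC by (simp add: pos_le_divide_eq)
      then show ?thesis using \<tau> by (simp add: algebra_simps)
    qed
    have tn: "real n * \<tau> \<le> T" if "n \<le> N" for n
    proof -
      have "real n * \<tau> \<le> real N * \<tau>" using that \<tau> by simp
      then show ?thesis using N by linarith
    qed
    have main: "l2_le (\<lambda>k. c (real n * \<tau>) k - a n k) (C * \<tau>) \<and> l1_le (a n) S \<and> (\<exists>B. h1_le (a n) B)" if "n \<le> N" for n
      using that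
    proof (induction n rule: less_induct)
      case (less n)
      have l1a: "l1_le (a j) S" if "j < n" for j using less that by simp
      have cb: "l2_le (\<lambda>k. c (real n * \<tau>) k - a n k) (exp (4 * S\<^sup>2 * T) * consistency_const T M R * \<tau>)"
        "h1_le (a n) (2 * exp (4 * S\<^sup>2 * T) * M)"
        using conditional_bounds[OF T \<tau>(1) \<tau>1 tn[OF less.prems], of a S] l1a by (auto simp: a_def S_def)
      have "exp (4 * S\<^sup>2 * T) * consistency_const T M R * \<tau> \<le> C * \<tau>"
        using \<tau> unfolding C_def by (intro mult_right_mono) auto
      with cb(1) have e2: "l2_le (\<lambda>k. c (real n * \<tau>) k - a n k) (C * \<tau>)" by (rule l2_le_mono)
      have tnT: "real n * \<tau> \<in> {0..T}" using tn[OF less.prems] \<tau> by simp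
      have "h1_le (\<lambda>k. c (real n * \<tau>) k - a n k) (M + 2 * exp (4 * S\<^sup>2 * T) * M)"
        by (rule h1_le_diff[OF h1[OF tnT] cb(2)])
      then have eh: "h1_le (\<lambda>k. c (real n * \<tau>) k - a n k) G"
        unfolding h1_le_def by (rule l2_le_mono) (simp add: G_def)
      have half: "1 / (2 * (G + 1)) * G \<le> 1 / 2" using G by (simp add: field_simps)
      have "l1_le (\<lambda>k. c (real n * \<tau>) k - a n k) (Q * (C * \<tau>) + 1 / 2)"
        unfolding Q_def using J(2)[OF eh] half by (intro l1_le_from_low_and_high[OF _ J(1) e2]) (meson order_trans)
      then have "l1_le (\<lambda>k. c (real n * \<tau>) k - a n k) 1"
        using small by (elim l1_le_mono) simp
      from l1_le_diff[OF l1[OF tnT] this] have "l1_le (a n) S" by (simp add: S_def)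
      then show ?case using e2 cb(2) by blast
    qed
    from main[of N] show "l2_le (\<lambda>k. c (real N * \<tau>) k - (scheme_step \<tau> \<mu> ^^ N) (c 0) k) (C * \<tau>) \<and>
      l1_le ((scheme_step \<tau> \<mu> ^^ N) (c 0)) (R + 1) \<and> (\<exists>B. h1_le ((scheme_step \<tau> \<mu> ^^ N) (c 0)) B)"
      by (simp add: a_def S_def)
  qed
qed

theorem theorem1p2:
  fixes T M :: real
  assumes "T > 0"
  shows "\<exists>C>0. \<exists>\<tau>0>0. \<forall>\<mu>\<in>{1, -1 :: real}. \<forall>u0 u.
      u0 \<in> H1_torus \<longrightarrow>
      NLS_solution T \<mu> u0 u \<longrightarrow>
      (\<forall>t\<in>{0..T}. u t \<in> H1_torus) \<longrightarrow>
      Linf_H1_norm T u = ereal M \<longrightarrow>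
      (\<forall>\<tau>\<in>{0<..\<tau>0}. \<forall>n::nat. real n * \<tau> \<le> T \<longrightarrow>
         (\<lambda>x. u (real n * \<tau>) x - scheme \<tau> \<mu> u0 n x) \<in> L2_torus \<and>
         L2_norm (\<lambda>x. u (real n * \<tau>) x - scheme \<tau> \<mu> u0 n x) \<le> C * \<tau>)"
proof -
  define R where "R = embed_const * \<bar>M\<bar>"
  obtain C \<tau>0 where C: "C > 0" "0 < \<tau>0" "\<tau>0 \<le> 1" and
    conv: "\<And>\<mu> c \<tau> N. coefficient_solution T \<mu> \<bar>M\<bar> R c \<Longrightarrow> 0 < \<tau> \<Longrightarrow> \<tau> \<le> \<tau>0 \<Longrightarrow> real N * \<tau> \<le> T \<Longrightarrow>
      l2_le (\<lambda>k. c (real N * \<tau>) k - (scheme_step \<tau> \<mu> ^^ N) (c 0) k) (C * \<tau>) \<and>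
      l1_le ((scheme_step \<tau> \<mu> ^^ N) (c 0)) (R + 1) \<and> (\<exists>B. h1_le ((scheme_step \<tau> \<mu> ^^ N) (c 0)) B)"
    by (rule coefficient_convergence[OF assms, of "\<bar>M\<bar>" R], rule that)
  show ?thesis
  proof (rule exI[of _ C], rule conjI[OF C(1)], rule exI[of _ \<tau>0], rule conjI[OF C(2)], intro ballI allI impI)
    fix \<mu> u0 u \<tau> and n :: nat
    assume \<mu>: "\<mu> \<in> {1, - 1 :: real}" and u0: "u0 \<in> H1_torus" and sol: "NLS_solution T \<mu> u0 u"
      and M: "Linf_H1_norm T u = ereal M" and \<tau>: "\<tau> \<in> {0<..\<tau>0}" and n: "real n * \<tau> \<le> T"
    define c where "c = (\<lambda>t. fourier_coeff (u t))"
    interpret coefficient_solution T \<mu> "\<bar>M\<bar>" R c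
      unfolding c_def R_def by (rule NLS_coefficient_solution[OF assms \<mu> sol M])
    define a where "a = (\<lambda>n. (scheme_step \<tau> \<mu> ^^ n) (c 0))"
    have \<tau>0: "0 < \<tau>" using \<tau> by simp
    have uL2: "u t \<in> L2_torus" if "t \<in> {0..T}" for t
      using sol that by (auto simp: NLS_solution_def H1_torus_def)
    have c0: "fourier_coeff u0 = c 0"
      unfolding c_def
      using sol u0 uL2[of 0] assms
      by (intro fourier_coeff_cong_AE[symmetric] L2_torus_measurable) (auto simp: NLS_solution_def H1_torus_def)
    have bounds: "l2_le (\<lambda>k. c (real j * \<tau>) k - a j k) (C * \<tau>) \<and> l1_le (a j) (R + 1) \<and> (\<exists>B. h1_le (a j) B)"
      if "j \<le> n" for j
    proof -
      have "real j * \<tau> \<le> real n * \<tau>" using that \<tau> by simp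
      then show ?thesis
        unfolding a_def using conv[OF coefficient_solution_axioms, of \<tau> j] \<tau> n by auto
    qed
    have scheme: "scheme \<tau> \<mu> u0 j \<in> L2_torus \<and> fourier_coeff (scheme \<tau> \<mu> u0 j) = a j" if "j \<le> n" for j
      using that
    proof (induction j)
      case 0
      then show ?case using u0 c0 by (simp add: a_def H1_torus_def)
    next
      case (Suc j)
      then have IH: "scheme \<tau> \<mu> u0 j \<in> L2_torus" "fourier_coeff (scheme \<tau> \<mu> u0 j) = a j" by auto
      obtain B where B: "l1_le (a j) (R + 1)" "h1_le (a j) B" using bounds[of j] Suc.prems by auto
      have "h1_le (scheme_cubic \<tau> (a j)) (4 * \<tau> * (R + 1)\<^sup>2 * B + 4 * \<tau> * (R + 1)\<^sup>2 * B)"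
        using \<tau>0 by (intro h1_leI scheme_cubic_bound scheme_cubic_dx B h1_le_l2_le h1_le_dx) auto
      then have "summable_coeffs (scheme_cubic \<tau> (a j))"
        by (rule l1_le_summable_coeffs[OF h1_le_l1_le])
      from scheme_Suc_coeffs[OF \<tau>0 IH l1_le_summable_coeffs[OF B(1)] this]
      show ?case by (simp add: a_def del: scheme.simps)
    qed
    define e where "e = (\<lambda>k. c (real n * \<tau>) k - a n k)"
    define f where "f = (\<lambda>x. u (real n * \<tau>) x - scheme \<tau> \<mu> u0 n x)"
    have t: "real n * \<tau> \<in> {0..T}" using n \<tau>0 by simp
    have sc: "summable_coeffs (c (real n * \<tau>))" "summable_coeffs (a n)"
      using l1[OF t] bounds[of n] l1_le_summable_coeffs by auto
    have se: "summable_coeffs e" unfolding e_def by (intro summable_coeffs_diff sc)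
    have ae: "AE x in torus. f x = fser e x"
      using AE_eq_fser[OF uL2[OF t]] AE_eq_fser[of "scheme \<tau> \<mu> u0 n"] scheme[of n] sc
      by (auto simp: f_def e_def fser_diff c_def elim!: eventually_rev_mp)
    have mf: "f \<in> borel_measurable torus"
      unfolding f_def using uL2[OF t] scheme[of n]
      by (intro borel_measurable_diff L2_torus_measurable) auto
    have sq: "AE x in torus. (cmod (f x))\<^sup>2 = (cmod (fser e x))\<^sup>2"
      using ae by eventually_elim simp
    have mm: "(\<lambda>x. (cmod (f x))\<^sup>2) \<in> borel_measurable torus"
      "(\<lambda>x. (cmod (fser e x))\<^sup>2) \<in> borel_measurable torus"
      using mf by (measurable, intro measurable_period_continuous continuous_intros se)
    have "integrable torus (\<lambda>x. (cmod (f x))\<^sup>2)"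
      using L2_torus_fser[OF se] sq mm by (subst integrable_cong_AE[OF mm sq]) (simp add: L2_torus_def)
    moreover have "f (x + 1) = f x" for x
      using uL2[OF t] scheme[of n] by (simp add: f_def L2_torus_def)
    ultimately have "f \<in> L2_torus" using mf by (simp add: L2_torus_def)
    moreover have "L2_norm f \<le> C * \<tau>"
    proof -
      have "(LINT x|torus. (cmod (f x))\<^sup>2) = (LINT x|torus. (cmod (fser e x))\<^sup>2)"
        by (rule integral_cong_AE[OF mm sq])
      also have "\<dots> \<le> (C * \<tau>)\<^sup>2"
        using bounds[of n] by (intro parseval_le se) (simp add: e_def)
      finally show ?thesis
        unfolding L2_norm_def using C \<tau>0 by (intro real_le_lsqrt) auto
    qed
    ultimately show "(\<lambda>x. u (real n * \<tau>) x - scheme \<tau> \<mu> u0 n x) \<in> L2_torus \<and>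
      L2_norm (\<lambda>x. u (real n * \<tau>) x - scheme \<tau> \<mu> u0 n x) \<le> C * \<tau>"
      by (simp add: f_def)
  qed
qed

end
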